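(* Let $\mathcal{F}=\{F_1,F_2,\dots\}$ be a family of continuity moduli, $F_i$ intended for the $G$-variable of the action map $G\times B_i\to B_i$. (a) Let $G$ be a locally compact metric group and let $\pi$ be an $\mathcal{F}$-continuous unitary representation of $G$ on an (infinite-dimensional) complex Hilbert space $\mathbf{H}$. Then $\pi$ almost contains the unit representation $1_G$ if and only if the structure $A(G,\mathbf{H})$ belongs to $\mathcal{K}_\delta(\mathcal{F})$ for some $\delta\in(0,1)\cap\mathbb{Q}$. (b) Let $(G,d)$ be a locally compact metric group. Suppose that for every compact $Q\subseteq G$ and every $\varepsilon>0$ there is an $\mathcal{F}$-continuous unitary representation of $G$ on a complex Hilbert space which has a $(Q,\varepsilon)$-almost invariant unit vector but has no non-zero invariant vector. Then $G$ has an $\mathcal{F}$-continuous unitary representation on a complex Hilbert space $\mathbf{H}$ which almost contains $1_G$ but does not fix any vector of norm $1$. Moreover, every elementary substructure (in the sense of continuous logic) of the corresponding structure $A(G,\mathbf{H})$ is of the form $A(G_0,\mathbf{H}_0)$ with $G_0\preceq G$ and $\mathbf{H}_0\preceq\mathbf{H}$, and the corresponding representation of $G_0$ on $\mathbf{H}_0$ also almost contains $1_{G_0}$ and does not fix any vector of norm $1$.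
   Context: A metric group here is a group $G$ with a complete bi-invariant metric $d$ of diameter $\le 1$ (a continuous structure in the language $(d,\cdot,{}^{-1},1)$). Hilbert spaces are infinite-dimensional complex Hilbert spaces; $B_i=\{v:\|v\|\le i\}$. A continuity modulus is a function $F:(0,\infty)\to(0,\infty)$; a unitary representation $\pi$ of $G$ on $\mathbf{H}$ (written $g\circ v$) is $\mathcal{F}$-continuous if for each $i\ge1$, all $g,g'\in G$, $v\in B_i$ and $\varepsilon>0$: $d(g,g')<F_i(\varepsilon)$ implies $\|g\circ v-g'\circ v\|<\varepsilon$. For $Q\subseteq G$ and $\varepsilon>0$, a $(Q,\varepsilon)$-almost invariant unit vector is $v$ with $\|v\|=1$ and $\sup_{x\in Q}\|x\circ v-v\|<\varepsilon$. The representation almost contains $1_G$ if for every compact $Q\subseteq G$ and every $\varepsilon>0$ there is a $(Q,\varepsilon)$-almost invariant unit vector. $A(G,\mathbf{H})$ denotes the many-sorted continuous structure consisting of the sort $G$ with $d,\cdot,{}^{-1},1$; sorts $B_n$ ($n\in\omega$) with the metric $d(x,y)=\|x-y\|$, the constant $0$, the inclusions $I_{mn}:B_m\to B_n$ ($m<n$), scalar multiplications $\lambda_c$ ($c\in\mathbb{C}$), $+,-$, the real and imaginary parts of the inner product; and the action maps $\circ_m:G\times B_m\to B_m$. For $\delta\in(0,1)$ let $K_\delta=\{g\in G:d(1,g)\le\delta\}$, and let $a\dot{-}b=\max(a-b,0)$. $\mathcal{K}_\delta(\mathcal{F})$ is the class of such structures coming from $\mathcal{F}$-continuous unitary representations which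 satisfy, for all $k,m,n\in\omega\setminus\{0\}$, the condition $$\sup_{x_1,\dots,x_k\in G}\ \inf_{v\in B_m}\ \sup_{x\in\bigcup_{i=1}^k x_iK_\delta}\max\big(\|x\circ v-v\|\dot{-}\tfrac1n,\ |1-\|v\||\big)=0.$$ *)

theory Defs
  imports "HOL-Analysis.Analysis" "HOL-Algebra.Module"
begin

section \<open>Many-sorted continuous logic\<close>

text \<open>
  A signature has sorts of type \<open>'s\<close>, function symbols of type \<open>'f\<close> and predicate symbols of
  type \<open>'r\<close>; only the symbols in \<open>fsyms\<close> and \<open>rsyms\<close> belong to the language.  Every sort
  carries its metric as a logical symbol.  Constants are function symbols of arity 0.  Moduli of
  uniform continuity are not recorded in the signature, since they do not influence the values of
  formulas and every substructure inherits them; \<open>continuous_structure\<close> below requires that moduli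
  exist.
\<close>

record ('s, 'f, 'r) signat =
  fsyms :: "'f set"
  fargs :: "'f \<Rightarrow> 's list"
  fres  :: "'f \<Rightarrow> 's"
  rsyms :: "'r set"
  rargs :: "'r \<Rightarrow> 's list"

text \<open>
  The sorts of a structure are subsets of one type \<open>'u\<close>.  The interpretations are total
  functions, only the values on tuples from the appropriate sorts are meaningful.
\<close>

record ('s, 'f, 'r, 'u) mstruct =
  sort_set :: "'s \<Rightarrow> 'u set"
  metric   :: "'s \<Rightarrow> 'u \<Rightarrow> 'u \<Rightarrow> real"
  fint     :: "'f \<Rightarrow> 'u list \<Rightarrow> 'u"
  rint     :: "'r \<Rightarrow> 'u list \<Rightarrow> real"

definition tuples :: "('s, 'f, 'r, 'u) mstruct \<Rightarrow> 's list \<Rightarrow> 'u list set" where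
  "tuples M ss = {xs. list_all2 (\<lambda>x s. x \<in> sort_set M s) xs ss}"

definition tuples_close ::
    "('s, 'f, 'r, 'u) mstruct \<Rightarrow> 's list \<Rightarrow> real \<Rightarrow> 'u list \<Rightarrow> 'u list \<Rightarrow> bool" where
  "tuples_close M ss e xs ys \<longleftrightarrow>
     xs \<in> tuples M ss \<and> ys \<in> tuples M ss \<and>
     (\<forall>i < length ss. metric M (ss ! i) (xs ! i) (ys ! i) < e)"

definition continuous_structure ::
    "('s, 'f, 'r) signat \<Rightarrow> ('s, 'f, 'r, 'u) mstruct \<Rightarrow> bool" where
  "continuous_structure L M \<longleftrightarrow>
     (\<forall>s. sort_set M s \<noteq> {} \<and>
          Metric_space (sort_set M s) (metric M s) \<and>
          Metric_space.mcomplete (sort_set M s) (metric M s) \<and>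
          (\<exists>b. \<forall>x \<in> sort_set M s. \<forall>y \<in> sort_set M s. metric M s x y \<le> b)) \<and>
     (\<forall>f \<in> fsyms L.
          (\<forall>xs \<in> tuples M (fargs L f). fint M f xs \<in> sort_set M (fres L f)) \<and>
          (\<forall>\<epsilon>>0. \<exists>\<delta>>0. \<forall>xs ys. tuples_close M (fargs L f) \<delta> xs ys \<longrightarrow>
              metric M (fres L f) (fint M f xs) (fint M f ys) < \<epsilon>)) \<and>
     (\<forall>r \<in> rsyms L.
          (\<exists>b. \<forall>xs \<in> tuples M (rargs L r). \<bar>rint M r xs\<bar> \<le> b) \<and>
          (\<forall>\<epsilon>>0. \<exists>\<delta>>0. \<forall>xs ys. tuples_close M (rargs L r) \<delta> xs ys \<longrightarrow>
              \<bar>rint M r xs - rint M r ys\<bar> < \<epsilon>))"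

datatype ('s, 'f) trm = Var 's nat | Fun 'f "('s, 'f) trm list"

text \<open>
  \<open>Conn u [\<phi>\<^sub>0, \<dots>, \<phi>\<^sub>k]\<close> applies the connective \<open>u\<close> to finitely many formulas.  The connective is
  a continuous function on real sequences with the product topology, evaluated at the values of
  the formulas followed by zeros; these evaluations are exactly the continuous functions of
  finitely many real variables.
\<close>

datatype ('s, 'f, 'r) fml =
    Dist 's "('s, 'f) trm" "('s, 'f) trm"
  | Pred 'r "('s, 'f) trm list"
  | Conn "(nat \<Rightarrow> real) \<Rightarrow> real" "('s, 'f, 'r) fml list"
  | SupQ 's nat "('s, 'f, 'r) fml"
  | InfQ 's nat "('s, 'f, 'r) fml"

fun has_sort :: "('s, 'f, 'r) signat \<Rightarrow> ('s, 'f) trm \<Rightarrow> 's \<Rightarrow> bool" where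
  "has_sort L (Var s n) s' \<longleftrightarrow> s' = s"
| "has_sort L (Fun f ts) s' \<longleftrightarrow>
     f \<in> fsyms L \<and> s' = fres L f \<and> list_all2 (has_sort L) ts (fargs L f)"

fun wff :: "('s, 'f, 'r) signat \<Rightarrow> ('s, 'f, 'r) fml \<Rightarrow> bool" where
  "wff L (Dist s t u) \<longleftrightarrow> has_sort L t s \<and> has_sort L u s"
| "wff L (Pred r ts) \<longleftrightarrow> r \<in> rsyms L \<and> list_all2 (has_sort L) ts (rargs L r)"
| "wff L (Conn u \<phi>s) \<longleftrightarrow> continuous_on UNIV u \<and> (\<forall>\<phi> \<in> set \<phi>s. wff L \<phi>)"
| "wff L (SupQ s n \<phi>) \<longleftrightarrow> wff L \<phi>"
| "wff L (InfQ s n \<phi>) \<longleftrightarrow> wff L \<phi>"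

fun tval :: "('s, 'f, 'r, 'u) mstruct \<Rightarrow> ('s \<Rightarrow> nat \<Rightarrow> 'u) \<Rightarrow> ('s, 'f) trm \<Rightarrow> 'u" where
  "tval M a (Var s n) = a s n"
| "tval M a (Fun f ts) = fint M f (map (tval M a) ts)"

fun fval :: "('s, 'f, 'r, 'u) mstruct \<Rightarrow> ('s \<Rightarrow> nat \<Rightarrow> 'u) \<Rightarrow> ('s, 'f, 'r) fml \<Rightarrow> real" where
  "fval M a (Dist s t u) = metric M s (tval M a t) (tval M a u)"
| "fval M a (Pred r ts) = rint M r (map (tval M a) ts)"
| "fval M a (Conn u \<phi>s) =
     (let vs = map (fval M a) \<phi>s in u (\<lambda>i. if i < length vs then vs ! i else 0))"
| "fval M a (SupQ s n \<phi>) = (SUP x \<in> sort_set M s. fval M (a(s := (a s)(n := x))) \<phi>)"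
| "fval M a (InfQ s n \<phi>) = (INF x \<in> sort_set M s. fval M (a(s := (a s)(n := x))) \<phi>)"

definition substructure ::
    "('s, 'f, 'r) signat \<Rightarrow> ('s, 'f, 'r, 'u) mstruct \<Rightarrow> ('s, 'f, 'r, 'u) mstruct \<Rightarrow> bool" where
  "substructure L N M \<longleftrightarrow>
     (\<forall>s. sort_set N s \<subseteq> sort_set M s) \<and>
     (\<forall>s. \<forall>x \<in> sort_set N s. \<forall>y \<in> sort_set N s. metric N s x y = metric M s x y) \<and>
     (\<forall>f \<in> fsyms L. \<forall>xs \<in> tuples N (fargs L f). fint N f xs = fint M f xs) \<and>
     (\<forall>r \<in> rsyms L. \<forall>xs \<in> tuples N (rargs L r). rint N r xs = rint M r xs)"

text \<open>Equality of structures: equality up to the meaningless values of the interpretations.\<close>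

definition same_structure ::
    "('s, 'f, 'r) signat \<Rightarrow> ('s, 'f, 'r, 'u) mstruct \<Rightarrow> ('s, 'f, 'r, 'u) mstruct \<Rightarrow> bool" where
  "same_structure L N M \<longleftrightarrow> substructure L N M \<and> substructure L M N"

definition elementary_substructure ::
    "('s, 'f, 'r) signat \<Rightarrow> ('s, 'f, 'r, 'u) mstruct \<Rightarrow> ('s, 'f, 'r, 'u) mstruct \<Rightarrow> bool" where
  "elementary_substructure L N M \<longleftrightarrow>
     continuous_structure L N \<and> substructure L N M \<and>
     (\<forall>\<phi> a. wff L \<phi> \<longrightarrow> (\<forall>s n. a s n \<in> sort_set N s) \<longrightarrow> fval N a \<phi> = fval M a \<phi>)"


section \<open>Metric groups\<close>

locale metric_group = group G + Metric_space "carrier G" d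
  for G :: "'g monoid" (structure) and d :: "'g \<Rightarrow> 'g \<Rightarrow> real" +
  assumes complete: "mcomplete"
    and left_invariant:
      "\<lbrakk>x \<in> carrier G; y \<in> carrier G; z \<in> carrier G\<rbrakk> \<Longrightarrow> d (z \<otimes> x) (z \<otimes> y) = d x y"
    and right_invariant:
      "\<lbrakk>x \<in> carrier G; y \<in> carrier G; z \<in> carrier G\<rbrakk> \<Longrightarrow> d (x \<otimes> z) (y \<otimes> z) = d x y"
    and diameter_le_1: "\<lbrakk>x \<in> carrier G; y \<in> carrier G\<rbrakk> \<Longrightarrow> d x y \<le> 1"

abbreviation group_topology :: "'g monoid \<Rightarrow> ('g \<Rightarrow> 'g \<Rightarrow> real) \<Rightarrow> 'g topology" where
  "group_topology G d \<equiv> Metric_space.mtopology (carrier G) d"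

datatype gsym = GMul | GInv | GOne

text \<open>There are no predicate symbols besides the metric: the type \<open>unit\<close> is a dummy.\<close>

definition group_lang :: "(unit, gsym, unit) signat" where
  "group_lang =
    \<lparr>fsyms = UNIV,
     fargs = (\<lambda>f. case f of GMul \<Rightarrow> [(), ()] | GInv \<Rightarrow> [()] | GOne \<Rightarrow> []),
     fres = (\<lambda>_. ()),
     rsyms = {},
     rargs = (\<lambda>_. [])\<rparr>"

definition group_structure ::
    "'g monoid \<Rightarrow> ('g \<Rightarrow> 'g \<Rightarrow> real) \<Rightarrow> (unit, gsym, unit, 'g) mstruct" where
  "group_structure G d =
    \<lparr>sort_set = (\<lambda>_. carrier G),
     metric = (\<lambda>_. d),
     fint = (\<lambda>f xs. case f of
         GMul \<Rightarrow> xs ! 0 \<otimes>\<^bsub>G\<^esub> xs ! 1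
       | GInv \<Rightarrow> inv\<^bsub>G\<^esub> (xs ! 0)
       | GOne \<Rightarrow> \<one>\<^bsub>G\<^esub>),
     rint = (\<lambda>_ _. 0)\<rparr>"


section \<open>Infinite-dimensional complex Hilbert spaces\<close>

definition complex_field :: "complex ring" where
  "complex_field = \<lparr>carrier = UNIV, mult = (*), one = 1, zero = 0, add = (+)\<rparr>"

text \<open>The ring multiplication and unit contained in the library's \<open>module\<close> record play no role.\<close>

record 'h inner_module = "(complex, 'h) module" +
  inprod :: "'h \<Rightarrow> 'h \<Rightarrow> complex"

definition hnorm :: "'h inner_module \<Rightarrow> 'h \<Rightarrow> real" where
  "hnorm H v = sqrt (Re (inprod H v v))"

text \<open>
  The value 0 outside of the carrier is needed because the locale \<open>Metric_space\<close> demands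
  symmetry and non-negativity of the distance function on the whole type.
\<close>

definition hdist :: "'h inner_module \<Rightarrow> 'h \<Rightarrow> 'h \<Rightarrow> real" where
  "hdist H v w = (if v \<in> carrier H \<and> w \<in> carrier H then hnorm H (v \<ominus>\<^bsub>H\<^esub> w) else 0)"

definition hball :: "'h inner_module \<Rightarrow> nat \<Rightarrow> 'h set" where
  "hball H n = {v \<in> carrier H. hnorm H v \<le> real n}"

definition finite_dimensional :: "'h inner_module \<Rightarrow> bool" where
  "finite_dimensional H \<longleftrightarrow>
     (\<exists>B. finite B \<and> B \<subseteq> carrier H \<and>
       (\<forall>v \<in> carrier H. \<exists>c :: 'h \<Rightarrow> complex. v = (\<Oplus>\<^bsub>H\<^esub>b\<in>B. c b \<odot>\<^bsub>H\<^esub> b)))"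

locale hilbert_space = module complex_field H for H :: "'h inner_module" (structure) +
  assumes inprod_commute:
      "\<lbrakk>v \<in> carrier H; w \<in> carrier H\<rbrakk> \<Longrightarrow> inprod H v w = cnj (inprod H w v)"
    and inprod_add_left:
      "\<lbrakk>u \<in> carrier H; v \<in> carrier H; w \<in> carrier H\<rbrakk> \<Longrightarrow>
        inprod H (u \<oplus>\<^bsub>H\<^esub> v) w = inprod H u w + inprod H v w"
    and inprod_scale_left:
      "\<lbrakk>v \<in> carrier H; w \<in> carrier H\<rbrakk> \<Longrightarrow> inprod H (c \<odot>\<^bsub>H\<^esub> v) w = c * inprod H v w"
    and inprod_nonneg: "v \<in> carrier H \<Longrightarrow> Re (inprod H v v) \<ge> 0"
    and inprod_definite: "\<lbrakk>v \<in> carrier H; inprod H v v = 0\<rbrakk> \<Longrightarrow> v = \<zero>\<^bsub>H\<^esub>"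
    and complete: "Metric_space.mcomplete (carrier H) (hdist H)"
    and infinite_dimensional: "\<not> finite_dimensional H"

text \<open>
  The sort \<open>n\<close> is the ball \<open>B\<^sub>n\<close>.  The constant 0 lives in \<open>B\<^sub>0 = {0}\<close>; \<open>HIncl m n\<close> is the
  inclusion of \<open>B\<^sub>m\<close> into \<open>B\<^sub>n\<close> for \<open>m < n\<close>.  \<open>HScale m c\<close> maps \<open>B\<^sub>m\<close> to \<open>B\<^bsub>km\<^esub>\<close> for the unique
  integer \<open>k \<ge> 1\<close> with \<open>k - 1 \<le> |c| < k\<close>, and \<open>HAdd m\<close>, \<open>HSub m\<close> map \<open>B\<^sub>m \<times> B\<^sub>m\<close> to \<open>B\<^bsub>2m\<^esub>\<close>.
\<close>

datatype hsym = HZero | HIncl nat nat | HScale nat complex | HAdd nat | HSub nat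

datatype hpred = ReInner nat | ImInner nat

fun hsym_args :: "hsym \<Rightarrow> nat list" where
  "hsym_args HZero = []"
| "hsym_args (HIncl m n) = [m]"
| "hsym_args (HScale m c) = [m]"
| "hsym_args (HAdd m) = [m, m]"
| "hsym_args (HSub m) = [m, m]"

fun hsym_res :: "hsym \<Rightarrow> nat" where
  "hsym_res HZero = 0"
| "hsym_res (HIncl m n) = n"
| "hsym_res (HScale m c) = (nat \<lfloor>cmod c\<rfloor> + 1) * m"
| "hsym_res (HAdd m) = 2 * m"
| "hsym_res (HSub m) = 2 * m"

fun hpred_args :: "hpred \<Rightarrow> nat list" where
  "hpred_args (ReInner m) = [m, m]"
| "hpred_args (ImInner m) = [m, m]"

definition hilbert_lang :: "(nat, hsym, hpred) signat" where
  "hilbert_lang =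
    \<lparr>fsyms = UNIV - {HIncl m n | m n. \<not> m < n},
     fargs = hsym_args,
     fres = hsym_res,
     rsyms = UNIV,
     rargs = hpred_args\<rparr>"

definition hilbert_structure :: "'h inner_module \<Rightarrow> (nat, hsym, hpred, 'h) mstruct" where
  "hilbert_structure H =
    \<lparr>sort_set = hball H,
     metric = (\<lambda>_. hdist H),
     fint = (\<lambda>f vs. case f of
         HZero \<Rightarrow> \<zero>\<^bsub>H\<^esub>
       | HIncl m n \<Rightarrow> vs ! 0
       | HScale m c \<Rightarrow> c \<odot>\<^bsub>H\<^esub> (vs ! 0)
       | HAdd m \<Rightarrow> vs ! 0 \<oplus>\<^bsub>H\<^esub> vs ! 1
       | HSub m \<Rightarrow> vs ! 0 \<ominus>\<^bsub>H\<^esub> vs ! 1),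
     rint = (\<lambda>r vs. case r of
         ReInner m \<Rightarrow> Re (inprod H (vs ! 0) (vs ! 1))
       | ImInner m \<Rightarrow> Im (inprod H (vs ! 0) (vs ! 1)))\<rparr>"


section \<open>Unitary representations\<close>

definition unitary_operator :: "'h inner_module \<Rightarrow> ('h \<Rightarrow> 'h) \<Rightarrow> bool" where
  "unitary_operator H U \<longleftrightarrow>
     bij_betw U (carrier H) (carrier H) \<and>
     (\<forall>v \<in> carrier H. \<forall>w \<in> carrier H. U (v \<oplus>\<^bsub>H\<^esub> w) = U v \<oplus>\<^bsub>H\<^esub> U w) \<and>
     (\<forall>c. \<forall>v \<in> carrier H. U (c \<odot>\<^bsub>H\<^esub> v) = c \<odot>\<^bsub>H\<^esub> U v) \<and>
     (\<forall>v \<in> carrier H. \<forall>w \<in> carrier H. inprod H (U v) (U w) = inprod H v w)"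

definition unitary_representation :: "'g monoid \<Rightarrow> 'h inner_module \<Rightarrow> ('g \<Rightarrow> 'h \<Rightarrow> 'h) \<Rightarrow> bool" where
  "unitary_representation G H \<pi> \<longleftrightarrow>
     (\<forall>g \<in> carrier G. unitary_operator H (\<pi> g)) \<and>
     (\<forall>v \<in> carrier H. \<pi> \<one>\<^bsub>G\<^esub> v = v) \<and>
     (\<forall>g \<in> carrier G. \<forall>h \<in> carrier G. \<forall>v \<in> carrier H. \<pi> (g \<otimes>\<^bsub>G\<^esub> h) v = \<pi> g (\<pi> h v))"

text \<open>
  A family \<open>F\<^sub>1, F\<^sub>2, \<dots>\<close> of functions from \<open>(0,\<infinity>)\<close> to \<open>(0,\<infinity>)\<close>; the values of \<open>F 0\<close> and at
  non-positive arguments are never used.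
\<close>

definition continuity_moduli :: "(nat \<Rightarrow> real \<Rightarrow> real) \<Rightarrow> bool" where
  "continuity_moduli F \<longleftrightarrow> (\<forall>i\<ge>1. \<forall>\<epsilon>>0. F i \<epsilon> > 0)"

definition F_continuous :: "(nat \<Rightarrow> real \<Rightarrow> real) \<Rightarrow> 'g monoid \<Rightarrow> ('g \<Rightarrow> 'g \<Rightarrow> real) \<Rightarrow>
    'h inner_module \<Rightarrow> ('g \<Rightarrow> 'h \<Rightarrow> 'h) \<Rightarrow> bool" where
  "F_continuous F G d H \<pi> \<longleftrightarrow>
     (\<forall>i\<ge>1. \<forall>g \<in> carrier G. \<forall>g' \<in> carrier G. \<forall>v \<in> hball H i. \<forall>\<epsilon>>0.
        d g g' < F i \<epsilon> \<longrightarrow> hnorm H (\<pi> g v \<ominus>\<^bsub>H\<^esub> \<pi> g' v) < \<epsilon>)"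

text \<open>The element 0 is inserted so that the supremum over \<open>Q = {}\<close> is 0.\<close>

definition almost_invariant_unit_vector ::
    "'h inner_module \<Rightarrow> ('g \<Rightarrow> 'h \<Rightarrow> 'h) \<Rightarrow> 'g set \<Rightarrow> real \<Rightarrow> 'h \<Rightarrow> bool" where
  "almost_invariant_unit_vector H \<pi> Q \<epsilon> v \<longleftrightarrow>
     v \<in> carrier H \<and> hnorm H v = 1 \<and>
     Sup (insert 0 ((\<lambda>x. hnorm H (\<pi> x v \<ominus>\<^bsub>H\<^esub> v)) ` Q)) < \<epsilon>"

definition almost_contains_unit :: "'g monoid \<Rightarrow> ('g \<Rightarrow> 'g \<Rightarrow> real) \<Rightarrow>
    'h inner_module \<Rightarrow> ('g \<Rightarrow> 'h \<Rightarrow> 'h) \<Rightarrow> bool" where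
  "almost_contains_unit G d H \<pi> \<longleftrightarrow>
     (\<forall>Q \<epsilon>. compactin (group_topology G d) Q \<longrightarrow> \<epsilon> > 0 \<longrightarrow>
        (\<exists>v. almost_invariant_unit_vector H \<pi> Q \<epsilon> v))"

definition invariant_vector ::
    "'g monoid \<Rightarrow> 'h inner_module \<Rightarrow> ('g \<Rightarrow> 'h \<Rightarrow> 'h) \<Rightarrow> 'h \<Rightarrow> bool" where
  "invariant_vector G H \<pi> v \<longleftrightarrow> v \<in> carrier H \<and> (\<forall>g \<in> carrier G. \<pi> g v = v)"


section \<open>The structures \<open>A(G,H)\<close> and the classes \<open>K\<^sub>\<delta>(F)\<close>\<close>

datatype asort = GSort | BSort nat

datatype asym = GSym gsym | HSym hsym | Act nat

fun asym_args :: "asym \<Rightarrow> asort list" where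
  "asym_args (GSym f) = map (\<lambda>_. GSort) (fargs group_lang f)"
| "asym_args (HSym f) = map BSort (fargs hilbert_lang f)"
| "asym_args (Act m) = [GSort, BSort m]"

fun asym_res :: "asym \<Rightarrow> asort" where
  "asym_res (GSym f) = GSort"
| "asym_res (HSym f) = BSort (fres hilbert_lang f)"
| "asym_res (Act m) = BSort m"

definition action_lang :: "(asort, asym, hpred) signat" where
  "action_lang =
    \<lparr>fsyms = GSym ` fsyms group_lang \<union> HSym ` fsyms hilbert_lang \<union> range Act,
     fargs = asym_args,
     fres = asym_res,
     rsyms = rsyms hilbert_lang,
     rargs = (\<lambda>r. map BSort (rargs hilbert_lang r))\<rparr>"

definition action_structure :: "'g monoid \<Rightarrow> ('g \<Rightarrow> 'g \<Rightarrow> real) \<Rightarrow> 'h inner_module \<Rightarrow>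
    ('g \<Rightarrow> 'h \<Rightarrow> 'h) \<Rightarrow> (asort, asym, hpred, 'g + 'h) mstruct" where
  "action_structure G d H \<pi> =
    \<lparr>sort_set = (\<lambda>s. case s of
         GSort \<Rightarrow> Inl ` sort_set (group_structure G d) ()
       | BSort n \<Rightarrow> Inr ` sort_set (hilbert_structure H) n),
     metric = (\<lambda>s x y. case s of
         GSort \<Rightarrow> metric (group_structure G d) () (projl x) (projl y)
       | BSort n \<Rightarrow> metric (hilbert_structure H) n (projr x) (projr y)),
     fint = (\<lambda>f xs. case f of
         GSym f' \<Rightarrow> Inl (fint (group_structure G d) f' (map projl xs))
       | HSym f' \<Rightarrow> Inr (fint (hilbert_structure H) f' (map projr xs))
       | Act m \<Rightarrow> Inr (\<pi> (projl (xs ! 0)) (projr (xs ! 1)))),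
     rint = (\<lambda>r xs. rint (hilbert_structure H) r (map projr xs))\<rparr>"

text \<open>
  \<open>x K\<^sub>\<delta>\<close>, the norm on \<open>B\<^sub>m\<close>, and the condition defining \<open>K\<^sub>\<delta>(F)\<close>, all read inside a structure
  for the language of actions.
\<close>

definition translate_K ::
    "real \<Rightarrow> (asort, asym, hpred, 'u) mstruct \<Rightarrow> 'u \<Rightarrow> 'u set" where
  "translate_K \<delta> M x =
     {fint M (GSym GMul) [x, g] | g. g \<in> sort_set M GSort \<and>
        metric M GSort (fint M (GSym GOne) []) g \<le> \<delta>}"

definition norm_in :: "(asort, asym, hpred, 'u) mstruct \<Rightarrow> nat \<Rightarrow> 'u \<Rightarrow> real" where
  "norm_in M m v = sqrt (rint M (ReInner m) [v, v])"

definition K_condition :: "real \<Rightarrow> (asort, asym, hpred, 'u) mstruct \<Rightarrow> bool" where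
  "K_condition \<delta> M \<longleftrightarrow>
     (\<forall>k\<ge>1. \<forall>m\<ge>1. \<forall>n\<ge>(1::nat).
        (SUP xs \<in> {xs. length xs = k \<and> set xs \<subseteq> sort_set M GSort}.
           INF v \<in> sort_set M (BSort m).
             SUP x \<in> (\<Union>y \<in> set xs. translate_K \<delta> M y).
               max (max (metric M (BSort m) (fint M (Act m) [x, v]) v - 1 / real n) 0)
                   \<bar>1 - norm_in M m v\<bar>) = 0)"

definition K_class ::
    "real \<Rightarrow> (nat \<Rightarrow> real \<Rightarrow> real) \<Rightarrow> (asort, asym, hpred, 'g + 'h) mstruct set" where
  "K_class \<delta> F =
     {M. (\<exists>(G :: 'g monoid) d (H :: 'h inner_module) \<pi>.
            metric_group G d \<and> hilbert_space H \<and> unitary_representation G H \<pi> \<and>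
            F_continuous F G d H \<pi> \<and> M = action_structure G d H \<pi>) \<and>
         K_condition \<delta> M}"

end

theory Submission
  imports Defs
begin

text \<open>
  For (a), local compactness provides a \<open>\<delta>\<close> with \<open>K\<^sub>\<delta>\<close> compact, so that finite unions of translates of
  \<open>K\<^sub>\<delta>\<close> are compact; conversely such unions cover every compact set, and an approximately invariant
  vector of norm close to 1 can be normalized.

  For (b), take the Hilbert sum of representations chosen for all pairs \<open>(Q, n)\<close>.  Its summands give the
  almost invariant vectors, an invariant vector is invariant in each coordinate, and the moduli \<open>F\<close> pass
  to the sum because the estimates for the summands can be rescaled.  Everything required of an
  elementary substructure is the vanishing of a supremum or infimum of a quantifier-free formula:
  \<open>sup\<^sub>g d(g v, v)\<close> detects invariance of \<open>v\<close>, almost invariance is needed only on a finite net of a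
  compact set since the net is spread by \<open>F\<^sub>1\<close>, and infinite dimension amounts to the existence of
  approximate unit vectors approximately orthogonal to a given finite orthonormal family.
\<close>

text \<open>An elementary substructure \<open>N\<close> is at first only a family of complete
  subsets of the sorts. It has to be recognised as an action structure before its representation can
  be discussed, and closure under the operations does not suffice for that: a vector of norm at most
  n may occur in a larger ball sort, and it lies in the sort of index n only because its distance
  from that ball vanishes, which is an elementary fact, and because the sorts are complete. Infima
  need not be attained, so transfer returns approximate witnesses. Vectors come with norm only near
  1 and are normalized at the price of a factor 2, which fixes the constants 1/2,
  \<open>\<epsilon> / 4\<close> and \<open>\<epsilon> / 8\<close>. Infinite dimension is proved by
  contradiction: a nearly unit vector with small coefficients on a supposed finite orthonormal basis
  violates Parseval's identity. The moduli give strict inequalities, which infinite sums could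
  weaken. The rescaled bound is homogeneous in the vector and strict in every non-zero coordinate,
  and one such coordinate keeps the summed bound strict.\<close>

lemma complex_field_simps [simp]:
  "carrier complex_field = UNIV"
  "x \<otimes>\<^bsub>complex_field\<^esub> y = x * y"
  "\<one>\<^bsub>complex_field\<^esub> = 1"
  "\<zero>\<^bsub>complex_field\<^esub> = 0"
  "x \<oplus>\<^bsub>complex_field\<^esub> y = x + y"
  by (simp_all add: complex_field_def)

lemma cring_complex_field: "cring complex_field"
proof (rule cringI)
  show "abelian_group complex_field"
    by (rule abelian_groupI) (auto intro: exI[of _ "- x" for x])
  show "comm_monoid complex_field"
    by (rule comm_monoidI) auto
qed (auto simp: algebra_simps)

text \<open>Removes \<open>MCauchy\<close> and the limit topology from completeness, so that one
  test in terms of sequences and distances serves carriers in different types and with different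
  distance functions.\<close>

lemma mcomplete_iff:
  assumes "Metric_space M d"
  shows "Metric_space.mcomplete M d \<longleftrightarrow>
    (\<forall>\<sigma>. (\<forall>n. \<sigma> n \<in> M) \<and> (\<forall>\<epsilon>>0. \<exists>N::nat. \<forall>m\<ge>N. \<forall>n\<ge>N. d (\<sigma> m) (\<sigma> n) < \<epsilon>) \<longrightarrow>
      (\<exists>l\<in>M. \<forall>\<epsilon>>0. \<exists>N::nat. \<forall>n\<ge>N. d (\<sigma> n) l < \<epsilon>))"
proof -
  interpret Metric_space M d by fact
  have C: "(\<forall>n. \<sigma> n \<in> M) \<and> (\<forall>\<epsilon>>0. \<exists>N::nat. \<forall>m\<ge>N. \<forall>n\<ge>N. d (\<sigma> m) (\<sigma> n) < \<epsilon>) \<longleftrightarrow> MCauchy \<sigma>" for \<sigma>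
    unfolding MCauchy_def by (simp add: image_subset_iff)
  have L: "(\<exists>l\<in>M. \<forall>\<epsilon>>0. \<exists>N::nat. \<forall>n\<ge>N. d (\<sigma> n) l < \<epsilon>) \<longleftrightarrow>
      (\<exists>l. limitin mtopology \<sigma> l sequentially)" if "MCauchy \<sigma>" for \<sigma>
  proof -
    have "\<sigma> n \<in> M" for n
      using that by (auto simp: MCauchy_def)
    then show ?thesis
      by (simp add: limit_metric_sequentially Bex_def)
  qed
  show ?thesis
    unfolding mcomplete_def C using L by simp
qed

lemma mcompleteD:
  assumes "Metric_space M d" "Metric_space.mcomplete M d" "\<And>n. \<sigma> n \<in> M"
    and "\<And>\<epsilon>. \<epsilon> > 0 \<Longrightarrow> \<exists>N::nat. \<forall>m\<ge>N. \<forall>n\<ge>N. d (\<sigma> m) (\<sigma> n) < \<epsilon>"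
  obtains l where "l \<in> M" "\<And>\<epsilon>. \<epsilon> > 0 \<Longrightarrow> \<exists>N::nat. \<forall>n\<ge>N. d (\<sigma> n) l < \<epsilon>"
proof -
  have "\<exists>l\<in>M. \<forall>\<epsilon>>0. \<exists>N::nat. \<forall>n\<ge>N. d (\<sigma> n) l < \<epsilon>"
    using assms by (metis mcomplete_iff[OF assms(1)])
  then show ?thesis using that by blast
qed

text \<open>A Cauchy sequence in the image is pulled back by choosing preimages. This moves
  completeness between the sorts of a structure, which live in a sum type, and the sets of group
  elements or vectors that they encode.\<close>

lemma mcomplete_image:
  assumes "Metric_space X dX" "Metric_space (f ` X) dY" "Metric_space.mcomplete X dX"
    and iso: "\<And>x y. x \<in> X \<Longrightarrow> y \<in> X \<Longrightarrow> dY (f x) (f y) = dX x y"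
  shows "Metric_space.mcomplete (f ` X) dY"
  unfolding mcomplete_iff[OF assms(2)]
proof (intro allI impI, elim conjE)
  fix \<sigma> :: "nat \<Rightarrow> 'b"
  assume \<sigma>: "\<forall>n. \<sigma> n \<in> f ` X"
    and C: "\<forall>\<epsilon>>0. \<exists>N. \<forall>m\<ge>N. \<forall>n\<ge>N. dY (\<sigma> m) (\<sigma> n) < \<epsilon>"
  define \<tau> where "\<tau> n = inv_into X f (\<sigma> n)" for n
  have \<tau>: "\<tau> n \<in> X" "\<sigma> n = f (\<tau> n)" for n
    using \<sigma> by (simp_all add: \<tau>_def inv_into_into f_inv_into_f)
  have eq: "dX (\<tau> m) (\<tau> n) = dY (\<sigma> m) (\<sigma> n)" for m n
    unfolding \<tau>(2) by (simp add: iso \<tau>(1))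
  obtain l where "l \<in> X" "\<And>\<epsilon>. \<epsilon> > 0 \<Longrightarrow> \<exists>N::nat. \<forall>n\<ge>N. dX (\<tau> n) l < \<epsilon>"
  proof (rule mcompleteD[OF assms(1,3) \<tau>(1)])
    show "\<exists>N. \<forall>m\<ge>N. \<forall>n\<ge>N. dX (\<tau> m) (\<tau> n) < \<epsilon>" if "\<epsilon> > 0" for \<epsilon>
      using C that by (simp add: eq)
  qed (rule that)
  then show "\<exists>l\<in>f ` X. \<forall>\<epsilon>>0. \<exists>N. \<forall>n\<ge>N. dY (\<sigma> n) l < \<epsilon>"
    by (intro bexI[of _ "f l"]) (simp_all add: \<tau>(2) iso \<tau>(1))
qed


section \<open>Pre-Hilbert spaces\<close>

text \<open>\<open>hilbert_space\<close> without completeness and infinite dimension. Hilbert sums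
  and the vector part of an elementary substructure are handled as inner product spaces before these
  two properties are established for them.\<close>

locale pre_hilbert_space = module complex_field H for H :: "'h inner_module" (structure) +
  assumes inprod_commute:
      "\<lbrakk>v \<in> carrier H; w \<in> carrier H\<rbrakk> \<Longrightarrow> inprod H v w = cnj (inprod H w v)"
    and inprod_add_left:
      "\<lbrakk>u \<in> carrier H; v \<in> carrier H; w \<in> carrier H\<rbrakk> \<Longrightarrow>
        inprod H (u \<oplus>\<^bsub>H\<^esub> v) w = inprod H u w + inprod H v w"
    and inprod_scale_left:
      "\<lbrakk>v \<in> carrier H; w \<in> carrier H\<rbrakk> \<Longrightarrow> inprod H (c \<odot>\<^bsub>H\<^esub> v) w = c * inprod H v w"
    and inprod_nonneg: "v \<in> carrier H \<Longrightarrow> Re (inprod H v v) \<ge> 0"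
    and inprod_definite: "\<lbrakk>v \<in> carrier H; inprod H v v = 0\<rbrakk> \<Longrightarrow> v = \<zero>\<^bsub>H\<^esub>"
begin

lemma scale_closed [simp]: "v \<in> carrier H \<Longrightarrow> c \<odot>\<^bsub>H\<^esub> v \<in> carrier H"
  using smult_closed[of c v] by simp

lemma scale_add_left: "v \<in> carrier H \<Longrightarrow> (a + b) \<odot>\<^bsub>H\<^esub> v = a \<odot>\<^bsub>H\<^esub> v \<oplus>\<^bsub>H\<^esub> b \<odot>\<^bsub>H\<^esub> v"
  using smult_l_distr[of a b v] by simp

lemma scale_add_right:
  "v \<in> carrier H \<Longrightarrow> w \<in> carrier H \<Longrightarrow> a \<odot>\<^bsub>H\<^esub> (v \<oplus>\<^bsub>H\<^esub> w) = a \<odot>\<^bsub>H\<^esub> v \<oplus>\<^bsub>H\<^esub> a \<odot>\<^bsub>H\<^esub> w"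
  using smult_r_distr[of a v w] by simp

lemma scale_scale: "v \<in> carrier H \<Longrightarrow> a \<odot>\<^bsub>H\<^esub> (b \<odot>\<^bsub>H\<^esub> v) = (a * b) \<odot>\<^bsub>H\<^esub> v"
  using smult_assoc1[of a b v] by simp

lemma scale_one [simp]: "v \<in> carrier H \<Longrightarrow> 1 \<odot>\<^bsub>H\<^esub> v = v"
  using smult_one[of v] by simp

lemma scale_zero_left [simp]: "v \<in> carrier H \<Longrightarrow> 0 \<odot>\<^bsub>H\<^esub> v = \<zero>\<^bsub>H\<^esub>"
  using smult_l_null[of v] by simp

lemma scale_zero_right [simp]: "a \<odot>\<^bsub>H\<^esub> \<zero>\<^bsub>H\<^esub> = \<zero>\<^bsub>H\<^esub>"
  using smult_r_null[of a] by simp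

lemma uminus_eq_scale: "v \<in> carrier H \<Longrightarrow> \<ominus>\<^bsub>H\<^esub> v = (-1) \<odot>\<^bsub>H\<^esub> v"
proof -
  assume v: "v \<in> carrier H"
  have "(-1) \<odot>\<^bsub>H\<^esub> v \<oplus>\<^bsub>H\<^esub> v = \<zero>\<^bsub>H\<^esub>"
    using scale_add_left[of v "-1" 1] v by simp
  then show ?thesis
    using v by (simp add: M.minus_equality)
qed

lemma minus_eq_scale:
  "v \<in> carrier H \<Longrightarrow> w \<in> carrier H \<Longrightarrow> v \<ominus>\<^bsub>H\<^esub> w = v \<oplus>\<^bsub>H\<^esub> (-1) \<odot>\<^bsub>H\<^esub> w"
  by (simp add: a_minus_def uminus_eq_scale)

lemma minus_carrier [simp]: "v \<in> carrier H \<Longrightarrow> w \<in> carrier H \<Longrightarrow> v \<ominus>\<^bsub>H\<^esub> w \<in> carrier H"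
  by (simp add: minus_eq_scale)

lemma scale_minus_right:
  "v \<in> carrier H \<Longrightarrow> w \<in> carrier H \<Longrightarrow> a \<odot>\<^bsub>H\<^esub> (v \<ominus>\<^bsub>H\<^esub> w) = a \<odot>\<^bsub>H\<^esub> v \<ominus>\<^bsub>H\<^esub> a \<odot>\<^bsub>H\<^esub> w"
  by (simp add: minus_eq_scale scale_add_right scale_scale)

lemma inprod_add_right:
  "u \<in> carrier H \<Longrightarrow> v \<in> carrier H \<Longrightarrow> w \<in> carrier H \<Longrightarrow>
    inprod H w (u \<oplus>\<^bsub>H\<^esub> v) = inprod H w u + inprod H w v"
  by (metis M.add.m_closed complex_cnj_add inprod_add_left inprod_commute)

lemma inprod_scale_right:
  "v \<in> carrier H \<Longrightarrow> w \<in> carrier H \<Longrightarrow> inprod H w (c \<odot>\<^bsub>H\<^esub> v) = cnj c * inprod H w v"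
  by (metis complex_cnj_mult inprod_commute inprod_scale_left scale_closed)

lemma inprod_minus_left:
  "u \<in> carrier H \<Longrightarrow> v \<in> carrier H \<Longrightarrow> w \<in> carrier H \<Longrightarrow>
    inprod H (u \<ominus>\<^bsub>H\<^esub> v) w = inprod H u w - inprod H v w"
  by (simp add: minus_eq_scale inprod_add_left inprod_scale_left)

lemma inprod_zero_left [simp]: "v \<in> carrier H \<Longrightarrow> inprod H \<zero>\<^bsub>H\<^esub> v = 0"
  using inprod_scale_left[of v v 0] by simp

lemma inprod_zero_right [simp]: "v \<in> carrier H \<Longrightarrow> inprod H v \<zero>\<^bsub>H\<^esub> = 0"
  using inprod_scale_right[of v v 0] by simp

lemma norm_nonneg [simp]: "v \<in> carrier H \<Longrightarrow> 0 \<le> hnorm H v"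
  by (simp add: hnorm_def inprod_nonneg)

lemma norm_sq: "v \<in> carrier H \<Longrightarrow> (hnorm H v)\<^sup>2 = Re (inprod H v v)"
  by (simp add: hnorm_def inprod_nonneg)

lemma Im_inprod_self [simp]: "v \<in> carrier H \<Longrightarrow> Im (inprod H v v) = 0"
  using inprod_commute[of v v] by (metis cnj.simps(2) neg_equal_zero)

lemma inprod_self: "v \<in> carrier H \<Longrightarrow> inprod H v v = complex_of_real ((hnorm H v)\<^sup>2)"
  by (simp add: complex_eq_iff norm_sq)

lemma norm_eq_zero_iff: "v \<in> carrier H \<Longrightarrow> hnorm H v = 0 \<longleftrightarrow> v = \<zero>\<^bsub>H\<^esub>"
proof
  assume "v \<in> carrier H" "hnorm H v = 0"
  then show "v = \<zero>\<^bsub>H\<^esub>"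
    by (intro inprod_definite) (simp_all add: inprod_self)
next
  assume "v \<in> carrier H" "v = \<zero>\<^bsub>H\<^esub>"
  then show "hnorm H v = 0"
    by (simp add: hnorm_def)
qed

lemma norm_zero [simp]: "hnorm H \<zero>\<^bsub>H\<^esub> = 0"
  by (simp add: norm_eq_zero_iff)

lemma norm_scale [simp]: "v \<in> carrier H \<Longrightarrow> hnorm H (c \<odot>\<^bsub>H\<^esub> v) = cmod c * hnorm H v"
proof (rule power2_eq_imp_eq)
  assume v: "v \<in> carrier H"
  have "inprod H (c \<odot>\<^bsub>H\<^esub> v) (c \<odot>\<^bsub>H\<^esub> v) = (c * cnj c) * inprod H v v"
    using v by (simp add: inprod_scale_left inprod_scale_right)
  also have "\<dots> = complex_of_real ((cmod c * hnorm H v)\<^sup>2)"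
    using v by (simp add: inprod_self power_mult_distrib flip: complex_norm_square)
  finally show "(hnorm H (c \<odot>\<^bsub>H\<^esub> v))\<^sup>2 = (cmod c * hnorm H v)\<^sup>2"
    using v by (simp add: norm_sq)
qed auto

lemma norm_add_sq:
  "v \<in> carrier H \<Longrightarrow> w \<in> carrier H \<Longrightarrow>
    (hnorm H (v \<oplus>\<^bsub>H\<^esub> w))\<^sup>2 = (hnorm H v)\<^sup>2 + 2 * Re (inprod H v w) + (hnorm H w)\<^sup>2"
  using inprod_commute[of w v]
  by (simp add: norm_sq inprod_add_left inprod_add_right)

lemma Cauchy_Schwarz:
  assumes v: "v \<in> carrier H" and w: "w \<in> carrier H"
  shows "cmod (inprod H v w) \<le> hnorm H v * hnorm H w"
proof (cases "w = \<zero>\<^bsub>H\<^esub>")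
  case False
  then have nw: "hnorm H w > 0"
    using w norm_eq_zero_iff[of w] norm_nonneg[of w] by linarith
  have z: "(complex_of_real (cmod z))\<^sup>2 = z * cnj z" for z
    by (metis complex_norm_square of_real_power)
  \<comment> \<open>Minus the coefficient of the projection of \<open>v\<close> to the line of
    \<open>w\<close>: adding the multiple of \<open>w\<close> by \<open>c\<close> leaves the
    component of \<open>v\<close> orthogonal to \<open>w\<close>, and the inequality says that its
    squared norm is non-negative.\<close>
  define c where "c = - (inprod H v w / complex_of_real ((hnorm H w)\<^sup>2))"
  have "0 \<le> (hnorm H (v \<oplus>\<^bsub>H\<^esub> c \<odot>\<^bsub>H\<^esub> w))\<^sup>2"
    by simp
  also have "\<dots> = (hnorm H v)\<^sup>2 + 2 * Re (cnj c * inprod H v w) + (cmod c * hnorm H w)\<^sup>2"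
    using v w by (simp add: norm_add_sq inprod_scale_right)
  also have "cnj c * inprod H v w = - complex_of_real ((cmod (inprod H v w))\<^sup>2 / (hnorm H w)\<^sup>2)"
    by (simp add: c_def z mult.commute)
  also have "cmod c * hnorm H w = cmod (inprod H v w) / hnorm H w"
    using nw by (simp add: c_def norm_divide norm_mult power2_eq_square)
  finally have "(cmod (inprod H v w))\<^sup>2 / (hnorm H w)\<^sup>2 \<le> (hnorm H v)\<^sup>2"
    by (simp add: power_divide)
  then have "(cmod (inprod H v w))\<^sup>2 \<le> (hnorm H v * hnorm H w)\<^sup>2"
    using nw by (simp add: divide_le_eq power_mult_distrib)
  then show ?thesis
    by (rule power2_le_imp_le) (simp add: v w)
qed (use v in simp)

lemma norm_triangle:
  assumes "v \<in> carrier H" "w \<in> carrier H"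
  shows "hnorm H (v \<oplus>\<^bsub>H\<^esub> w) \<le> hnorm H v + hnorm H w"
proof (rule power2_le_imp_le)
  have "Re (inprod H v w) \<le> hnorm H v * hnorm H w"
    using Cauchy_Schwarz[OF assms] complex_Re_le_cmod order_trans by blast
  then show "(hnorm H (v \<oplus>\<^bsub>H\<^esub> w))\<^sup>2 \<le> (hnorm H v + hnorm H w)\<^sup>2"
    using assms by (simp add: norm_add_sq power2_sum)
qed (use assms in auto)

lemma norm_minus_le:
  "v \<in> carrier H \<Longrightarrow> w \<in> carrier H \<Longrightarrow> hnorm H (v \<ominus>\<^bsub>H\<^esub> w) \<le> hnorm H v + hnorm H w"
  using norm_triangle[of v "(-1) \<odot>\<^bsub>H\<^esub> w"] by (simp add: minus_eq_scale)

lemma norm_minus_commute: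
  assumes "v \<in> carrier H" "w \<in> carrier H"
  shows "hnorm H (v \<ominus>\<^bsub>H\<^esub> w) = hnorm H (w \<ominus>\<^bsub>H\<^esub> v)"
proof -
  have "(-1) \<odot>\<^bsub>H\<^esub> (w \<ominus>\<^bsub>H\<^esub> v) = v \<ominus>\<^bsub>H\<^esub> w"
    using assms by (simp add: minus_eq_scale scale_add_right scale_scale M.a_comm)
  then show ?thesis
    using norm_scale[of "w \<ominus>\<^bsub>H\<^esub> v" "-1"] assms by simp
qed

lemma minus_add_minus:
  assumes "u \<in> carrier H" "v \<in> carrier H" "w \<in> carrier H"
  shows "(u \<ominus>\<^bsub>H\<^esub> v) \<oplus>\<^bsub>H\<^esub> (v \<ominus>\<^bsub>H\<^esub> w) = u \<ominus>\<^bsub>H\<^esub> w"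
  using assms by (simp add: a_minus_def M.a_ac M.r_neg1 M.r_neg2)

lemma norm_minus_triangle:
  assumes "u \<in> carrier H" "v \<in> carrier H" "w \<in> carrier H"
  shows "hnorm H (u \<ominus>\<^bsub>H\<^esub> w) \<le> hnorm H (u \<ominus>\<^bsub>H\<^esub> v) + hnorm H (v \<ominus>\<^bsub>H\<^esub> w)"
  using norm_triangle[of "u \<ominus>\<^bsub>H\<^esub> v" "v \<ominus>\<^bsub>H\<^esub> w"] assms by (simp add: minus_add_minus)

lemma add_minus_cancel:
  assumes "v \<in> carrier H" "w \<in> carrier H"
  shows "v \<oplus>\<^bsub>H\<^esub> (w \<ominus>\<^bsub>H\<^esub> v) = w"
  using assms M.a_comm[of w "\<ominus>\<^bsub>H\<^esub> v"] by (simp add: a_minus_def M.r_neg2)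

lemma norm_diff_abs_le:
  assumes "v \<in> carrier H" "w \<in> carrier H"
  shows "\<bar>hnorm H v - hnorm H w\<bar> \<le> hnorm H (v \<ominus>\<^bsub>H\<^esub> w)"
  using norm_triangle[of v "w \<ominus>\<^bsub>H\<^esub> v"] norm_triangle[of w "v \<ominus>\<^bsub>H\<^esub> w"] assms
    norm_minus_commute[of v w]
  by (simp add: add_minus_cancel)

lemma minus_eq_zero_iff:
  assumes "v \<in> carrier H" "w \<in> carrier H"
  shows "v \<ominus>\<^bsub>H\<^esub> w = \<zero>\<^bsub>H\<^esub> \<longleftrightarrow> v = w"
  using assms add_minus_cancel[of w v] by (auto simp: a_minus_def M.r_neg)

lemma hdist_eq: "v \<in> carrier H \<Longrightarrow> w \<in> carrier H \<Longrightarrow> hdist H v w = hnorm H (v \<ominus>\<^bsub>H\<^esub> w)"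
  by (simp add: hdist_def)

lemma Metric_space_hdist: "Metric_space (carrier H) (hdist H)"
proof
  show "0 \<le> hdist H v w" for v w
    by (simp add: hdist_def)
  show "hdist H v w = hdist H w v" for v w
    by (simp add: hdist_def norm_minus_commute)
  show "hdist H v w = 0 \<longleftrightarrow> v = w" if "v \<in> carrier H" "w \<in> carrier H" for v w
    using that by (simp add: hdist_def norm_eq_zero_iff minus_eq_zero_iff)
  show "hdist H u w \<le> hdist H u v + hdist H v w"
    if "u \<in> carrier H" "v \<in> carrier H" "w \<in> carrier H" for u v w
    using that by (simp add: hdist_def norm_minus_triangle)
qed

lemma hball_subset: "hball H n \<subseteq> carrier H"
  by (auto simp: hball_def)

lemma zero_in_hball [simp]: "\<zero>\<^bsub>H\<^esub> \<in> hball H n"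
  by (simp add: hball_def)

lemma Metric_space_hball: "Metric_space (hball H n) (hdist H)"
  using Metric_space.subspace[OF Metric_space_hdist hball_subset] .

lemma hdist_hball_le:
  assumes "v \<in> hball H n" "w \<in> hball H n"
  shows "hdist H v w \<le> 2 * real n"
  using assms norm_minus_le[of v w] by (auto simp: hball_def hdist_def)

end

sublocale hilbert_space \<subseteq> pre_hilbert_space
  using inprod_commute inprod_add_left inprod_scale_left inprod_nonneg inprod_definite
  by unfold_locales


section \<open>Finite orthonormal families, Gram-Schmidt and finite dimension\<close>

context pre_hilbert_space
begin

lemma finsum_closed' [simp]: "(\<And>x. x \<in> A \<Longrightarrow> f x \<in> carrier H) \<Longrightarrow> (\<Oplus>\<^bsub>H\<^esub>x\<in>A. f x) \<in> carrier H"
  by (rule M.finsum_closed) auto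

lemma finsum_insert':
  "finite A \<Longrightarrow> a \<notin> A \<Longrightarrow> (\<And>x. x \<in> insert a A \<Longrightarrow> f x \<in> carrier H) \<Longrightarrow>
    (\<Oplus>\<^bsub>H\<^esub>x\<in>insert a A. f x) = f a \<oplus>\<^bsub>H\<^esub> (\<Oplus>\<^bsub>H\<^esub>x\<in>A. f x)"
  by (rule M.finsum_insert) auto

lemma inprod_finsum_left:
  assumes "finite A" "\<And>x. x \<in> A \<Longrightarrow> f x \<in> carrier H" "w \<in> carrier H"
  shows "inprod H (\<Oplus>\<^bsub>H\<^esub>x\<in>A. f x) w = (\<Sum>x\<in>A. inprod H (f x) w)"
  using assms by (induction A rule: finite_induct) (simp_all add: finsum_insert' inprod_add_left)

definition orthonormal :: "'h set \<Rightarrow> bool" where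
  "orthonormal E \<longleftrightarrow> finite E \<and> E \<subseteq> carrier H \<and>
     (\<forall>e\<in>E. \<forall>e'\<in>E. inprod H e e' = (if e = e' then 1 else 0))"

text \<open>For orthonormal \<open>E\<close> this is the orthogonal projection to the span of
  \<open>E\<close>, and the equation \<open>proj E v = v\<close> is used throughout in place of
  membership in that span.\<close>

definition proj :: "'h set \<Rightarrow> 'h \<Rightarrow> 'h" where
  "proj E v = (\<Oplus>\<^bsub>H\<^esub>e\<in>E. inprod H v e \<odot>\<^bsub>H\<^esub> e)"

lemma proj_closed [simp]: "orthonormal E \<Longrightarrow> proj E v \<in> carrier H"
  unfolding proj_def orthonormal_def by (intro finsum_closed' scale_closed) auto

lemma inprod_proj:
  assumes E: "orthonormal E" and v: "v \<in> carrier H" and e: "e \<in> E"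
  shows "inprod H (proj E v) e = inprod H v e"
proof -
  have "inprod H (proj E v) e = (\<Sum>x\<in>E. inprod H (inprod H v x \<odot>\<^bsub>H\<^esub> x) e)"
    unfolding proj_def using E e by (intro inprod_finsum_left) (auto simp: orthonormal_def)
  also have "\<dots> = (\<Sum>x\<in>E. if x = e then inprod H v e else 0)"
    using E e by (intro sum.cong) (auto simp: orthonormal_def inprod_scale_left subset_iff)
  also have "\<dots> = inprod H v e"
    using E e by (simp add: orthonormal_def)
  finally show ?thesis .
qed

text \<open>The residue of \<open>v\<close> is non-zero and orthogonal to \<open>E\<close>;
  normalized, it becomes \<open>y\<close>. The last conclusion places \<open>v\<close> in the span
  of \<open>E\<close> and \<open>y\<close>, which is the induction step of Gram-Schmidt.\<close>

lemma unit_vector_orthogonal_to: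
  assumes E: "orthonormal E" and v: "v \<in> carrier H" "proj E v \<noteq> v"
  obtains y where "y \<in> carrier H" "inprod H y y = 1" "\<And>e. e \<in> E \<Longrightarrow> inprod H y e = 0"
    "v = proj E v \<oplus>\<^bsub>H\<^esub> inprod H v y \<odot>\<^bsub>H\<^esub> y"
proof -
  define r where "r = v \<ominus>\<^bsub>H\<^esub> proj E v"
  have r: "r \<in> carrier H" and r0: "hnorm H r \<noteq> 0"
    using E v by (auto simp: r_def norm_eq_zero_iff minus_eq_zero_iff)
  have re: "inprod H r e = 0" if "e \<in> E" for e
  proof -
    have "e \<in> carrier H"
      using E that by (auto simp: orthonormal_def)
    then show ?thesis
      using E v(1) that by (simp add: r_def inprod_minus_left inprod_proj)
  qed
  define c where "c = complex_of_real (inverse (hnorm H r))"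
  define y where "y = c \<odot>\<^bsub>H\<^esub> r"
  have y: "y \<in> carrier H"
    using r by (simp add: y_def)
  have "hnorm H y = 1"
    using r r0 by (simp add: y_def c_def norm_inverse)
  then have yy: "inprod H y y = 1"
    using y by (simp add: inprod_self)
  have ye: "inprod H y e = 0" if "e \<in> E" for e
    using that r E re by (auto simp: y_def inprod_scale_left orthonormal_def)
  have ey: "inprod H e y = 0" if "e \<in> E" for e
    using that y ye E inprod_commute[of e y] by (auto simp: orthonormal_def)
  have ry: "r = complex_of_real (hnorm H r) \<odot>\<^bsub>H\<^esub> y"
    using r r0 by (simp add: y_def scale_scale c_def)
  have "inprod H (proj E v) y = (\<Sum>x\<in>E. inprod H (inprod H v x \<odot>\<^bsub>H\<^esub> x) y)"
    unfolding proj_def using E y by (intro inprod_finsum_left) (auto simp: orthonormal_def)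
  also have "\<dots> = 0"
    using E y ey by (intro sum.neutral) (auto simp: inprod_scale_left orthonormal_def subset_iff)
  finally have py: "inprod H (proj E v) y = 0" .
  \<comment> \<open>The projection is orthogonal to \<open>y\<close>, so the coefficient of
    \<open>v\<close> at \<open>y\<close> is that of the residue, namely the norm of the
    residue.\<close>
  have "inprod H v y = inprod H r y"
    using E v y py by (simp add: r_def inprod_minus_left)
  also have "\<dots> = complex_of_real (hnorm H r)"
    using y yy by (subst ry) (simp add: inprod_scale_left)
  finally have "v = proj E v \<oplus>\<^bsub>H\<^esub> inprod H v y \<odot>\<^bsub>H\<^esub> y"
    using ry E v r_def by (metis add_minus_cancel proj_closed)
  then show ?thesis
    using that[of y] y yy ye by blast
qed

lemma Gram_Schmidt:
  assumes "finite B" "B \<subseteq> carrier H"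
  obtains E where "orthonormal E" "\<And>b. b \<in> B \<Longrightarrow> proj E b = b"
proof -
  have "\<exists>E. orthonormal E \<and> (\<forall>b\<in>B. proj E b = b)"
    using assms
  proof (induction B rule: finite_induct)
    case empty
    show ?case by (rule exI[of _ "{}"]) (simp add: orthonormal_def)
  next
    case (insert v B)
    then obtain E where E: "orthonormal E" "\<forall>b\<in>B. proj E b = b"
      by auto
    have v: "v \<in> carrier H" and B: "B \<subseteq> carrier H"
      using insert.prems by auto
    show ?case
    proof (cases "proj E v = v")
      case True
      then show ?thesis using E by auto
    next
      case False
      obtain y where y: "y \<in> carrier H" "inprod H y y = 1" "\<And>e. e \<in> E \<Longrightarrow> inprod H y e = 0"
        "v = proj E v \<oplus>\<^bsub>H\<^esub> inprod H v y \<odot>\<^bsub>H\<^esub> y"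
        using unit_vector_orthogonal_to[OF E(1) v False] by blast
      have ey: "inprod H e y = 0" if "e \<in> E" for e
        using that y(1,3) E(1) inprod_commute[of e y] by (auto simp: orthonormal_def)
      have yE: "y \<notin> E"
        using y(2,3) by auto
      have E': "orthonormal (insert y E)"
        using E(1) y ey yE by (auto simp: orthonormal_def)
      have pr: "proj (insert y E) b = inprod H b y \<odot>\<^bsub>H\<^esub> y \<oplus>\<^bsub>H\<^esub> proj E b" if "b \<in> carrier H" for b
        unfolding proj_def using E(1) y(1) yE by (intro finsum_insert') (auto simp: orthonormal_def)
      have "proj (insert y E) v = v"
        using pr[OF v] y(1,4) E(1) by (simp add: M.a_comm)
      \<comment> \<open>An earlier \<open>b\<close> lies in the span of \<open>E\<close>, hence is
        orthogonal to \<open>y\<close>, and the new summand of the projection vanishes on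
        it.\<close>
      moreover have "proj (insert y E) b = b" if b: "b \<in> B" for b
      proof -
        have "inprod H (proj E b) y = (\<Sum>x\<in>E. inprod H (inprod H b x \<odot>\<^bsub>H\<^esub> x) y)"
          unfolding proj_def using E(1) y(1) by (intro inprod_finsum_left) (auto simp: orthonormal_def)
        also have "\<dots> = 0"
          using E(1) y(1) ey by (intro sum.neutral) (auto simp: inprod_scale_left orthonormal_def subset_iff)
        finally have "inprod H b y = 0"
          using E(2) b by simp
        then show ?thesis
          using pr[of b] b B E y(1) by auto
      qed
      ultimately show ?thesis
        using E' by blast
    qed
  qed
  then show ?thesis using that by blast
qed

lemma proj_add:
  assumes "orthonormal E" "v \<in> carrier H" "w \<in> carrier H"
  shows "proj E (v \<oplus>\<^bsub>H\<^esub> w) = proj E v \<oplus>\<^bsub>H\<^esub> proj E w"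
proof -
  have "proj E (v \<oplus>\<^bsub>H\<^esub> w) = (\<Oplus>\<^bsub>H\<^esub>e\<in>E. inprod H v e \<odot>\<^bsub>H\<^esub> e \<oplus>\<^bsub>H\<^esub> inprod H w e \<odot>\<^bsub>H\<^esub> e)"
    unfolding proj_def using assms
    by (intro M.finsum_cong') (auto simp: orthonormal_def inprod_add_left scale_add_left subset_iff)
  also have "\<dots> = proj E v \<oplus>\<^bsub>H\<^esub> proj E w"
    unfolding proj_def using assms by (intro M.finsum_addf) (auto simp: orthonormal_def)
  finally show ?thesis .
qed

lemma proj_scale:
  assumes "orthonormal E" "v \<in> carrier H"
  shows "proj E (c \<odot>\<^bsub>H\<^esub> v) = c \<odot>\<^bsub>H\<^esub> proj E v"
proof -
  have "proj E (c \<odot>\<^bsub>H\<^esub> v) = (\<Oplus>\<^bsub>H\<^esub>e\<in>E. c \<odot>\<^bsub>H\<^esub> (inprod H v e \<odot>\<^bsub>H\<^esub> e))"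
    unfolding proj_def using assms
    by (intro M.finsum_cong') (auto simp: orthonormal_def inprod_scale_left scale_scale subset_iff)
  also have "\<dots> = c \<odot>\<^bsub>H\<^esub> proj E v"
    unfolding proj_def using assms by (subst finsum_smult_ldistr) (auto simp: orthonormal_def)
  finally show ?thesis .
qed

lemma proj_finsum:
  assumes E: "orthonormal E" and B: "finite B" "\<And>b. b \<in> B \<Longrightarrow> f b \<in> carrier H \<and> proj E (f b) = f b"
  shows "proj E (\<Oplus>\<^bsub>H\<^esub>b\<in>B. f b) = (\<Oplus>\<^bsub>H\<^esub>b\<in>B. f b)"
  using B
proof (induction B rule: finite_induct)
  case empty
  have "proj E (0 \<odot>\<^bsub>H\<^esub> \<zero>\<^bsub>H\<^esub>) = 0 \<odot>\<^bsub>H\<^esub> proj E \<zero>\<^bsub>H\<^esub>"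
    using E by (intro proj_scale) auto
  then show ?case
    using E by simp
next
  case (insert b B)
  then show ?case
    using E by (simp add: finsum_insert' proj_add)
qed

text \<open>This form of finite dimensionality does not need linear independence or dimension counting, and it passes to
  approximate statements.\<close>

lemma finite_dimensional_iff:
  "finite_dimensional H \<longleftrightarrow> (\<exists>E. orthonormal E \<and> (\<forall>v\<in>carrier H. proj E v = v))"
proof
  assume "finite_dimensional H"
  then obtain B where B: "finite B" "B \<subseteq> carrier H"
    "\<And>v. v \<in> carrier H \<Longrightarrow> \<exists>c. v = (\<Oplus>\<^bsub>H\<^esub>b\<in>B. c b \<odot>\<^bsub>H\<^esub> b)"
    unfolding finite_dimensional_def by blast
  obtain E where E: "orthonormal E" "\<And>b. b \<in> B \<Longrightarrow> proj E b = b"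
    using Gram_Schmidt[OF B(1,2)] by blast
  have "proj E v = v" if v: "v \<in> carrier H" for v
  proof -
    obtain c where c: "v = (\<Oplus>\<^bsub>H\<^esub>b\<in>B. c b \<odot>\<^bsub>H\<^esub> b)"
      using B(3)[OF v] by blast
    show ?thesis
      unfolding c using B E by (intro proj_finsum) (auto simp: proj_scale subset_iff)
  qed
  then show "\<exists>E. orthonormal E \<and> (\<forall>v\<in>carrier H. proj E v = v)"
    using E(1) by blast
next
  assume "\<exists>E. orthonormal E \<and> (\<forall>v\<in>carrier H. proj E v = v)"
  then obtain E where "orthonormal E" "\<And>v. v \<in> carrier H \<Longrightarrow> v = proj E v"
    by fastforce
  then show "finite_dimensional H"
    unfolding finite_dimensional_def proj_def orthonormal_def by blast
qed

text \<open>If \<open>proj E\<close> fixed every vector, then \<open>E\<close> would witness finite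
  dimension; the normalized residue of a vector that it moves is the required
  \<open>y\<close>.\<close>

lemma infinite_dimensional_orthogonal_unit:
  assumes "\<not> finite_dimensional H" "orthonormal E"
  obtains y where "y \<in> carrier H" "inprod H y y = 1" "\<And>e. e \<in> E \<Longrightarrow> inprod H y e = 0"
  using assms unit_vector_orthogonal_to[OF assms(2)] finite_dimensional_iff by metis

text \<open>Parseval's identity on the span of \<open>E\<close>. Later it bounds the norm of a
  vector all of whose coefficients are small.\<close>

lemma sum_inprod_orthonormal:
  assumes E: "orthonormal E" and v: "v \<in> carrier H" "proj E v = v"
  shows "Re (inprod H v v) = (\<Sum>e\<in>E. (cmod (inprod H v e))\<^sup>2)"
proof -
  have "inprod H v v = inprod H (proj E v) v"
    by (simp add: v(2))
  also have "\<dots> = (\<Sum>e\<in>E. inprod H (inprod H v e \<odot>\<^bsub>H\<^esub> e) v)"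
    unfolding proj_def using E v by (intro inprod_finsum_left) (auto simp: orthonormal_def)
  also have "\<dots> = (\<Sum>e\<in>E. complex_of_real ((cmod (inprod H v e))\<^sup>2))"
  proof (rule sum.cong)
    fix e assume "e \<in> E"
    then have "e \<in> carrier H" using E by (auto simp: orthonormal_def)
    then show "inprod H (inprod H v e \<odot>\<^bsub>H\<^esub> e) v = complex_of_real ((cmod (inprod H v e))\<^sup>2)"
      using v(1) inprod_commute[of e v] by (simp only: inprod_scale_left complex_norm_square)
  qed simp
  finally show ?thesis
    by (simp flip: of_real_sum)
qed

end


section \<open>Suprema and infima that vanish\<close>

lemma SUP_eq_0_iff:
  fixes f :: "'a \<Rightarrow> real"
  assumes "A \<noteq> {}" "\<And>x. x \<in> A \<Longrightarrow> 0 \<le> f x" "\<And>x. x \<in> A \<Longrightarrow> f x \<le> b"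
  shows "(SUP x\<in>A. f x) = 0 \<longleftrightarrow> (\<forall>x\<in>A. f x = 0)"
proof
  assume 0: "(SUP x\<in>A. f x) = 0"
  have "bdd_above (f ` A)"
    using assms(3) by (rule bdd_aboveI2)
  then have "f x \<le> (SUP x\<in>A. f x)" if "x \<in> A" for x
    using that by (intro cSUP_upper)
  with 0 assms(2) show "\<forall>x\<in>A. f x = 0"
    by (metis order_antisym)
qed (use assms(1) in simp)

text \<open>The lower bound 0 makes vanishing equivalent to being below every positive number. The
  right-hand side offers approximate witnesses, since the infimum may fail to be attained.\<close>

lemma INF_eq_0_iff:
  fixes f :: "'a \<Rightarrow> real"
  assumes A: "A \<noteq> {}" and nonneg: "\<And>x. x \<in> A \<Longrightarrow> 0 \<le> f x"
  shows "(INF x\<in>A. f x) = 0 \<longleftrightarrow> (\<forall>\<eta>>0. \<exists>x\<in>A. f x < \<eta>)"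
proof -
  have bdd: "bdd_below (f ` A)"
    using nonneg by (auto intro: bdd_belowI[of _ 0])
  have ge: "0 \<le> (INF x\<in>A. f x)"
    using A nonneg by (intro cINF_greatest)
  have "(INF x\<in>A. f x) < \<eta> \<longleftrightarrow> (\<exists>x\<in>A. f x < \<eta>)" for \<eta>
    using A bdd by (rule cINF_less_iff)
  moreover have "(INF x\<in>A. f x) = 0 \<longleftrightarrow> (\<forall>\<eta>>0. (INF x\<in>A. f x) < \<eta>)"
    using ge by (metis less_irrefl order_le_less)
  ultimately show ?thesis by simp
qed


lemma (in hilbert_space) pre_hilbert: "pre_hilbert_space H" ..

section \<open>Almost invariant vectors\<close>

locale unitary_rep = pre_hilbert_space H for H :: "'h inner_module" (structure) +
  fixes G :: "'g monoid" and \<pi> :: "'g \<Rightarrow> 'h \<Rightarrow> 'h"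
  assumes rep: "unitary_representation G H \<pi>"
begin

lemma unitary: "g \<in> carrier G \<Longrightarrow> unitary_operator H (\<pi> g)"
  using rep by (simp add: unitary_representation_def)

lemma act_closed [simp]: "g \<in> carrier G \<Longrightarrow> v \<in> carrier H \<Longrightarrow> \<pi> g v \<in> carrier H"
  using unitary[of g] unfolding unitary_operator_def bij_betw_def by blast

lemma act_add:
  "g \<in> carrier G \<Longrightarrow> v \<in> carrier H \<Longrightarrow> w \<in> carrier H \<Longrightarrow> \<pi> g (v \<oplus>\<^bsub>H\<^esub> w) = \<pi> g v \<oplus>\<^bsub>H\<^esub> \<pi> g w"
  using unitary[of g] unfolding unitary_operator_def by blast

lemma act_scale:
  "g \<in> carrier G \<Longrightarrow> v \<in> carrier H \<Longrightarrow> \<pi> g (c \<odot>\<^bsub>H\<^esub> v) = c \<odot>\<^bsub>H\<^esub> \<pi> g v"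
  using unitary[of g] unfolding unitary_operator_def by blast

lemma act_inprod:
  "g \<in> carrier G \<Longrightarrow> v \<in> carrier H \<Longrightarrow> w \<in> carrier H \<Longrightarrow> inprod H (\<pi> g v) (\<pi> g w) = inprod H v w"
  using unitary[of g] unfolding unitary_operator_def by blast

lemma act_norm [simp]: "g \<in> carrier G \<Longrightarrow> v \<in> carrier H \<Longrightarrow> hnorm H (\<pi> g v) = hnorm H v"
  by (simp add: hnorm_def act_inprod)

lemma act_hball [simp]: "g \<in> carrier G \<Longrightarrow> v \<in> hball H m \<Longrightarrow> \<pi> g v \<in> hball H m"
  by (simp add: hball_def)

lemma act_one: "v \<in> carrier H \<Longrightarrow> \<pi> \<one>\<^bsub>G\<^esub> v = v"
  using rep by (simp add: unitary_representation_def)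

lemma act_mult:
  "g \<in> carrier G \<Longrightarrow> h \<in> carrier G \<Longrightarrow> v \<in> carrier H \<Longrightarrow> \<pi> (g \<otimes>\<^bsub>G\<^esub> h) v = \<pi> g (\<pi> h v)"
  using rep by (simp add: unitary_representation_def)

text \<open>A supremum of numbers below \<open>\<epsilon>\<close> may equal
  \<open>\<epsilon>\<close>; hence the uniform bound \<open>\<eta>\<close> strictly below
  it.\<close>

lemma almost_invariant_unit_vectorI:
  assumes "v \<in> carrier H" "hnorm H v = 1" "\<And>x. x \<in> Q \<Longrightarrow> hnorm H (\<pi> x v \<ominus>\<^bsub>H\<^esub> v) \<le> \<eta>" "0 \<le> \<eta>" "\<eta> < \<epsilon>"
  shows "almost_invariant_unit_vector H \<pi> Q \<epsilon> v"
proof -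
  have "Sup (insert 0 ((\<lambda>x. hnorm H (\<pi> x v \<ominus>\<^bsub>H\<^esub> v)) ` Q)) \<le> \<eta>"
    using assms(3,4) by (intro cSup_least) auto
  then show ?thesis
    using assms by (simp add: almost_invariant_unit_vector_def)
qed

text \<open>A unitary operator moves a unit vector by at most 2. This bounds the set of
  displacements, so that \<open>Sup\<close> really dominates each of them.\<close>

lemma almost_invariant_unit_vectorD:
  assumes "almost_invariant_unit_vector H \<pi> Q \<epsilon> v" "Q \<subseteq> carrier G"
  shows "v \<in> carrier H" "hnorm H v = 1" "\<And>x. x \<in> Q \<Longrightarrow> hnorm H (\<pi> x v \<ominus>\<^bsub>H\<^esub> v) < \<epsilon>"
proof -
  show v: "v \<in> carrier H" "hnorm H v = 1"
    using assms(1) by (simp_all add: almost_invariant_unit_vector_def)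
  fix x assume x: "x \<in> Q"
  have "hnorm H (\<pi> y v \<ominus>\<^bsub>H\<^esub> v) \<le> 2" if "y \<in> Q" for y
  proof -
    have "y \<in> carrier G" using that assms(2) by blast
    then show ?thesis using norm_minus_le[of "\<pi> y v" v] v by simp
  qed
  then have "bdd_above (insert 0 ((\<lambda>x. hnorm H (\<pi> x v \<ominus>\<^bsub>H\<^esub> v)) ` Q))"
    by (auto intro!: bdd_aboveI[of _ 2])
  then have "hnorm H (\<pi> x v \<ominus>\<^bsub>H\<^esub> v) \<le> Sup (insert 0 ((\<lambda>x. hnorm H (\<pi> x v \<ominus>\<^bsub>H\<^esub> v)) ` Q))"
    using x by (intro cSup_upper) auto
  then show "hnorm H (\<pi> x v \<ominus>\<^bsub>H\<^esub> v) < \<epsilon>"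
    using assms(1) by (simp add: almost_invariant_unit_vector_def)
qed

text \<open>A norm of at least 1/2 makes the normalizing factor at most 2, so the displacement at
  most doubles.\<close>

lemma almost_invariant_normalize:
  assumes Q: "Q \<subseteq> carrier G" and v: "v \<in> carrier H" "hnorm H v \<ge> 1/2"
    and le: "\<And>x. x \<in> Q \<Longrightarrow> hnorm H (\<pi> x v \<ominus>\<^bsub>H\<^esub> v) \<le> \<eta>" and \<eta>: "0 \<le> \<eta>" "2 * \<eta> < \<epsilon>"
  shows "\<exists>w. almost_invariant_unit_vector H \<pi> Q \<epsilon> w"
proof (intro exI almost_invariant_unit_vectorI)
  define c where "c = complex_of_real (inverse (hnorm H v))"
  have c: "cmod c = inverse (hnorm H v)"
    using v by (simp add: c_def norm_inverse)
  show cl: "c \<odot>\<^bsub>H\<^esub> v \<in> carrier H"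
    using v by simp
  show "hnorm H (c \<odot>\<^bsub>H\<^esub> v) = 1"
    using v c by simp
  fix x assume x: "x \<in> Q"
  then have xG: "x \<in> carrier G"
    using Q by blast
  have "hnorm H (\<pi> x (c \<odot>\<^bsub>H\<^esub> v) \<ominus>\<^bsub>H\<^esub> c \<odot>\<^bsub>H\<^esub> v) = hnorm H (c \<odot>\<^bsub>H\<^esub> (\<pi> x v \<ominus>\<^bsub>H\<^esub> v))"
    using v xG by (simp add: act_scale scale_minus_right)
  also have "\<dots> = inverse (hnorm H v) * hnorm H (\<pi> x v \<ominus>\<^bsub>H\<^esub> v)"
    using v xG c by simp
  also have "\<dots> \<le> 2 * \<eta>"
    using v xG le[OF x] \<eta> by (intro mult_mono) (auto simp: inverse_eq_divide divide_le_eq)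
  finally show "hnorm H (\<pi> x (c \<odot>\<^bsub>H\<^esub> v) \<ominus>\<^bsub>H\<^esub> c \<odot>\<^bsub>H\<^esub> v) \<le> 2 * \<eta>" .
qed (use \<eta> in auto)

end


section \<open>Locally compact metric groups\<close>

context metric_group
begin

text \<open>Some closed ball about the unit lies in a compact neighbourhood. Shrinking its radius to
  a rational number below 1 leaves a closed subset of a compact set.\<close>

lemma compact_cball_one:
  assumes "locally_compact_space mtopology"
  obtains \<delta> where "\<delta> \<in> {0<..<1} \<inter> \<rat>" "compactin mtopology (mcball \<one> \<delta>)"
proof -
  obtain U K where U: "openin mtopology U" "compactin mtopology K" "\<one> \<in> U" "U \<subseteq> K"
    using assms unfolding locally_compact_space_def by (metis one_closed topspace_mtopology)
  then obtain r where r: "r > 0" "mcball \<one> r \<subseteq> U"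
    unfolding openin_mtopology_mcball by blast
  obtain q where q: "0 < real_of_rat q" "real_of_rat q < min r 1"
    using of_rat_dense[of 0 "min r 1"] r(1) by auto
  have "mcball \<one> (real_of_rat q) \<subseteq> mcball \<one> r"
    using q by auto
  then have "compactin mtopology (mcball \<one> (real_of_rat q))"
    using closed_compactin[OF U(2) _ closedin_mcball] r(2) U(4) by blast
  then show ?thesis
    using that[of "real_of_rat q"] q by simp
qed

text \<open>Left invariance makes the translation an isometry, so continuity holds with
  \<open>\<epsilon>\<close> as its own modulus.\<close>

lemma compactin_translate:
  assumes "compactin mtopology K" "y \<in> carrier G"
  shows "compactin mtopology ((\<lambda>g. y \<otimes> g) ` K)"
proof (rule image_compactin[OF assms(1)])
  show "continuous_map mtopology mtopology (\<lambda>g. y \<otimes> g)"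
    unfolding metric_continuous_map[OF Metric_space_axioms]
  proof (intro conjI ballI allI impI)
    fix a and \<epsilon> :: real
    assume "a \<in> carrier G" "0 < \<epsilon>"
    then show "\<exists>\<delta>>0. \<forall>x. x \<in> carrier G \<and> d a x < \<delta> \<longrightarrow> d (y \<otimes> a) (y \<otimes> x) < \<epsilon>"
      using assms(2) by (intro exI[of _ \<epsilon>]) (simp add: left_invariant)
  qed (use assms(2) in auto)
qed

lemma compact_net:
  assumes "compactin mtopology Q" "r > 0"
  obtains S where "finite S" "S \<subseteq> Q" "\<And>x. x \<in> Q \<Longrightarrow> \<exists>y\<in>S. d y x < r"
  using compactin_imp_mtotally_bounded[OF assms(1)] assms(2)
  unfolding mtotally_bounded_def by (force simp: subset_iff)

end


section \<open>The class K\<close>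

lemma action_structure_simps [simp]:
  "sort_set (action_structure G d H \<pi>) GSort = Inl ` carrier G"
  "sort_set (action_structure G d H \<pi>) (BSort n) = Inr ` hball H n"
  "metric (action_structure G d H \<pi>) GSort = (\<lambda>x y. d (projl x) (projl y))"
  "metric (action_structure G d H \<pi>) (BSort n) = (\<lambda>x y. hdist H (projr x) (projr y))"
  "fint (action_structure G d H \<pi>) (GSym f) xs = Inl (fint (group_structure G d) f (map projl xs))"
  "fint (action_structure G d H \<pi>) (HSym h) xs = Inr (fint (hilbert_structure H) h (map projr xs))"
  "fint (action_structure G d H \<pi>) (Act n) xs = Inr (\<pi> (projl (xs ! 0)) (projr (xs ! 1)))"
  "rint (action_structure G d H \<pi>) r xs = rint (hilbert_structure H) r (map projr xs)"
  by (simp_all add: action_structure_def group_structure_def hilbert_structure_def)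

lemma group_structure_simps [simp]:
  "sort_set (group_structure G d) u = carrier G"
  "metric (group_structure G d) u = d"
  "fint (group_structure G d) GMul xs = xs ! 0 \<otimes>\<^bsub>G\<^esub> xs ! 1"
  "fint (group_structure G d) GInv xs = inv\<^bsub>G\<^esub> (xs ! 0)"
  "fint (group_structure G d) GOne xs = \<one>\<^bsub>G\<^esub>"
  by (simp_all add: group_structure_def)

lemma hilbert_structure_simps [simp]:
  "sort_set (hilbert_structure H) = hball H"
  "metric (hilbert_structure H) n = hdist H"
  "fint (hilbert_structure H) HZero vs = \<zero>\<^bsub>H\<^esub>"
  "fint (hilbert_structure H) (HIncl m n) vs = vs ! 0"
  "fint (hilbert_structure H) (HScale m c) vs = c \<odot>\<^bsub>H\<^esub> (vs ! 0)"
  "fint (hilbert_structure H) (HAdd m) vs = vs ! 0 \<oplus>\<^bsub>H\<^esub> vs ! 1"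
  "fint (hilbert_structure H) (HSub m) vs = vs ! 0 \<ominus>\<^bsub>H\<^esub> vs ! 1"
  "rint (hilbert_structure H) (ReInner m) vs = Re (inprod H (vs ! 0) (vs ! 1))"
  "rint (hilbert_structure H) (ImInner m) vs = Im (inprod H (vs ! 0) (vs ! 1))"
  by (simp_all add: hilbert_structure_def)

text \<open>The expression under the innermost supremum of \<open>K_condition\<close>, read on
  vectors and group elements instead of the sum type.\<close>

definition invariance_defect :: "'h inner_module \<Rightarrow> ('g \<Rightarrow> 'h \<Rightarrow> 'h) \<Rightarrow> nat \<Rightarrow> 'h \<Rightarrow> 'g \<Rightarrow> real" where
  "invariance_defect H \<pi> n v x = max (max (hdist H (\<pi> x v) v - 1 / real n) 0) \<bar>1 - hnorm H v\<bar>"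

definition union_translates :: "'g monoid \<Rightarrow> ('g \<Rightarrow> 'g \<Rightarrow> real) \<Rightarrow> real \<Rightarrow> 'g set \<Rightarrow> 'g set" where
  "union_translates G d \<delta> Y = (\<Union>y\<in>Y. (\<lambda>g. y \<otimes>\<^bsub>G\<^esub> g) ` {g \<in> carrier G. d \<one>\<^bsub>G\<^esub> g \<le> \<delta>})"

lemma (in metric_group) union_translates_subset:
  "Y \<subseteq> carrier G \<Longrightarrow> union_translates G d \<delta> Y \<subseteq> carrier G"
  by (auto simp: union_translates_def)

text \<open>Write \<open>x\<close> as \<open>y\<close> times the quotient of \<open>x\<close> by
  \<open>y\<close>. Left invariance turns the distance of that quotient from the unit into
  \<open>d y x\<close>, so the translate of the ball about the unit contains the closed ball about
  \<open>y\<close>.\<close>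

lemma (in metric_group) mem_union_translates:
  assumes "y \<in> Y" "Y \<subseteq> carrier G" "x \<in> carrier G" "d y x \<le> \<delta>"
  shows "x \<in> union_translates G d \<delta> Y"
proof -
  have y: "y \<in> carrier G"
    using assms by blast
  have eq: "y \<otimes> (inv y \<otimes> x) = x"
    using y assms(3) by (simp flip: m_assoc)
  have "d \<one> (inv y \<otimes> x) = d y x"
    using left_invariant[of "\<one>" "inv y \<otimes> x" y] y assms(3) eq by simp
  then have "inv y \<otimes> x \<in> {g \<in> carrier G. d \<one> g \<le> \<delta>}"
    using y assms by simp
  then have "y \<otimes> (inv y \<otimes> x) \<in> union_translates G d \<delta> Y"
    unfolding union_translates_def using assms(1) by blast
  then show ?thesis
    by (simp only: eq)
qed

lemma (in metric_group) compactin_union_translates: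
  assumes "finite Y" "Y \<subseteq> carrier G" "compactin mtopology (mcball \<one> \<delta>)"
  shows "compactin mtopology (union_translates G d \<delta> Y)"
proof -
  have "{g \<in> carrier G. d \<one> g \<le> \<delta>} = mcball \<one> \<delta>"
    by auto
  then show ?thesis
    unfolding union_translates_def using assms
    by (auto intro!: compactin_Union compactin_translate)
qed

text \<open>All values lie between 0 and \<open>2 * m\<close>, so the outer supremum vanishes
  exactly if the infimum vanishes for each tuple, and this means that vectors with arbitrarily small
  inner supremum exist.\<close>

lemma K_condition_iff:
  fixes G :: "'g monoid" and H :: "'h inner_module"
  assumes G: "metric_group G d" and rep: "unitary_rep H G \<pi>" and \<delta>: "0 \<le> \<delta>"
  shows "K_condition \<delta> (action_structure G d H \<pi>) \<longleftrightarrow>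
    (\<forall>k\<ge>1. \<forall>m\<ge>1. \<forall>n\<ge>(1::nat). \<forall>ys. length ys = k \<and> set ys \<subseteq> carrier G \<longrightarrow>
      (\<forall>\<eta>>0. \<exists>v\<in>hball H m. (SUP x\<in>union_translates G d \<delta> (set ys). invariance_defect H \<pi> n v x) < \<eta>))"
proof -
  interpret G: metric_group G d by fact
  interpret unitary_rep H G \<pi> by fact
  let ?A = "action_structure G d H \<pi>" and ?Z = "\<lambda>ys. union_translates G d \<delta> (set ys)"
  let ?L = "\<lambda>k. {ys. length ys = k \<and> set ys \<subseteq> carrier G}"
  have trans: "(\<Union>y\<in>set (map Inl ys). translate_K \<delta> ?A y) = Inl ` ?Z ys" for ys
  proof -
    have "translate_K \<delta> ?A (Inl y) = Inl ` (\<lambda>g. y \<otimes>\<^bsub>G\<^esub> g) ` {g \<in> carrier G. d \<one>\<^bsub>G\<^esub> g \<le> \<delta>}" for y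
      unfolding translate_K_def by force
    then show ?thesis
      by (simp add: union_translates_def image_UN)
  qed
  have lists: "{xs. length xs = k \<and> set xs \<subseteq> sort_set ?A GSort} = map Inl ` ?L k" for k
  proof (intro equalityI subsetI)
    fix xs :: "('g + 'h) list" assume xs: "xs \<in> {xs. length xs = k \<and> set xs \<subseteq> sort_set ?A GSort}"
    then have "xs = map Inl (map projl xs)"
      by (intro nth_equalityI) (auto simp: subset_iff in_set_conv_nth)
    moreover have "map projl xs \<in> ?L k"
      using xs by (auto simp: subset_iff)
    ultimately show "xs \<in> map Inl ` ?L k" by blast
  qed (auto simp: subset_iff)
  have norm: "norm_in ?A m (Inr v) = hnorm H v" for m v
    by (simp add: norm_in_def hnorm_def)
  have eq: "(SUP xs \<in> {xs. length xs = k \<and> set xs \<subseteq> sort_set ?A GSort}.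
           INF v \<in> sort_set ?A (BSort m).
             SUP x \<in> (\<Union>y \<in> set xs. translate_K \<delta> ?A y).
               max (max (metric ?A (BSort m) (fint ?A (Act m) [x, v]) v - 1 / real n) 0)
                   \<bar>1 - norm_in ?A m v\<bar>) =
      (SUP ys\<in>?L k. INF v\<in>hball H m. SUP x\<in>?Z ys. invariance_defect H \<pi> n v x)" for k m n
    unfolding lists image_image trans action_structure_simps(2)
    by (simp add: image_image norm invariance_defect_def del: set_map)
  have "(SUP ys\<in>?L k. INF v\<in>hball H m. SUP x\<in>?Z ys. invariance_defect H \<pi> n v x) = 0 \<longleftrightarrow>
      (\<forall>ys. length ys = k \<and> set ys \<subseteq> carrier G \<longrightarrow>
      (\<forall>\<eta>>0. \<exists>v\<in>hball H m. (SUP x\<in>?Z ys. invariance_defect H \<pi> n v x) < \<eta>))"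
    if "k \<ge> 1" "m \<ge> 1" "n \<ge> 1" for k m n :: nat
  proof -
    \<comment> \<open>From \<open>k \<ge> 1\<close> there is an entry, and
      \<open>0 \<le> \<delta>\<close> puts it into its own translate; the inner supremum is
      therefore taken over a non-empty set.\<close>
    have Z: "?Z ys \<noteq> {}" "?Z ys \<subseteq> carrier G" if "ys \<in> ?L k" for ys
    proof -
      have "hd ys \<in> set ys"
        using that \<open>k \<ge> 1\<close> by (intro hd_in_set) auto
      then have "hd ys \<in> ?Z ys"
        using that \<delta> by (intro G.mem_union_translates[of "hd ys"]) auto
      then show "?Z ys \<noteq> {}" by blast
      show "?Z ys \<subseteq> carrier G"
        using that by (intro G.union_translates_subset) simp
    qed
    \<comment> \<open>Two vectors of the ball of radius m are at distance at most
      \<open>2 * m\<close>, and \<open>m \<ge> 1\<close> brings the deviation of the norm from 1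
      under the same bound.\<close>
    have defect: "0 \<le> invariance_defect H \<pi> n v x" "invariance_defect H \<pi> n v x \<le> 2 * real m"
      if "v \<in> hball H m" "x \<in> carrier G" for v x
    proof -
      show "0 \<le> invariance_defect H \<pi> n v x"
        by (simp add: invariance_defect_def)
      have "hdist H (\<pi> x v) v \<le> 2 * real m"
        using that by (intro hdist_hball_le) auto
      moreover have "0 \<le> 1 / real n"
        by simp
      ultimately have 1: "hdist H (\<pi> x v) v - 1 / real n \<le> 2 * real m"
        by linarith
      have "v \<in> carrier H" "hnorm H v \<le> real m"
        using that(1) by (auto simp: hball_def)
      then have "\<bar>1 - hnorm H v\<bar> \<le> 2 * real m"
        using norm_nonneg[of v] \<open>m \<ge> 1\<close> by linarith
      with 1 show "invariance_defect H \<pi> n v x \<le> 2 * real m"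
        by (simp add: invariance_defect_def)
    qed
    have sup: "0 \<le> (SUP x\<in>?Z ys. invariance_defect H \<pi> n v x)"
      "(SUP x\<in>?Z ys. invariance_defect H \<pi> n v x) \<le> 2 * real m"
      if ys: "ys \<in> ?L k" and v: "v \<in> hball H m" for ys v
    proof -
      show "(SUP x\<in>?Z ys. invariance_defect H \<pi> n v x) \<le> 2 * real m"
        using Z[OF ys] defect[OF v] by (intro cSUP_least) auto
      obtain x where x: "x \<in> ?Z ys"
        using Z(1)[OF ys] by blast
      have "bdd_above (invariance_defect H \<pi> n v ` ?Z ys)"
        using Z(2)[OF ys] defect(2)[OF v] by (intro bdd_aboveI2[of _ _ "2 * real m"]) auto
      then have "invariance_defect H \<pi> n v x \<le> (SUP x\<in>?Z ys. invariance_defect H \<pi> n v x)"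
        using x by (intro cSUP_upper)
      moreover have "0 \<le> invariance_defect H \<pi> n v x"
        using x Z(2)[OF ys] defect(1)[OF v] by blast
      ultimately show "0 \<le> (SUP x\<in>?Z ys. invariance_defect H \<pi> n v x)"
        by linarith
    qed
    have L: "?L k \<noteq> {}"
      by (auto intro!: exI[of _ "replicate k \<one>\<^bsub>G\<^esub>"])
    have B: "hball H m \<noteq> {}"
      using zero_in_hball by blast
    have inf: "0 \<le> (INF v\<in>hball H m. SUP x\<in>?Z ys. invariance_defect H \<pi> n v x)"
      "(INF v\<in>hball H m. SUP x\<in>?Z ys. invariance_defect H \<pi> n v x) \<le> 2 * real m"
      if ys: "ys \<in> ?L k" for ys
    proof -
      show "0 \<le> (INF v\<in>hball H m. SUP x\<in>?Z ys. invariance_defect H \<pi> n v x)"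
        using B sup(1)[OF ys] by (intro cINF_greatest)
      show "(INF v\<in>hball H m. SUP x\<in>?Z ys. invariance_defect H \<pi> n v x) \<le> 2 * real m"
      proof (rule cINF_lower2)
        show "bdd_below ((\<lambda>v. SUP x\<in>?Z ys. invariance_defect H \<pi> n v x) ` hball H m)"
          by (rule bdd_belowI2) (rule sup(1)[OF ys])
        show "\<zero>\<^bsub>H\<^esub> \<in> hball H m"
          by simp
        then show "(SUP x\<in>?Z ys. invariance_defect H \<pi> n \<zero>\<^bsub>H\<^esub> x) \<le> 2 * real m"
          by (rule sup(2)[OF ys])
      qed
    qed
    have "(SUP ys\<in>?L k. INF v\<in>hball H m. SUP x\<in>?Z ys. invariance_defect H \<pi> n v x) = 0 \<longleftrightarrow>
       (\<forall>ys\<in>?L k. (INF v\<in>hball H m. SUP x\<in>?Z ys. invariance_defect H \<pi> n v x) = 0)"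
      by (rule SUP_eq_0_iff[OF L inf])
    also have "\<dots> \<longleftrightarrow> (\<forall>ys\<in>?L k. \<forall>\<eta>>0. \<exists>v\<in>hball H m. (SUP x\<in>?Z ys. invariance_defect H \<pi> n v x) < \<eta>)"
      by (rule ball_cong[OF refl INF_eq_0_iff[OF B sup(1)]])
    finally show ?thesis
      by simp
  qed
  then show ?thesis
    unfolding K_condition_def eq by simp
qed

theorem almost_contains_unit_iff_K_class:
  fixes G :: "'g monoid" and H :: "'h inner_module"
  assumes G: "metric_group G d" and lc: "locally_compact_space (group_topology G d)"
    and H: "hilbert_space H" and rep: "unitary_representation G H \<pi>" and F: "F_continuous F G d H \<pi>"
  shows "almost_contains_unit G d H \<pi> \<longleftrightarrow>
    (\<exists>\<delta> \<in> {0<..<1} \<inter> \<rat>. action_structure G d H \<pi> \<in> K_class \<delta> F)"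
proof -
  interpret G: metric_group G d by fact
  interpret unitary_rep H G \<pi>
    by (intro unitary_rep.intro unitary_rep_axioms.intro rep hilbert_space.pre_hilbert H)
  have mem: "action_structure G d H \<pi> \<in> K_class \<delta> F \<longleftrightarrow> K_condition \<delta> (action_structure G d H \<pi>)" for \<delta>
    using G H rep F unfolding K_class_def by blast
  note K_iff = K_condition_iff[OF G unitary_rep_axioms]
  show ?thesis
  proof
    assume ac: "almost_contains_unit G d H \<pi>"
    obtain \<delta> where \<delta>: "\<delta> \<in> {0<..<1} \<inter> \<rat>" "compactin G.mtopology (G.mcball \<one>\<^bsub>G\<^esub> \<delta>)"
      using G.compact_cball_one[OF lc] by blast
    have \<delta>0: "0 \<le> \<delta>"
      using \<delta>(1) by simp
    have "K_condition \<delta> (action_structure G d H \<pi>)"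
      unfolding K_iff[OF \<delta>0]
    proof (intro allI impI)
      fix k m n :: nat and ys :: "'g list" and \<eta> :: real
      assume *: "1 \<le> k" "1 \<le> m" "1 \<le> n" "length ys = k \<and> set ys \<subseteq> carrier G" "0 < \<eta>"
      let ?Z = "union_translates G d \<delta> (set ys)"
      have Z: "compactin G.mtopology ?Z"
        using *(4) \<delta>(2) by (intro G.compactin_union_translates) auto
      have ZG: "?Z \<subseteq> carrier G"
        using *(4) by (intro G.union_translates_subset) simp
      have "0 < 1 / real n"
        using *(3) by simp
      then obtain v where v: "almost_invariant_unit_vector H \<pi> ?Z (1 / real n) v"
        using ac Z unfolding almost_contains_unit_def by blast
      note v = almost_invariant_unit_vectorD[OF v ZG]
      \<comment> \<open>The truncated subtraction is what yields an exact zero: a displacement below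
        1/n is cut off, and the norm is exactly 1.\<close>
      have "invariance_defect H \<pi> n v x = 0" if "x \<in> ?Z" for x
      proof -
        have "hdist H (\<pi> x v) v < 1 / real n"
          using v(1) v(3)[OF that] that ZG by (simp add: hdist_eq subset_iff)
        then show ?thesis
          using v(2) by (simp add: invariance_defect_def)
      qed
      moreover have "?Z \<noteq> {}"
      proof -
        have "hd ys \<in> set ys"
          using * by (intro hd_in_set) auto
        then have "hd ys \<in> ?Z"
          using *(4) \<delta>0 by (intro G.mem_union_translates[of "hd ys"]) auto
        then show ?thesis by blast
      qed
      ultimately have "(SUP x\<in>?Z. invariance_defect H \<pi> n v x) < \<eta>"
        using *(5) by simp
      moreover have "v \<in> hball H m"
        using v *(2) by (simp add: hball_def)
      ultimately show "\<exists>v\<in>hball H m. (SUP x\<in>?Z. invariance_defect H \<pi> n v x) < \<eta>"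
        by blast
    qed
    then show "\<exists>\<delta> \<in> {0<..<1} \<inter> \<rat>. action_structure G d H \<pi> \<in> K_class \<delta> F"
      using \<delta>(1) mem by blast
  next
    assume "\<exists>\<delta> \<in> {0<..<1} \<inter> \<rat>. action_structure G d H \<pi> \<in> K_class \<delta> F"
    then obtain \<delta> where \<delta>: "0 < \<delta>" and K: "K_condition \<delta> (action_structure G d H \<pi>)"
      using mem by auto
    show "almost_contains_unit G d H \<pi>"
      unfolding almost_contains_unit_def
    proof (intro allI impI)
      fix Q and \<epsilon> :: real
      assume Q: "compactin G.mtopology Q" and \<epsilon>: "0 < \<epsilon>"
      have QG: "Q \<subseteq> carrier G"
        using compactin_subset_topspace[OF Q] by simp
      obtain S where S: "finite S" "S \<subseteq> Q" "\<And>x. x \<in> Q \<Longrightarrow> \<exists>y\<in>S. d y x < \<delta>"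
        using G.compact_net[OF Q \<delta>] by blast
      \<comment> \<open>The net may be empty, but the condition speaks of tuples with
        \<open>k \<ge> 1\<close>. The adjoined unit is also the point at which the defect will
        control the norm of \<open>v\<close>.\<close>
      obtain ys where ys: "set ys = insert \<one>\<^bsub>G\<^esub> S"
        using finite_list[of "insert \<one>\<^bsub>G\<^esub> S"] S(1) by auto
      have ysG: "set ys \<subseteq> carrier G" and len: "length ys \<ge> 1"
        using ys S(2) QG by (auto simp: Suc_le_eq)
      let ?Z = "union_translates G d \<delta> (set ys)"
      have QZ: "Q \<subseteq> ?Z"
      proof
        fix x assume x: "x \<in> Q"
        then obtain y where y: "y \<in> S" "d y x < \<delta>"
          using S(3) by blast
        have xG: "x \<in> carrier G" and yG: "y \<in> carrier G"
          using x y S(2) QG by auto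
        show "x \<in> ?Z"
          using y xG ysG ys by (intro G.mem_union_translates[of y]) auto
      qed
      have ZG: "?Z \<subseteq> carrier G"
        using ysG by (rule G.union_translates_subset)
      \<comment> \<open>The bound 1/2 keeps the norm of \<open>v\<close> at least 1/2. The
        displacement is below \<open>\<eta> + 1/n\<close>, hence at most
        \<open>\<epsilon> / 4\<close>, and normalization brings it to at most
        \<open>\<epsilon> / 2\<close>.\<close>
      define \<eta> where "\<eta> = min (1/2) (\<epsilon> / 8)"
      obtain n' :: nat where "inverse (real (Suc n')) < \<epsilon> / 8"
        using reals_Archimedean[of "\<epsilon> / 8"] \<epsilon> by auto
      then obtain n :: nat where n: "n \<ge> 1" "1 / real n < \<epsilon> / 8"
        using that[of "Suc n'"] by (simp add: inverse_eq_divide)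
      have \<eta>: "0 < \<eta>" "\<eta> \<le> 1/2" "\<eta> \<le> \<epsilon> / 8"
        using \<epsilon> by (auto simp: \<eta>_def)
      obtain v where v: "v \<in> hball H 1" "(SUP x\<in>?Z. invariance_defect H \<pi> n v x) < \<eta>"
        using K[unfolded K_iff[OF less_imp_le[OF \<delta>]], rule_format, of "length ys" 1 n ys \<eta>] len n(1) ysG \<eta>(1)
        by auto
      have vH: "v \<in> carrier H" "hnorm H v \<le> 1"
        using v(1) by (auto simp: hball_def)
      have "invariance_defect H \<pi> n v x \<le> 2" if "x \<in> ?Z" for x
      proof -
        have "hdist H (\<pi> x v) v \<le> 2 * real 1"
          using that ZG v(1) by (intro hdist_hball_le) auto
        moreover have "0 \<le> 1 / real n"
          by simp
        ultimately have "hdist H (\<pi> x v) v - 1 / real n \<le> 2"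
          by linarith
        then show ?thesis
          using vH(2) norm_nonneg[OF vH(1)] unfolding invariance_defect_def by linarith
      qed
      then have bdd: "bdd_above (invariance_defect H \<pi> n v ` ?Z)"
        by (rule bdd_aboveI2)
      have less: "invariance_defect H \<pi> n v x < \<eta>" if "x \<in> ?Z" for x
        using cSUP_upper[OF that bdd] v(2) by simp
      have "\<one>\<^bsub>G\<^esub> \<in> ?Z"
        using ys ysG \<delta> by (intro G.mem_union_translates[of "\<one>\<^bsub>G\<^esub>"]) auto
      from less[OF this] have "hnorm H v \<ge> 1/2"
        using \<eta> unfolding invariance_defect_def by linarith
      moreover have "hnorm H (\<pi> x v \<ominus>\<^bsub>H\<^esub> v) \<le> \<epsilon> / 4" if "x \<in> Q" for x
      proof -
        have "hdist H (\<pi> x v) v - 1 / real n < \<eta>"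
          using less[of x] that QZ by (auto simp: invariance_defect_def)
        then show ?thesis
          using n(2) \<eta>(3) vH(1) that QG by (auto simp: hdist_eq subset_iff)
      qed
      ultimately show "\<exists>v. almost_invariant_unit_vector H \<pi> Q \<epsilon> v"
        using vH(1) QG \<epsilon> by (intro almost_invariant_normalize[of Q v "\<epsilon> / 4"]) auto
    qed
  qed
qed


section \<open>Hilbert sums\<close>

text \<open>The square-summable families over an arbitrary index type; \<open>summable_on\<close> is
  unconditional summability, so no order of the indices enters.\<close>

definition hilbert_sum :: "('i \<Rightarrow> 'h inner_module) \<Rightarrow> ('i \<Rightarrow> 'h) inner_module" where
  "hilbert_sum H =
    \<lparr>carrier = {f. (\<forall>i. f i \<in> carrier (H i)) \<and> (\<lambda>i. (hnorm (H i) (f i))\<^sup>2) summable_on UNIV},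
     mult = (\<lambda>f g. f), one = (\<lambda>i. \<zero>\<^bsub>H i\<^esub>),
     zero = (\<lambda>i. \<zero>\<^bsub>H i\<^esub>), add = (\<lambda>f g i. f i \<oplus>\<^bsub>H i\<^esub> g i),
     smult = (\<lambda>c f i. c \<odot>\<^bsub>H i\<^esub> f i),
     inprod = (\<lambda>f g. \<Sum>\<^sub>\<infinity>i. inprod (H i) (f i) (g i))\<rparr>"

lemma hilbert_sum_simps [simp]:
  "f \<in> carrier (hilbert_sum H) \<longleftrightarrow>
    (\<forall>i. f i \<in> carrier (H i)) \<and> (\<lambda>i. (hnorm (H i) (f i))\<^sup>2) summable_on UNIV"
  "\<zero>\<^bsub>hilbert_sum H\<^esub> = (\<lambda>i. \<zero>\<^bsub>H i\<^esub>)"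
  "f \<oplus>\<^bsub>hilbert_sum H\<^esub> g = (\<lambda>i. f i \<oplus>\<^bsub>H i\<^esub> g i)"
  "c \<odot>\<^bsub>hilbert_sum H\<^esub> f = (\<lambda>i. c \<odot>\<^bsub>H i\<^esub> f i)"
  "inprod (hilbert_sum H) f g = (\<Sum>\<^sub>\<infinity>i. inprod (H i) (f i) (g i))"
  by (simp_all add: hilbert_sum_def)

text \<open>Additive inverses are obtained as multiples by -1, so the axioms can be checked on
  addition and scaling.\<close>

lemma pre_hilbert_spaceI:
  fixes H :: "'h inner_module"
  assumes zero: "\<zero>\<^bsub>H\<^esub> \<in> carrier H"
    and add: "\<And>v w. v \<in> carrier H \<Longrightarrow> w \<in> carrier H \<Longrightarrow> v \<oplus>\<^bsub>H\<^esub> w \<in> carrier H"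
    and scale: "\<And>c v. v \<in> carrier H \<Longrightarrow> c \<odot>\<^bsub>H\<^esub> v \<in> carrier H"
    and add_assoc: "\<And>u v w. u \<in> carrier H \<Longrightarrow> v \<in> carrier H \<Longrightarrow> w \<in> carrier H \<Longrightarrow>
      (u \<oplus>\<^bsub>H\<^esub> v) \<oplus>\<^bsub>H\<^esub> w = u \<oplus>\<^bsub>H\<^esub> (v \<oplus>\<^bsub>H\<^esub> w)"
    and add_comm: "\<And>v w. v \<in> carrier H \<Longrightarrow> w \<in> carrier H \<Longrightarrow> v \<oplus>\<^bsub>H\<^esub> w = w \<oplus>\<^bsub>H\<^esub> v"
    and zero_add: "\<And>v. v \<in> carrier H \<Longrightarrow> \<zero>\<^bsub>H\<^esub> \<oplus>\<^bsub>H\<^esub> v = v"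
    and neg_add: "\<And>v. v \<in> carrier H \<Longrightarrow> (-1) \<odot>\<^bsub>H\<^esub> v \<oplus>\<^bsub>H\<^esub> v = \<zero>\<^bsub>H\<^esub>"
    and scale_add_left: "\<And>a b v. v \<in> carrier H \<Longrightarrow> (a + b) \<odot>\<^bsub>H\<^esub> v = a \<odot>\<^bsub>H\<^esub> v \<oplus>\<^bsub>H\<^esub> b \<odot>\<^bsub>H\<^esub> v"
    and scale_add_right: "\<And>a v w. v \<in> carrier H \<Longrightarrow> w \<in> carrier H \<Longrightarrow>
      a \<odot>\<^bsub>H\<^esub> (v \<oplus>\<^bsub>H\<^esub> w) = a \<odot>\<^bsub>H\<^esub> v \<oplus>\<^bsub>H\<^esub> a \<odot>\<^bsub>H\<^esub> w"
    and scale_scale: "\<And>a b v. v \<in> carrier H \<Longrightarrow> (a * b) \<odot>\<^bsub>H\<^esub> v = a \<odot>\<^bsub>H\<^esub> (b \<odot>\<^bsub>H\<^esub> v)"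
    and scale_one: "\<And>v. v \<in> carrier H \<Longrightarrow> 1 \<odot>\<^bsub>H\<^esub> v = v"
    and inprod: "pre_hilbert_space_axioms H"
  shows "pre_hilbert_space H"
proof (intro pre_hilbert_space.intro inprod moduleI cring_complex_field abelian_groupI)
  show "\<exists>w\<in>carrier H. w \<oplus>\<^bsub>H\<^esub> v = \<zero>\<^bsub>H\<^esub>" if "v \<in> carrier H" for v
    using scale neg_add that by blast
  show "(u \<oplus>\<^bsub>H\<^esub> v) \<oplus>\<^bsub>H\<^esub> w = u \<oplus>\<^bsub>H\<^esub> (v \<oplus>\<^bsub>H\<^esub> w)"
    if "u \<in> carrier H" "v \<in> carrier H" "w \<in> carrier H" for u v w
    using that by (rule add_assoc)
  show "v \<oplus>\<^bsub>H\<^esub> w = w \<oplus>\<^bsub>H\<^esub> v" if "v \<in> carrier H" "w \<in> carrier H" for v w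
    using that by (rule add_comm)
qed (simp_all add: zero add scale zero_add scale_add_left scale_add_right scale_scale scale_one)

locale hilbert_family =
  fixes H :: "'i \<Rightarrow> 'h inner_module"
  assumes hilbert: "hilbert_space (H i)"
begin

lemma pre_hilbert: "pre_hilbert_space (H i)"
  using hilbert by (rule hilbert_space.pre_hilbert)

lemmas component =
  pre_hilbert_space.norm_nonneg[OF pre_hilbert] pre_hilbert_space.scale_closed[OF pre_hilbert]
  pre_hilbert_space.norm_scale[OF pre_hilbert] pre_hilbert_space.norm_zero[OF pre_hilbert]
  abelian_monoid.a_closed[OF abelian_group.axioms(1)[OF module.axioms(2)[OF pre_hilbert_space.axioms(1)[OF pre_hilbert]]]]
  abelian_monoid.zero_closed[OF abelian_group.axioms(1)[OF module.axioms(2)[OF pre_hilbert_space.axioms(1)[OF pre_hilbert]]]]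

abbreviation S :: "('i \<Rightarrow> 'h) inner_module" where
  "S \<equiv> hilbert_sum H"

text \<open>Cauchy-Schwarz in each coordinate, together with the bound of a product of non-negative
  numbers by the sum of their squares, gives a summable majorant.\<close>

lemma summable_inprod:
  assumes "f \<in> carrier S" "g \<in> carrier S"
  shows "(\<lambda>i. inprod (H i) (f i) (g i)) summable_on UNIV"
proof -
  have "(\<lambda>i. norm (inprod (H i) (f i) (g i))) summable_on UNIV"
  proof (rule Infinite_Sum.abs_summable_on_comparison_test)
    show "(\<lambda>i. norm ((hnorm (H i) (f i))\<^sup>2 + (hnorm (H i) (g i))\<^sup>2)) summable_on UNIV"
      using assms by (auto intro!: summable_on_add simp: abs_of_nonneg)
    fix i
    have fg: "f i \<in> carrier (H i)" "g i \<in> carrier (H i)"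
      using assms by auto
    have "0 \<le> (hnorm (H i) (f i) - hnorm (H i) (g i))\<^sup>2"
      by simp
    then have "hnorm (H i) (f i) * hnorm (H i) (g i) \<le> (hnorm (H i) (f i))\<^sup>2 + (hnorm (H i) (g i))\<^sup>2"
      using mult_nonneg_nonneg[OF component(1)[OF fg(1)] component(1)[OF fg(2)]]
      unfolding power2_diff by linarith
    then show "norm (inprod (H i) (f i) (g i)) \<le> norm ((hnorm (H i) (f i))\<^sup>2 + (hnorm (H i) (g i))\<^sup>2)"
      using pre_hilbert_space.Cauchy_Schwarz[OF pre_hilbert fg] by simp
  qed
  then show ?thesis
    by (rule Infinite_Sum.abs_summable_summable)
qed

lemma sum_zero: "\<zero>\<^bsub>S\<^esub> \<in> carrier S"
  by (simp add: component)

lemma sum_scale: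
  assumes "f \<in> carrier S"
  shows "c \<odot>\<^bsub>S\<^esub> f \<in> carrier S"
  using assms by (simp add: component power_mult_distrib summable_on_cmult_right)

lemma sum_add:
  assumes "f \<in> carrier S" "g \<in> carrier S"
  shows "f \<oplus>\<^bsub>S\<^esub> g \<in> carrier S"
proof -
  have "(\<lambda>i. (hnorm (H i) (f i \<oplus>\<^bsub>H i\<^esub> g i))\<^sup>2) summable_on UNIV"
  proof (rule summable_on_comparison_test)
    show "(\<lambda>i. 2 * (hnorm (H i) (f i))\<^sup>2 + 2 * (hnorm (H i) (g i))\<^sup>2) summable_on UNIV"
      using assms by (intro summable_on_add summable_on_cmult_right) auto
    fix i
    have fg: "f i \<in> carrier (H i)" "g i \<in> carrier (H i)"
      using assms by auto
    let ?a = "hnorm (H i) (f i)" and ?b = "hnorm (H i) (g i)"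
    have "(hnorm (H i) (f i \<oplus>\<^bsub>H i\<^esub> g i))\<^sup>2 \<le> (?a + ?b)\<^sup>2"
      using fg pre_hilbert_space.norm_triangle[OF pre_hilbert fg] by (intro power_mono) (auto simp: component)
    \<comment> \<open>The difference of the two sides is the square of
      \<open>?a - ?b\<close>.\<close>
    also have "\<dots> \<le> 2 * ?a\<^sup>2 + 2 * ?b\<^sup>2"
      using zero_le_power2[of "?a - ?b"] by (simp add: power2_sum power2_diff)
    finally show "(hnorm (H i) (f i \<oplus>\<^bsub>H i\<^esub> g i))\<^sup>2 \<le> 2 * ?a\<^sup>2 + 2 * ?b\<^sup>2" .
  qed auto
  then show ?thesis
    using assms by (simp add: component)
qed

lemma sum_inprod_self:
  assumes "f \<in> carrier S"
  shows "inprod S f f = complex_of_real (\<Sum>\<^sub>\<infinity>i. (hnorm (H i) (f i))\<^sup>2)"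
proof -
  have "inprod S f f = (\<Sum>\<^sub>\<infinity>i. complex_of_real ((hnorm (H i) (f i))\<^sup>2))"
    using assms by (simp add: pre_hilbert_space.inprod_self[OF pre_hilbert])
  also have "\<dots> = complex_of_real (\<Sum>\<^sub>\<infinity>i. (hnorm (H i) (f i))\<^sup>2)"
    using assms by (intro infsumI has_sum_of_real) (auto intro: has_sum_infsum)
  finally show ?thesis .
qed

lemma sum_norm_sq:
  assumes "f \<in> carrier S"
  shows "(hnorm S f)\<^sup>2 = (\<Sum>\<^sub>\<infinity>i. (hnorm (H i) (f i))\<^sup>2)"
proof -
  have "0 \<le> (\<Sum>\<^sub>\<infinity>i. (hnorm (H i) (f i))\<^sup>2)"
    by (simp add: infsum_nonneg)
  then show ?thesis
    unfolding hnorm_def[of S] using assms by (simp only: sum_inprod_self Re_complex_of_real real_sqrt_pow2)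
qed

lemma pre_hilbert_sum: "pre_hilbert_space S"
proof (rule pre_hilbert_spaceI)
  note m = pre_hilbert_space.axioms(1)[OF pre_hilbert]
  note ab = module.axioms(2)[OF m]
  note mo = abelian_group.axioms(1)[OF ab]
  show "pre_hilbert_space_axioms S"
  proof
    fix u v w c
    assume u: "u \<in> carrier S" and v: "v \<in> carrier S" and w: "w \<in> carrier S"
    show "inprod S (u \<oplus>\<^bsub>S\<^esub> v) w = inprod S u w + inprod S v w"
      using u v w infsum_add[OF summable_inprod[OF u w] summable_inprod[OF v w]]
      by (simp add: pre_hilbert_space.inprod_add_left[OF pre_hilbert])
  next
    fix v w c
    assume v: "v \<in> carrier S" and w: "w \<in> carrier S"
    have "inprod S v w = (\<Sum>\<^sub>\<infinity>i. cnj (inprod (H i) (w i) (v i)))"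
      using v w by (simp add: pre_hilbert_space.inprod_commute[OF pre_hilbert, of "v _"])
    then show "inprod S v w = cnj (inprod S w v)"
      by simp
    show "inprod S (c \<odot>\<^bsub>S\<^esub> v) w = c * inprod S v w"
      using v w infsum_cmult_right[OF summable_inprod[OF v w]]
      by (simp add: pre_hilbert_space.inprod_scale_left[OF pre_hilbert])
  next
    fix v assume v: "v \<in> carrier S"
    show "0 \<le> Re (inprod S v v)"
      unfolding sum_inprod_self[OF v] by (simp add: infsum_nonneg)
    assume "inprod S v v = 0"
    then have 0: "(\<Sum>\<^sub>\<infinity>i. (hnorm (H i) (v i))\<^sup>2) = 0"
      unfolding sum_inprod_self[OF v] by simp
    have "v i = \<zero>\<^bsub>H i\<^esub>" for i
    proof -
      have "(hnorm (H i) (v i))\<^sup>2 = 0"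
        by (rule nonneg_infsum_le_0D[where A = UNIV and f = "\<lambda>i. (hnorm (H i) (v i))\<^sup>2"])
          (use 0 v in auto)
      then show ?thesis
        using v pre_hilbert_space.norm_eq_zero_iff[OF pre_hilbert, of "v i"] by simp
    qed
    then show "v = \<zero>\<^bsub>S\<^esub>"
      by auto
  qed
  fix u v w c b
  assume v: "v \<in> carrier S"
  then have vi: "v i \<in> carrier (H i)" for i
    by simp
  show "\<zero>\<^bsub>S\<^esub> \<oplus>\<^bsub>S\<^esub> v = v"
    using vi by (simp add: abelian_monoid.l_zero[OF mo])
  show "(-1) \<odot>\<^bsub>S\<^esub> v \<oplus>\<^bsub>S\<^esub> v = \<zero>\<^bsub>S\<^esub>"
    using vi by (simp add: abelian_group.l_neg[OF ab] flip: pre_hilbert_space.uminus_eq_scale[OF pre_hilbert])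
  show "(c + b) \<odot>\<^bsub>S\<^esub> v = c \<odot>\<^bsub>S\<^esub> v \<oplus>\<^bsub>S\<^esub> b \<odot>\<^bsub>S\<^esub> v"
    using vi by (simp add: pre_hilbert_space.scale_add_left[OF pre_hilbert])
  show "(c * b) \<odot>\<^bsub>S\<^esub> v = c \<odot>\<^bsub>S\<^esub> (b \<odot>\<^bsub>S\<^esub> v)"
    using vi by (simp add: pre_hilbert_space.scale_scale[OF pre_hilbert])
  show "1 \<odot>\<^bsub>S\<^esub> v = v"
    using vi by (simp add: pre_hilbert_space.scale_one[OF pre_hilbert])
  assume w: "w \<in> carrier S"
  then have wi: "w i \<in> carrier (H i)" for i
    by simp
  show "v \<oplus>\<^bsub>S\<^esub> w = w \<oplus>\<^bsub>S\<^esub> v"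
    using vi wi by (simp add: abelian_monoid.a_comm[OF mo])
  show "c \<odot>\<^bsub>S\<^esub> (v \<oplus>\<^bsub>S\<^esub> w) = c \<odot>\<^bsub>S\<^esub> v \<oplus>\<^bsub>S\<^esub> c \<odot>\<^bsub>S\<^esub> w"
    using vi wi by (simp add: pre_hilbert_space.scale_add_right[OF pre_hilbert])
  assume u: "u \<in> carrier S"
  then have ui: "u i \<in> carrier (H i)" for i
    by simp
  show "u \<oplus>\<^bsub>S\<^esub> v \<oplus>\<^bsub>S\<^esub> w = u \<oplus>\<^bsub>S\<^esub> (v \<oplus>\<^bsub>S\<^esub> w)"
    using ui vi wi by (simp add: abelian_monoid.a_assoc[OF mo])
qed (fact sum_zero sum_scale sum_add)+

sublocale S: pre_hilbert_space S
  by (rule pre_hilbert_sum)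

lemma sum_minus:
  assumes "f \<in> carrier S" "g \<in> carrier S"
  shows "f \<ominus>\<^bsub>S\<^esub> g = (\<lambda>i. f i \<ominus>\<^bsub>H i\<^esub> g i)"
  unfolding S.minus_eq_scale[OF assms]
  using assms by (simp add: pre_hilbert_space.minus_eq_scale[OF pre_hilbert])

lemma sum_hdist_sq:
  assumes "f \<in> carrier S" "g \<in> carrier S"
  shows "(\<lambda>i. (hdist (H i) (f i) (g i))\<^sup>2) summable_on UNIV"
    "(hdist S f g)\<^sup>2 = (\<Sum>\<^sub>\<infinity>i. (hdist (H i) (f i) (g i))\<^sup>2)"
proof -
  have fg: "f \<ominus>\<^bsub>S\<^esub> g \<in> carrier S"
    using assms by (rule S.minus_carrier)
  have eq: "hdist (H i) (f i) (g i) = hnorm (H i) ((f \<ominus>\<^bsub>S\<^esub> g) i)" for i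
    using assms unfolding sum_minus[OF assms] by (simp add: hdist_def)
  show "(\<lambda>i. (hdist (H i) (f i) (g i))\<^sup>2) summable_on UNIV"
    unfolding eq using fg by simp
  show "(hdist S f g)\<^sup>2 = (\<Sum>\<^sub>\<infinity>i. (hdist (H i) (f i) (g i))\<^sup>2)"
    unfolding eq using sum_norm_sq[OF fg] S.hdist_eq[OF assms] by simp
qed

lemma finite_sum_hdist_le:
  assumes "f \<in> carrier S" "g \<in> carrier S" "finite J"
  shows "(\<Sum>i\<in>J. (hdist (H i) (f i) (g i))\<^sup>2) \<le> (hdist S f g)\<^sup>2"
  unfolding sum_hdist_sq(2)[OF assms(1,2)]
  using assms(3) sum_hdist_sq(1)[OF assms(1,2)] by (intro finite_sum_le_infsum) auto

lemma hdist_component_le: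
  assumes "f \<in> carrier S" "g \<in> carrier S"
  shows "hdist (H i) (f i) (g i) \<le> hdist S f g"
proof (rule power2_le_imp_le)
  show "(hdist (H i) (f i) (g i))\<^sup>2 \<le> (hdist S f g)\<^sup>2"
    using finite_sum_hdist_le[OF assms, of "{i}"] by simp
qed (rule Metric_space.nonneg[OF S.Metric_space_hdist])

text \<open>The candidate \<open>l\<close> is the coordinatewise limit. The Cauchy estimate
  restricted to a finite set \<open>J\<close> of coordinates survives the passage to the limit, with
  a bound independent of \<open>J\<close>, so the difference from \<open>l\<close> lies in the sum
  and has small norm.\<close>

lemma mcomplete_sum: "Metric_space.mcomplete (carrier S) (hdist S)"
  unfolding mcomplete_iff[OF S.Metric_space_hdist]
proof (intro allI impI, elim conjE)
  fix \<sigma> :: "nat \<Rightarrow> 'i \<Rightarrow> 'h"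
  assume \<sigma>0: "\<forall>n. \<sigma> n \<in> carrier S"
    and C: "\<forall>\<epsilon>>0. \<exists>N. \<forall>m\<ge>N. \<forall>n\<ge>N. hdist S (\<sigma> m) (\<sigma> n) < \<epsilon>"
  have \<sigma>: "\<sigma> n \<in> carrier S" for n
    using \<sigma>0 by blast
  have \<sigma>i: "\<sigma> n i \<in> carrier (H i)" for n i
    using \<sigma>[of n] by simp
  note ms = pre_hilbert_space.Metric_space_hdist[OF pre_hilbert]
  have "\<exists>l\<in>carrier (H i). \<forall>\<epsilon>>0. \<exists>N. \<forall>n\<ge>N. hdist (H i) (\<sigma> n i) l < \<epsilon>" for i
  proof (rule mcomplete_iff[OF ms, THEN iffD1, OF hilbert_space.complete[OF hilbert], rule_format], intro conjI allI impI)
    show "\<sigma> n i \<in> carrier (H i)" for n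
      by (rule \<sigma>i)
    fix \<epsilon> :: real assume "0 < \<epsilon>"
    then obtain N where N: "\<forall>m\<ge>N. \<forall>n\<ge>N. hdist S (\<sigma> m) (\<sigma> n) < \<epsilon>"
      using C by blast
    show "\<exists>N. \<forall>m\<ge>N. \<forall>n\<ge>N. hdist (H i) (\<sigma> m i) (\<sigma> n i) < \<epsilon>"
      using N hdist_component_le[OF \<sigma> \<sigma>, of i] by (meson le_less_trans)
  qed
  then obtain l where l: "\<And>i. l i \<in> carrier (H i)"
    "\<And>i. \<forall>\<epsilon>>0. \<exists>N. \<forall>n\<ge>N. hdist (H i) (\<sigma> n i) (l i) < \<epsilon>"
    by metis
  have lim0: "(\<lambda>m. hdist (H i) (\<sigma> m i) (l i)) \<longlonglongrightarrow> 0" for i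
    using l(2)[of i] Metric_space.nonneg[OF ms] by (simp add: LIMSEQ_def)
  have lim: "(\<lambda>m. hdist (H i) (\<sigma> n i) (\<sigma> m i)) \<longlonglongrightarrow> hdist (H i) (\<sigma> n i) (l i)" for n i
  proof -
    have "norm (hdist (H i) (\<sigma> n i) (\<sigma> m i) - hdist (H i) (\<sigma> n i) (l i)) \<le> hdist (H i) (\<sigma> m i) (l i)" for m
      using Metric_space.triangle[OF ms, of "\<sigma> n i" i "\<sigma> m i" "l i"]
        Metric_space.triangle[OF ms, of "\<sigma> n i" i "l i" "\<sigma> m i"] \<sigma>i l(1)
        Metric_space.commute[OF ms, of i "l i" "\<sigma> m i"]
      by (simp add: abs_le_iff)
    then have "(\<lambda>m. hdist (H i) (\<sigma> n i) (\<sigma> m i) - hdist (H i) (\<sigma> n i) (l i)) \<longlonglongrightarrow> 0"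
      by (intro Lim_null_comparison[OF _ lim0[of i]] always_eventually) blast
    then show ?thesis
      by (rule LIM_zero_cancel)
  qed
  have bound: "(\<Sum>i\<in>J. (hdist (H i) (\<sigma> n i) (l i))\<^sup>2) \<le> \<epsilon>\<^sup>2"
    if N: "\<forall>m\<ge>N. \<forall>n\<ge>N. hdist S (\<sigma> m) (\<sigma> n) < \<epsilon>" and n: "n \<ge> N" and J: "finite J" for N n J \<epsilon>
  proof (rule LIMSEQ_le_const2)
    show "(\<lambda>m. \<Sum>i\<in>J. (hdist (H i) (\<sigma> n i) (\<sigma> m i))\<^sup>2) \<longlonglongrightarrow> (\<Sum>i\<in>J. (hdist (H i) (\<sigma> n i) (l i))\<^sup>2)"
      by (intro tendsto_sum tendsto_power lim)
    have "(\<Sum>i\<in>J. (hdist (H i) (\<sigma> n i) (\<sigma> m i))\<^sup>2) \<le> \<epsilon>\<^sup>2" if "m \<ge> N" for m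
    proof -
      have "(hdist S (\<sigma> n) (\<sigma> m))\<^sup>2 \<le> \<epsilon>\<^sup>2"
        using N n that Metric_space.nonneg[OF S.Metric_space_hdist] by (intro power_mono) (auto intro: less_imp_le)
      then show ?thesis
        using finite_sum_hdist_le[OF \<sigma>[of n] \<sigma>[of m] J] by linarith
    qed
    then show "\<exists>N. \<forall>m\<ge>N. (\<Sum>i\<in>J. (hdist (H i) (\<sigma> n i) (\<sigma> m i))\<^sup>2) \<le> \<epsilon>\<^sup>2"
      by blast
  qed
  have diff: "(\<lambda>i. \<sigma> n i \<ominus>\<^bsub>H i\<^esub> l i) \<in> carrier S \<and> hnorm S (\<lambda>i. \<sigma> n i \<ominus>\<^bsub>H i\<^esub> l i) \<le> \<epsilon>"
    if N: "\<forall>m\<ge>N. \<forall>n\<ge>N. hdist S (\<sigma> m) (\<sigma> n) < \<epsilon>" and n: "n \<ge> N" and \<epsilon>: "\<epsilon> > 0" for N n \<epsilon>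
  proof
    let ?g = "\<lambda>i. \<sigma> n i \<ominus>\<^bsub>H i\<^esub> l i"
    have eq: "hdist (H i) (\<sigma> n i) (l i) = hnorm (H i) (?g i)" for i
      using \<sigma>i l(1) by (simp add: hdist_def)
    have b: "(\<Sum>i\<in>J. (hnorm (H i) (?g i))\<^sup>2) \<le> \<epsilon>\<^sup>2" if "finite J" for J
      using bound[OF N n that] by (simp add: eq)
    then have "(\<lambda>i. (hnorm (H i) (?g i))\<^sup>2) summable_on UNIV"
      by (intro nonneg_bdd_above_summable_on) (auto intro!: bdd_aboveI[of _ "\<epsilon>\<^sup>2"])
    then show g: "?g \<in> carrier S"
      using \<sigma>i l(1) pre_hilbert_space.minus_carrier[OF pre_hilbert] by simp
    have "(\<Sum>\<^sub>\<infinity>i. (hnorm (H i) (?g i))\<^sup>2) \<le> \<epsilon>\<^sup>2"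
      using g b by (intro infsum_le_finite_sums) auto
    then have "(hnorm S ?g)\<^sup>2 \<le> \<epsilon>\<^sup>2"
      unfolding sum_norm_sq[OF g] .
    then show "hnorm S ?g \<le> \<epsilon>"
      by (rule power2_le_imp_le) (use \<epsilon> in simp)
  qed
  obtain N where N: "\<forall>m\<ge>N. \<forall>n\<ge>N. hdist S (\<sigma> m) (\<sigma> n) < 1"
    using C zero_less_one by blast
  \<comment> \<open>Square-summability of \<open>l\<close> itself is obtained by writing it as the
    difference of two members of the sum.\<close>
  have "\<sigma> N \<ominus>\<^bsub>S\<^esub> (\<lambda>i. \<sigma> N i \<ominus>\<^bsub>H i\<^esub> l i) \<in> carrier S"
    using diff[OF N order_refl] \<sigma> by (intro S.minus_carrier) auto
  also have "\<sigma> N \<ominus>\<^bsub>S\<^esub> (\<lambda>i. \<sigma> N i \<ominus>\<^bsub>H i\<^esub> l i) = l"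
  proof -
    have "\<sigma> N i \<ominus>\<^bsub>H i\<^esub> (\<sigma> N i \<ominus>\<^bsub>H i\<^esub> l i) = l i" for i
    proof -
      interpret pre_hilbert_space "H i" by (rule pre_hilbert)
      have "l i \<oplus>\<^bsub>H i\<^esub> (\<sigma> N i \<ominus>\<^bsub>H i\<^esub> l i) = \<sigma> N i"
        using \<sigma>i l(1) by (intro add_minus_cancel)
      then show ?thesis
        using \<sigma>i[of N i] l(1)[of i] minus_carrier[OF \<sigma>i l(1), of N]
        by (metis M.add.inv_solve_right a_minus_def)
    qed
    then show ?thesis
      using diff[OF N order_refl] \<sigma> by (subst sum_minus) auto
  qed
  finally have lS: "l \<in> carrier S" .
  show "\<exists>l\<in>carrier S. \<forall>\<epsilon>>0. \<exists>N. \<forall>n\<ge>N. hdist S (\<sigma> n) l < \<epsilon>"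
  proof (intro bexI[OF _ lS] allI impI)
    fix \<epsilon> :: real assume \<epsilon>: "0 < \<epsilon>"
    then obtain N where N: "\<forall>m\<ge>N. \<forall>n\<ge>N. hdist S (\<sigma> m) (\<sigma> n) < \<epsilon> / 2"
      using C half_gt_zero by blast
    have "hdist S (\<sigma> n) l < \<epsilon>" if "n \<ge> N" for n
    proof -
      have "hdist S (\<sigma> n) l \<le> \<epsilon> / 2"
        unfolding S.hdist_eq[OF \<sigma> lS] sum_minus[OF \<sigma> lS] using diff[OF N that] \<epsilon> by auto
      then show ?thesis using \<epsilon> by linarith
    qed
    then show "\<exists>N. \<forall>n\<ge>N. hdist S (\<sigma> n) l < \<epsilon>"
      by blast
  qed
qed

definition single :: "'i \<Rightarrow> 'h \<Rightarrow> 'i \<Rightarrow> 'h" where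
  "single i v = (\<lambda>j. if j = i then v else \<zero>\<^bsub>H j\<^esub>)"

lemma single_has_sum:
  "((\<lambda>j. (hnorm (H j) (single i v j))\<^sup>2) has_sum (hnorm (H i) v)\<^sup>2) UNIV"
proof -
  have "((\<lambda>j. (hnorm (H j) (single i v j))\<^sup>2) has_sum (\<Sum>j\<in>{i}. (hnorm (H j) (single i v j))\<^sup>2)) UNIV"
    by (rule has_sum_finite_neutralI[of "{i}"]) (auto simp: single_def component)
  then show ?thesis
    by (simp add: single_def)
qed

lemma single_closed: "v \<in> carrier (H i) \<Longrightarrow> single i v \<in> carrier S"
  using has_sum_imp_summable[OF single_has_sum[of i v]] by (auto simp: single_def component)

lemma norm_single:
  assumes "v \<in> carrier (H i)"
  shows "hnorm S (single i v) = hnorm (H i) v"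
proof (rule power2_eq_imp_eq)
  show "(hnorm S (single i v))\<^sup>2 = (hnorm (H i) v)\<^sup>2"
    unfolding sum_norm_sq[OF single_closed[OF assms]] by (rule infsumI[OF single_has_sum])
qed (use assms in \<open>simp_all add: component single_closed del: hilbert_sum_simps\<close>)

lemma finsum_component:
  assumes "finite B" "\<And>b. b \<in> B \<Longrightarrow> f b \<in> carrier S"
  shows "(\<Oplus>\<^bsub>S\<^esub>b\<in>B. f b) i = (\<Oplus>\<^bsub>H i\<^esub>b\<in>B. f b i)"
proof -
  interpret pre_hilbert_space "H i" by (rule pre_hilbert)
  show ?thesis
    using assms
  proof (induction B rule: finite_induct)
    case (insert b B)
    then have "(\<Oplus>\<^bsub>S\<^esub>b\<in>insert b B. f b) = f b \<oplus>\<^bsub>S\<^esub> (\<Oplus>\<^bsub>S\<^esub>b\<in>B. f b)"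
      by (intro S.finsum_insert') auto
    moreover have "(\<Oplus>\<^bsub>H i\<^esub>b\<in>insert b B. f b i) = f b i \<oplus>\<^bsub>H i\<^esub> (\<Oplus>\<^bsub>H i\<^esub>b\<in>B. f b i)"
      using insert by (intro finsum_insert') auto
    ultimately show ?case
      using insert by simp
  qed simp
qed

text \<open>The i-th coordinates of a finite spanning set of the sum would span the i-th summand,
  because each of its vectors is the i-th coordinate of an embedded one.\<close>

lemma infinite_dimensional_sum: "\<not> finite_dimensional S"
proof
  assume "finite_dimensional S"
  then obtain B where B: "finite B" "B \<subseteq> carrier S"
    "\<And>v. v \<in> carrier S \<Longrightarrow> \<exists>c. v = (\<Oplus>\<^bsub>S\<^esub>b\<in>B. c b \<odot>\<^bsub>S\<^esub> b)"
    unfolding finite_dimensional_def by blast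
  \<comment> \<open>One summand suffices for the contradiction, and there is one because types are
    non-empty.\<close>
  fix i :: 'i
  interpret pre_hilbert_space "H i" by (rule pre_hilbert)
  have Bi: "b i \<in> carrier (H i)" if "b \<in> B" for b
    using B(2) that by auto
  obtain E where E: "orthonormal E" "\<And>b. b \<in> (\<lambda>b. b i) ` B \<Longrightarrow> proj E b = b"
    using Gram_Schmidt[of "(\<lambda>b. b i) ` B"] B(1) Bi by blast
  have "proj E v = v" if v: "v \<in> carrier (H i)" for v
  proof -
    obtain c where c: "single i v = (\<Oplus>\<^bsub>S\<^esub>b\<in>B. c b \<odot>\<^bsub>S\<^esub> b)"
      using B(3)[OF single_closed[OF v]] by blast
    have "v = single i v i"
      by (simp add: single_def)
    also have "\<dots> = (\<Oplus>\<^bsub>H i\<^esub>b\<in>B. (c b \<odot>\<^bsub>S\<^esub> b) i)"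
      unfolding c using B(1,2) by (intro finsum_component) (auto simp del: hilbert_sum_simps)
    finally have vB: "v = (\<Oplus>\<^bsub>H i\<^esub>b\<in>B. c b \<odot>\<^bsub>H i\<^esub> b i)"
      by simp
    show ?thesis
      unfolding vB using B(1) Bi E by (intro proj_finsum) (auto simp: proj_scale)
  qed
  then show False
    using E(1) finite_dimensional_iff hilbert_space.infinite_dimensional[OF hilbert] by blast
qed

lemma hilbert_space_sum: "hilbert_space S"
  by (intro hilbert_space.intro hilbert_space_axioms.intro mcomplete_sum infinite_dimensional_sum
      S.module_axioms S.inprod_commute S.inprod_add_left S.inprod_scale_left S.inprod_nonneg S.inprod_definite)

end


section \<open>Unitary representations and their Hilbert sums\<close>

lemma unitary_representationI:
  assumes G: "group G" and H: "pre_hilbert_space H"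
    and closed: "\<And>g v. g \<in> carrier G \<Longrightarrow> v \<in> carrier H \<Longrightarrow> \<pi> g v \<in> carrier H"
    and add: "\<And>g v w. g \<in> carrier G \<Longrightarrow> v \<in> carrier H \<Longrightarrow> w \<in> carrier H \<Longrightarrow>
      \<pi> g (v \<oplus>\<^bsub>H\<^esub> w) = \<pi> g v \<oplus>\<^bsub>H\<^esub> \<pi> g w"
    and scale: "\<And>g c v. g \<in> carrier G \<Longrightarrow> v \<in> carrier H \<Longrightarrow> \<pi> g (c \<odot>\<^bsub>H\<^esub> v) = c \<odot>\<^bsub>H\<^esub> \<pi> g v"
    and inprod: "\<And>g v w. g \<in> carrier G \<Longrightarrow> v \<in> carrier H \<Longrightarrow> w \<in> carrier H \<Longrightarrow>
      inprod H (\<pi> g v) (\<pi> g w) = inprod H v w"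
    and one: "\<And>v. v \<in> carrier H \<Longrightarrow> \<pi> \<one>\<^bsub>G\<^esub> v = v"
    and mult: "\<And>g h v. g \<in> carrier G \<Longrightarrow> h \<in> carrier G \<Longrightarrow> v \<in> carrier H \<Longrightarrow>
      \<pi> (g \<otimes>\<^bsub>G\<^esub> h) v = \<pi> g (\<pi> h v)"
  shows "unitary_representation G H \<pi>"
proof -
  interpret G: group G by fact
  \<comment> \<open>Bijectivity comes for free from the group: the inverse element acts as a
    two-sided inverse.\<close>
  have "bij_betw (\<pi> g) (carrier H) (carrier H)" if g: "g \<in> carrier G" for g
  proof (rule bij_betw_byWitness[where f' = "\<pi> (inv\<^bsub>G\<^esub> g)"])
    show "\<forall>v\<in>carrier H. \<pi> (inv\<^bsub>G\<^esub> g) (\<pi> g v) = v"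
      using g by (simp add: one flip: mult)
    show "\<forall>v\<in>carrier H. \<pi> g (\<pi> (inv\<^bsub>G\<^esub> g) v) = v"
      using g by (simp add: one flip: mult)
  qed (use g closed in auto)
  then show ?thesis
    unfolding unitary_representation_def unitary_operator_def
    by (simp add: add scale inprod one mult)
qed

lemma (in unitary_rep) act_zero: "g \<in> carrier G \<Longrightarrow> \<pi> g \<zero>\<^bsub>H\<^esub> = \<zero>\<^bsub>H\<^esub>"
  using act_scale[of g "\<zero>\<^bsub>H\<^esub>" 0] act_closed[of g "\<zero>\<^bsub>H\<^esub>"] by simp

text \<open>The modulus is applied to the multiple of \<open>v\<close> of norm exactly i. The
  outcome is homogeneous in \<open>v\<close>, so it can be squared and summed over the coordinates;
  it is strict because \<open>v\<close> is non-zero.\<close>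

lemma (in unitary_rep) F_continuous_scaled:
  assumes F: "F_continuous F G d H \<pi>" and i: "i \<ge> 1" and g: "g \<in> carrier G" "g' \<in> carrier G"
    and \<epsilon>: "\<epsilon> > 0" and d: "d g g' < F i \<epsilon>" and v: "v \<in> carrier H" "v \<noteq> \<zero>\<^bsub>H\<^esub>"
  shows "hnorm H (\<pi> g v \<ominus>\<^bsub>H\<^esub> \<pi> g' v) < \<epsilon> / real i * hnorm H v"
proof -
  have nv: "hnorm H v > 0"
    using v norm_nonneg[of v] norm_eq_zero_iff[of v] by linarith
  define c where "c = complex_of_real (real i / hnorm H v)"
  have c: "cmod c = real i / hnorm H v"
    using nv by (simp add: c_def norm_divide)
  have "c \<odot>\<^bsub>H\<^esub> v \<in> hball H i"
    using v nv c by (simp add: hball_def)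
  then have "hnorm H (\<pi> g (c \<odot>\<^bsub>H\<^esub> v) \<ominus>\<^bsub>H\<^esub> \<pi> g' (c \<odot>\<^bsub>H\<^esub> v)) < \<epsilon>"
    using F i g \<epsilon> d unfolding F_continuous_def by blast
  also have "\<pi> g (c \<odot>\<^bsub>H\<^esub> v) \<ominus>\<^bsub>H\<^esub> \<pi> g' (c \<odot>\<^bsub>H\<^esub> v) = c \<odot>\<^bsub>H\<^esub> (\<pi> g v \<ominus>\<^bsub>H\<^esub> \<pi> g' v)"
    using v g by (simp add: act_scale scale_minus_right)
  also have "hnorm H \<dots> = real i / hnorm H v * hnorm H (\<pi> g v \<ominus>\<^bsub>H\<^esub> \<pi> g' v)"
    using v g c by simp
  finally show ?thesis
    using nv i by (simp add: field_simps)
qed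

locale rep_family = hilbert_family H for H :: "'i \<Rightarrow> 'h inner_module" +
  fixes G :: "'g monoid" and \<pi> :: "'i \<Rightarrow> 'g \<Rightarrow> 'h \<Rightarrow> 'h"
  assumes group: "group G" and rep: "unitary_representation G (H i) (\<pi> i)"
begin

lemma component_rep: "unitary_rep (H i) G (\<pi> i)"
  by (intro unitary_rep.intro unitary_rep_axioms.intro pre_hilbert rep)

definition sum_rep :: "'g \<Rightarrow> ('i \<Rightarrow> 'h) \<Rightarrow> 'i \<Rightarrow> 'h" where
  "sum_rep g f = (\<lambda>i. \<pi> i g (f i))"

lemma sum_rep: "unitary_representation G S sum_rep"
proof (rule unitary_representationI[OF group pre_hilbert_sum])
  fix g h v w c
  assume g: "g \<in> carrier G" and v: "v \<in> carrier S"
  have vi: "v i \<in> carrier (H i)" for i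
    using v by simp
  show "sum_rep g v \<in> carrier S"
    using v g by (simp add: sum_rep_def unitary_rep.act_closed[OF component_rep] unitary_rep.act_norm[OF component_rep])
  show "sum_rep g (c \<odot>\<^bsub>S\<^esub> v) = c \<odot>\<^bsub>S\<^esub> sum_rep g v"
    using g vi by (simp add: sum_rep_def unitary_rep.act_scale[OF component_rep])
  show "sum_rep (g \<otimes>\<^bsub>G\<^esub> h) v = sum_rep g (sum_rep h v)" if "h \<in> carrier G"
    using g vi that by (simp add: sum_rep_def unitary_rep.act_mult[OF component_rep])
  assume w: "w \<in> carrier S"
  have wi: "w i \<in> carrier (H i)" for i
    using w by simp
  show "sum_rep g (v \<oplus>\<^bsub>S\<^esub> w) = sum_rep g v \<oplus>\<^bsub>S\<^esub> sum_rep g w"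
    using g vi wi by (simp add: sum_rep_def unitary_rep.act_add[OF component_rep])
  show "inprod S (sum_rep g v) (sum_rep g w) = inprod S v w"
    using g vi wi by (simp add: sum_rep_def unitary_rep.act_inprod[OF component_rep])
next
  show "sum_rep \<one>\<^bsub>G\<^esub> v = v" if "v \<in> carrier S" for v
    using that by (simp add: sum_rep_def unitary_rep.act_one[OF component_rep])
qed

sublocale rep_S: unitary_rep S G sum_rep
  by (intro unitary_rep.intro unitary_rep_axioms.intro pre_hilbert_sum sum_rep)

text \<open>A coordinate of a vector in the ball of radius n can have any smaller norm, and the
  moduli must not change; the rescaled estimates have the common factor
  \<open>\<epsilon> / n\<close> and add up without loss.\<close>

lemma F_continuous_sum:
  assumes F: "\<And>i. F_continuous F G d (H i) (\<pi> i)"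
  shows "F_continuous F G d S sum_rep"
  unfolding F_continuous_def
proof (intro allI impI ballI)
  fix n :: nat and g g' v and \<epsilon> :: real
  assume n: "1 \<le> n" and g: "g \<in> carrier G" "g' \<in> carrier G" and vn: "v \<in> hball S n"
    and \<epsilon>: "0 < \<epsilon>" and d: "d g g' < F n \<epsilon>"
  have v: "v \<in> carrier S" and nv: "hnorm S v \<le> real n"
    using vn by (auto simp: hball_def simp del: hilbert_sum_simps)
  have vi: "v i \<in> carrier (H i)" for i
    using v by simp
  define w where "w = sum_rep g v \<ominus>\<^bsub>S\<^esub> sum_rep g' v"
  have gv: "sum_rep g v \<in> carrier S" "sum_rep g' v \<in> carrier S"
    using g v by (auto simp del: hilbert_sum_simps)
  have w: "w \<in> carrier S"
    unfolding w_def by (intro S.minus_carrier gv)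
  have wi: "w i = \<pi> i g (v i) \<ominus>\<^bsub>H i\<^esub> \<pi> i g' (v i)" for i
    unfolding w_def sum_minus[OF gv] by (simp add: sum_rep_def)
  have less: "hnorm (H i) (w i) < \<epsilon> / real n * hnorm (H i) (v i)" if "v i \<noteq> \<zero>\<^bsub>H i\<^esub>" for i
    unfolding wi by (rule unitary_rep.F_continuous_scaled[OF component_rep F n g \<epsilon> d vi that])
  have le: "hnorm (H i) (w i) \<le> \<epsilon> / real n * hnorm (H i) (v i)" for i
  proof (cases "v i = \<zero>\<^bsub>H i\<^esub>")
    case True
    interpret unitary_rep "H i" G "\<pi> i" by (rule component_rep)
    have "\<zero>\<^bsub>H i\<^esub> \<ominus>\<^bsub>H i\<^esub> \<zero>\<^bsub>H i\<^esub> = \<zero>\<^bsub>H i\<^esub>"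
      by (simp add: minus_eq_zero_iff)
    then show ?thesis
      unfolding wi True using g by (simp add: act_zero)
  qed (use less less_imp_le in blast)
  have sq_le: "(hnorm (H i) (w i))\<^sup>2 \<le> (\<epsilon> / real n)\<^sup>2 * (hnorm (H i) (v i))\<^sup>2" for i
  proof -
    have "0 \<le> hnorm (H i) (w i)"
      using w by (simp add: component)
    then show ?thesis
      using power_mono[OF le[of i], of 2] by (simp only: power_mult_distrib)
  qed
  have hs: "((\<lambda>i. (hnorm (H i) (w i))\<^sup>2) has_sum (hnorm S w)\<^sup>2) UNIV"
    unfolding sum_norm_sq[OF w] using w by (intro has_sum_infsum) simp
  have hs': "((\<lambda>i. (\<epsilon> / real n)\<^sup>2 * (hnorm (H i) (v i))\<^sup>2) has_sum (\<epsilon> / real n)\<^sup>2 * (hnorm S v)\<^sup>2) UNIV"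
    unfolding sum_norm_sq[OF v] using v by (intro has_sum_cmult_right has_sum_infsum) simp
  show "hnorm S (sum_rep g v \<ominus>\<^bsub>S\<^esub> sum_rep g' v) < \<epsilon>"
  proof (cases "\<exists>i. v i \<noteq> \<zero>\<^bsub>H i\<^esub>")
    case True
    then obtain i where i: "v i \<noteq> \<zero>\<^bsub>H i\<^esub>" by blast
    have "0 \<le> hnorm (H i) (w i)"
      using w by (simp add: component)
    then have "(hnorm (H i) (w i))\<^sup>2 < (\<epsilon> / real n)\<^sup>2 * (hnorm (H i) (v i))\<^sup>2"
      using power_strict_mono[OF less[OF i], of 2] by (simp only: power_mult_distrib)
    \<comment> \<open>A weak inequality in all coordinates and a strict one at \<open>i\<close> give
      a strict inequality of the sums.\<close>
    then have "(hnorm S w)\<^sup>2 < (\<epsilon> / real n)\<^sup>2 * (hnorm S v)\<^sup>2"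
      by (intro has_sum_strict_mono[OF hs hs' sq_le, of i]) auto
    also have "\<dots> \<le> (\<epsilon> / real n)\<^sup>2 * (real n)\<^sup>2"
      using nv v by (intro mult_left_mono power_mono S.norm_nonneg) (auto simp del: hilbert_sum_simps)
    also have "\<dots> = \<epsilon>\<^sup>2"
      using n by (simp add: power_divide)
    finally show ?thesis
      unfolding w_def[symmetric] by (rule power2_less_imp_less) (use \<epsilon> in simp)
  next
    case False
    have "hnorm (H i) (w i) \<le> 0" for i
      using le[of i] False by (simp add: component)
    moreover have "0 \<le> hnorm (H i) (w i)" for i
      using w by (simp add: component)
    ultimately have "hnorm (H i) (w i) = 0" for i
      by (simp add: order_antisym)
    then have "(hnorm S w)\<^sup>2 = 0"
      unfolding sum_norm_sq[OF w] by simp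
    then show ?thesis
      unfolding w_def[symmetric] using \<epsilon> by simp
  qed
qed

lemma invariant_component:
  assumes "invariant_vector G S sum_rep v"
  shows "invariant_vector G (H i) (\<pi> i) (v i)"
  using assms by (auto simp: invariant_vector_def sum_rep_def dest: fun_cong)

text \<open>The embedding of a summand is isometric and commutes with the action, so the set of
  displacements is unchanged.\<close>

lemma almost_invariant_single:
  assumes "almost_invariant_unit_vector (H i) (\<pi> i) Q \<epsilon> v" "Q \<subseteq> carrier G"
  shows "almost_invariant_unit_vector S sum_rep Q \<epsilon> (single i v)"
proof -
  interpret Hi: unitary_rep "H i" G "\<pi> i" by (rule component_rep)
  note v = Hi.almost_invariant_unit_vectorD[OF assms]
  have "hnorm S (sum_rep x (single i v) \<ominus>\<^bsub>S\<^esub> single i v) = hnorm (H i) (\<pi> i x v \<ominus>\<^bsub>H i\<^esub> v)" if "x \<in> Q" for x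
  proof -
    have x: "x \<in> carrier G"
      using that assms(2) by blast
    have "\<pi> j x \<zero>\<^bsub>H j\<^esub> = \<zero>\<^bsub>H j\<^esub>" for j
      by (rule unitary_rep.act_zero[OF component_rep x])
    then have e1: "sum_rep x (single i v) = single i (\<pi> i x v)"
      by (auto simp: sum_rep_def single_def)
    have xv: "\<pi> i x v \<in> carrier (H i)"
      using x v(1) by simp
    have "single i (\<pi> i x v) \<ominus>\<^bsub>S\<^esub> single i v = single i (\<pi> i x v \<ominus>\<^bsub>H i\<^esub> v)"
      unfolding sum_minus[OF single_closed[OF xv] single_closed[OF v(1)]]
      by (auto simp: single_def pre_hilbert_space.minus_eq_zero_iff[OF pre_hilbert] component)
    then show ?thesis
      unfolding e1 using xv v(1) by (simp add: norm_single)
  qed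
  then have "(\<lambda>x. hnorm S (sum_rep x (single i v) \<ominus>\<^bsub>S\<^esub> single i v)) ` Q =
      (\<lambda>x. hnorm (H i) (\<pi> i x v \<ominus>\<^bsub>H i\<^esub> v)) ` Q"
    by (intro image_cong) auto
  then show ?thesis
    using assms(1) v(1,2) single_closed[OF v(1)] norm_single[OF v(1)]
    unfolding almost_invariant_unit_vector_def by (simp del: hilbert_sum_simps)
qed

end

theorem exists_almost_invariant_without_invariant:
  fixes G :: "'g monoid" and F :: "nat \<Rightarrow> real \<Rightarrow> real"
  assumes G: "metric_group G d"
    and ex: "\<And>Q \<epsilon>. compactin (group_topology G d) Q \<Longrightarrow> \<epsilon> > 0 \<Longrightarrow>
         \<exists>(H :: 'k inner_module) \<pi>.
            hilbert_space H \<and> unitary_representation G H \<pi> \<and> F_continuous F G d H \<pi> \<and>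
            (\<exists>v. almost_invariant_unit_vector H \<pi> Q \<epsilon> v) \<and>
            \<not> (\<exists>v. invariant_vector G H \<pi> v \<and> v \<noteq> \<zero>\<^bsub>H\<^esub>)"
  obtains H :: "('g set \<times> nat \<Rightarrow> 'k) inner_module" and \<pi>
  where "hilbert_space H" "unitary_representation G H \<pi>" "F_continuous F G d H \<pi>"
    "almost_contains_unit G d H \<pi>" "\<not> (\<exists>v. invariant_vector G H \<pi> v \<and> hnorm H v = 1)"
proof -
  interpret G: metric_group G d by fact
  have "\<exists>(H :: 'k inner_module) \<pi>.
      hilbert_space H \<and> unitary_representation G H \<pi> \<and> F_continuous F G d H \<pi> \<and>
      (compactin (group_topology G d) (fst i) \<longrightarrow>
        (\<exists>v. almost_invariant_unit_vector H \<pi> (fst i) (1 / real (Suc (snd i))) v)) \<and>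
      \<not> (\<exists>v. invariant_vector G H \<pi> v \<and> v \<noteq> \<zero>\<^bsub>H\<^esub>)" for i :: "'g set \<times> nat"
  proof -
    \<comment> \<open>The family has to be total on all pairs. A set that is not compact is replaced
      by the empty set, so that its summand still has no invariant vectors. The tolerance uses n +
      1, which is positive for n = 0 as well.\<close>
    let ?Q = "if compactin (group_topology G d) (fst i) then fst i else {}"
    have "compactin (group_topology G d) ?Q" "0 < 1 / real (Suc (snd i))"
      by auto
    from ex[OF this] obtain H :: "'k inner_module" and \<pi> where
      "hilbert_space H \<and> unitary_representation G H \<pi> \<and> F_continuous F G d H \<pi> \<and>
       (\<exists>v. almost_invariant_unit_vector H \<pi> ?Q (1 / real (Suc (snd i))) v) \<and>
       \<not> (\<exists>v. invariant_vector G H \<pi> v \<and> v \<noteq> \<zero>\<^bsub>H\<^esub>)"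
      by blast
    then show ?thesis
      by (intro exI[of _ H] exI[of _ \<pi>]) auto
  qed
  then obtain H :: "'g set \<times> nat \<Rightarrow> 'k inner_module" and \<pi> where
    H: "\<And>i. hilbert_space (H i)" "\<And>i. unitary_representation G (H i) (\<pi> i)"
      "\<And>i. F_continuous F G d (H i) (\<pi> i)"
    and ai: "\<And>i. compactin (group_topology G d) (fst i) \<Longrightarrow>
        \<exists>v. almost_invariant_unit_vector (H i) (\<pi> i) (fst i) (1 / real (Suc (snd i))) v"
    and ni: "\<And>i v. invariant_vector G (H i) (\<pi> i) v \<Longrightarrow> v = \<zero>\<^bsub>H i\<^esub>"
    by metis
  interpret rep_family H G \<pi>
    by (intro rep_family.intro hilbert_family.intro rep_family_axioms.intro H G.group_axioms)
  show ?thesis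
  proof (rule that[OF hilbert_space_sum sum_rep F_continuous_sum[OF H(3)]])
    show "almost_contains_unit G d S sum_rep"
      unfolding almost_contains_unit_def
    proof (intro allI impI)
      fix Q and \<epsilon> :: real
      assume Q: "compactin G.mtopology Q" and "0 < \<epsilon>"
      then obtain n where n: "inverse (real (Suc n)) < \<epsilon>"
        using reals_Archimedean by blast
      have QG: "Q \<subseteq> carrier G"
        using compactin_subset_topspace[OF Q] by simp
      obtain v where "almost_invariant_unit_vector (H (Q, n)) (\<pi> (Q, n)) Q (1 / real (Suc n)) v"
        using ai[of "(Q, n)"] Q by auto
      then have "almost_invariant_unit_vector S sum_rep Q (1 / real (Suc n)) (single (Q, n) v)"
        using QG by (rule almost_invariant_single)
      then have "almost_invariant_unit_vector S sum_rep Q \<epsilon> (single (Q, n) v)"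
        using n unfolding almost_invariant_unit_vector_def inverse_eq_divide
        by (simp del: hilbert_sum_simps)
      then show "\<exists>v. almost_invariant_unit_vector S sum_rep Q \<epsilon> v"
        by blast
    qed
    show "\<not> (\<exists>v. invariant_vector G S sum_rep v \<and> hnorm S v = 1)"
    proof
      assume "\<exists>v. invariant_vector G S sum_rep v \<and> hnorm S v = 1"
      then obtain v where v: "invariant_vector G S sum_rep v" "hnorm S v = 1"
        by blast
      have "v i = \<zero>\<^bsub>H i\<^esub>" for i
        using ni[OF invariant_component[OF v(1)]] .
      then have "v = \<zero>\<^bsub>S\<^esub>"
        by auto
      then show False
        using v(2) S.norm_zero by simp
    qed
  qed
qed


section \<open>Elementary substructures and reducts\<close>

definition assignment :: "('s, 'f, 'r, 'u) mstruct \<Rightarrow> ('s \<Rightarrow> nat \<Rightarrow> 'u) \<Rightarrow> bool" where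
  "assignment M a \<longleftrightarrow> (\<forall>s n. a s n \<in> sort_set M s)"

lemma assignment_update:
  "assignment M a \<Longrightarrow> x \<in> sort_set M s \<Longrightarrow> assignment M (a(s := (a s)(n := x)))"
  by (simp add: assignment_def)

lemma tuples_map:
  "map f ts \<in> tuples M ss \<longleftrightarrow> list_all2 (\<lambda>t s. f t \<in> sort_set M s) ts ss"
  by (simp add: tuples_def list_all2_map1)

lemma tval_in_sort:
  assumes cl: "\<And>f xs. f \<in> fsyms L \<Longrightarrow> xs \<in> tuples M (fargs L f) \<Longrightarrow> fint M f xs \<in> sort_set M (fres L f)"
    and a: "assignment M a"
  shows "has_sort L t s \<Longrightarrow> tval M a t \<in> sort_set M s"
proof (induction t arbitrary: s)
  case (Var s' n)
  then show ?case using a by (simp add: assignment_def)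
next
  case (Fun f ts)
  then have "list_all2 (\<lambda>t s. tval M a t \<in> sort_set M s) ts (fargs L f)"
    by (auto elim: list_all2_mono simp: list_all2_conv_all_nth)
  with Fun.prems show ?case
    by (simp add: cl tuples_map)
qed

text \<open>A renaming that makes \<open>L0\<close> a part of \<open>L\<close>. Injectivity on sorts
  keeps variables of different sorts distinct, so that a quantifier binds the same variable after
  renaming.\<close>

definition lang_morphism ::
    "('s0, 'f0, 'r0) signat \<Rightarrow> ('s, 'f, 'r) signat \<Rightarrow> ('s0 \<Rightarrow> 's) \<Rightarrow> ('f0 \<Rightarrow> 'f) \<Rightarrow> ('r0 \<Rightarrow> 'r) \<Rightarrow> bool" where
  "lang_morphism L0 L \<sigma> F R \<longleftrightarrow> inj \<sigma> \<and>
     (\<forall>f\<in>fsyms L0. F f \<in> fsyms L \<and> fargs L (F f) = map \<sigma> (fargs L0 f) \<and> fres L (F f) = \<sigma> (fres L0 f)) \<and>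
     (\<forall>r\<in>rsyms L0. R r \<in> rsyms L \<and> rargs L (R r) = map \<sigma> (rargs L0 r))"

text \<open>\<open>M0\<close> is the reduct of \<open>M\<close> to the renamed language, up to the
  map \<open>e\<close> between the element types.\<close>

definition reduct_via ::
    "('s0, 'f0, 'r0) signat \<Rightarrow> ('s0 \<Rightarrow> 's) \<Rightarrow> ('f0 \<Rightarrow> 'f) \<Rightarrow> ('r0 \<Rightarrow> 'r) \<Rightarrow> ('v \<Rightarrow> 'u) \<Rightarrow>
      ('s0, 'f0, 'r0, 'v) mstruct \<Rightarrow> ('s, 'f, 'r, 'u) mstruct \<Rightarrow> bool" where
  "reduct_via L0 \<sigma> F R e M0 M \<longleftrightarrow>
     (\<forall>s. sort_set M (\<sigma> s) = e ` sort_set M0 s) \<and>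
     (\<forall>s. \<forall>x\<in>sort_set M0 s. \<forall>y\<in>sort_set M0 s. metric M (\<sigma> s) (e x) (e y) = metric M0 s x y) \<and>
     (\<forall>f\<in>fsyms L0. \<forall>xs\<in>tuples M0 (fargs L0 f). fint M (F f) (map e xs) = e (fint M0 f xs)) \<and>
     (\<forall>r\<in>rsyms L0. \<forall>xs\<in>tuples M0 (rargs L0 r). rint M (R r) (map e xs) = rint M0 r xs)"

lemma has_sort_map:
  assumes "lang_morphism L0 L \<sigma> F R"
  shows "has_sort L0 t s \<Longrightarrow> has_sort L (map_trm \<sigma> F t) (\<sigma> s)"
proof (induction t arbitrary: s)
  case (Fun f ts)
  then show ?case
    using assms by (auto simp: lang_morphism_def list_all2_conv_all_nth)
qed simp

lemma wff_map:
  assumes "lang_morphism L0 L \<sigma> F R"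
  shows "wff L0 \<phi> \<Longrightarrow> wff L (map_fml \<sigma> F R \<phi>)"
proof (induction \<phi>)
  case (Pred r ts)
  then show ?case
    using assms has_sort_map[OF assms] by (auto simp: lang_morphism_def list_all2_conv_all_nth)
qed (use has_sort_map[OF assms] in auto)

text \<open>Interpretations correspond only on tuples from the right sorts. Closure of the sorts
  under the function symbols keeps the values of all well-sorted terms there.\<close>

locale reduct =
  fixes L0 :: "('s0, 'f0, 'r0) signat" and L :: "('s, 'f, 'r) signat"
    and \<sigma> :: "'s0 \<Rightarrow> 's" and F :: "'f0 \<Rightarrow> 'f" and R :: "'r0 \<Rightarrow> 'r" and e :: "'v \<Rightarrow> 'u"
    and M0 :: "('s0, 'f0, 'r0, 'v) mstruct" and M :: "('s, 'f, 'r, 'u) mstruct"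
  assumes morphism: "lang_morphism L0 L \<sigma> F R" and inj_e: "inj e"
    and red: "reduct_via L0 \<sigma> F R e M0 M"
    and closed: "\<And>f xs. f \<in> fsyms L \<Longrightarrow> xs \<in> tuples M (fargs L f) \<Longrightarrow> fint M f xs \<in> sort_set M (fres L f)"
begin

lemma inj_\<sigma>: "inj \<sigma>"
  using morphism by (simp add: lang_morphism_def)

lemma sort: "sort_set M (\<sigma> s) = e ` sort_set M0 s"
  using red by (simp add: reduct_via_def)

lemma e_in_sort [simp]: "e x \<in> sort_set M (\<sigma> s) \<longleftrightarrow> x \<in> sort_set M0 s"
  unfolding sort using inj_e by (simp add: inj_image_mem_iff)

lemma metric_e:
  "x \<in> sort_set M0 s \<Longrightarrow> y \<in> sort_set M0 s \<Longrightarrow> metric M (\<sigma> s) (e x) (e y) = metric M0 s x y"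
  using red unfolding reduct_via_def by blast

lemma fint_e: "f \<in> fsyms L0 \<Longrightarrow> xs \<in> tuples M0 (fargs L0 f) \<Longrightarrow> fint M (F f) (map e xs) = e (fint M0 f xs)"
  using red unfolding reduct_via_def by blast

lemma rint_e: "r \<in> rsyms L0 \<Longrightarrow> xs \<in> tuples M0 (rargs L0 r) \<Longrightarrow> rint M (R r) (map e xs) = rint M0 r xs"
  using red unfolding reduct_via_def by blast

lemma tuples_e: "map e xs \<in> tuples M (map \<sigma> ss) \<longleftrightarrow> xs \<in> tuples M0 ss"
  by (simp add: tuples_def list_all2_map1 list_all2_map2)

lemma tuples_close_e: "tuples_close M (map \<sigma> ss) \<delta> (map e xs) (map e ys) \<longleftrightarrow> tuples_close M0 ss \<delta> xs ys"
proof -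
  have "metric M (map \<sigma> ss ! i) (map e xs ! i) (map e ys ! i) = metric M0 (ss ! i) (xs ! i) (ys ! i)"
    if "xs \<in> tuples M0 ss" "ys \<in> tuples M0 ss" "i < length ss" for i
    using that by (auto simp: tuples_def list_all2_conv_all_nth metric_e)
  then show ?thesis
    unfolding tuples_close_def tuples_e by auto
qed

lemma syms:
  "f \<in> fsyms L0 \<Longrightarrow> F f \<in> fsyms L" "f \<in> fsyms L0 \<Longrightarrow> fargs L (F f) = map \<sigma> (fargs L0 f)"
  "f \<in> fsyms L0 \<Longrightarrow> fres L (F f) = \<sigma> (fres L0 f)"
  "r \<in> rsyms L0 \<Longrightarrow> R r \<in> rsyms L" "r \<in> rsyms L0 \<Longrightarrow> rargs L (R r) = map \<sigma> (rargs L0 r)"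
  using morphism by (auto simp: lang_morphism_def)

lemma closed0:
  assumes "f \<in> fsyms L0" "xs \<in> tuples M0 (fargs L0 f)"
  shows "fint M0 f xs \<in> sort_set M0 (fres L0 f)"
  using closed[OF syms(1)[OF assms(1)], of "map e xs"] assms syms(2,3)[OF assms(1)]
  by (simp add: tuples_e fint_e)

lemma tval_map:
  assumes a0: "assignment M0 a0" and a: "\<And>s n. a (\<sigma> s) n = e (a0 s n)"
  shows "has_sort L0 t s \<Longrightarrow> tval M a (map_trm \<sigma> F t) = e (tval M0 a0 t)"
proof (induction t arbitrary: s)
  case (Fun f ts)
  then have f: "f \<in> fsyms L0" and ts: "list_all2 (has_sort L0) ts (fargs L0 f)"
    by auto
  have "map (tval M a) (map (map_trm \<sigma> F) ts) = map e (map (tval M0 a0) ts)"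
    using Fun.IH ts by (fastforce simp: list_all2_conv_all_nth in_set_conv_nth)
  moreover have "map (tval M0 a0) ts \<in> tuples M0 (fargs L0 f)"
    unfolding tuples_map using ts tval_in_sort[of L0 M0, OF closed0 a0]
    by (auto elim: list_all2_mono)
  ultimately show ?case
    using f by (simp add: fint_e del: map_map)
qed (simp add: a)

lemma map_tval_map:
  assumes "assignment M0 a0" "\<And>s n. a (\<sigma> s) n = e (a0 s n)" "list_all2 (has_sort L0) ts ss"
  shows "map (tval M a) (map (map_trm \<sigma> F) ts) = map e (map (tval M0 a0) ts)"
    "map (tval M0 a0) ts \<in> tuples M0 ss"
proof -
  show "map (tval M a) (map (map_trm \<sigma> F) ts) = map e (map (tval M0 a0) ts)"
    using assms(3) tval_map[of a0 a, OF assms(1,2)]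
    by (fastforce simp: list_all2_conv_all_nth in_set_conv_nth)
  show "map (tval M0 a0) ts \<in> tuples M0 ss"
    unfolding tuples_map using assms(3) tval_in_sort[of L0 M0, OF closed0 assms(1)]
    by (auto elim: list_all2_mono)
qed

text \<open>Quantifiers are preserved because \<open>e\<close> maps each sort onto its renamed sort;
  injectivity of \<open>\<sigma>\<close> makes the two updated assignments correspond again.\<close>

lemma fval_map:
  "wff L0 \<phi> \<Longrightarrow> assignment M0 a0 \<Longrightarrow> (\<And>s n. a (\<sigma> s) n = e (a0 s n)) \<Longrightarrow>
    fval M a (map_fml \<sigma> F R \<phi>) = fval M0 a0 \<phi>"
proof (induction \<phi> arbitrary: a0 a)
  case (Dist s t u)
  have "tval M0 a0 t \<in> sort_set M0 s" "tval M0 a0 u \<in> sort_set M0 s"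
    using Dist.prems(1) tval_in_sort[of L0 M0, OF closed0 Dist.prems(2)] by auto
  then show ?case
    using Dist.prems(1) tval_map[of a0 a, OF Dist.prems(2,3), of _ s] by (simp add: metric_e)
next
  case (Pred r ts)
  then have r: "r \<in> rsyms L0" and ts: "list_all2 (has_sort L0) ts (rargs L0 r)"
    by auto
  show ?case
    using map_tval_map[of a0 a, OF Pred.prems(2,3) ts] rint_e[OF r] by (simp del: map_map)
next
  case (Conn u \<phi>s)
  have "map (fval M a) (map (map_fml \<sigma> F R) \<phi>s) = map (fval M0 a0) \<phi>s"
    using Conn by auto
  then show ?case
    by (simp add: Let_def del: map_map)
next
  case (SupQ s n \<phi>)
  have "fval M (a(\<sigma> s := (a (\<sigma> s))(n := e x))) (map_fml \<sigma> F R \<phi>) = fval M0 (a0(s := (a0 s)(n := x))) \<phi>"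
    if "x \<in> sort_set M0 s" for x
    using SupQ.prems that inj_\<sigma> by (intro SupQ.IH assignment_update) (auto dest: injD)
  then show ?case
    by (simp add: sort image_image cong: image_cong)
next
  case (InfQ s n \<phi>)
  have "fval M (a(\<sigma> s := (a (\<sigma> s))(n := e x))) (map_fml \<sigma> F R \<phi>) = fval M0 (a0(s := (a0 s)(n := x))) \<phi>"
    if "x \<in> sort_set M0 s" for x
    using InfQ.prems that inj_\<sigma> by (intro InfQ.IH assignment_update) (auto dest: injD)
  then show ?case
    by (simp add: sort image_image cong: image_cong)
qed

text \<open>The metric axioms are assumed rather than transported, since \<open>Metric_space\<close>
  demands symmetry and non-negativity on the whole type, while \<open>M\<close> determines the
  distances only within the sorts.\<close>

lemma continuous_structure_reduct:
  assumes M: "continuous_structure L M" and ms: "\<And>s. Metric_space (sort_set M0 s) (metric M0 s)"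
  shows "continuous_structure L0 M0"
  unfolding continuous_structure_def
proof (intro conjI allI ballI impI)
  fix s
  have Ms: "sort_set M (\<sigma> s) \<noteq> {}" "Metric_space (sort_set M (\<sigma> s)) (metric M (\<sigma> s))"
      "Metric_space.mcomplete (sort_set M (\<sigma> s)) (metric M (\<sigma> s))"
      "\<exists>b. \<forall>x \<in> sort_set M (\<sigma> s). \<forall>y \<in> sort_set M (\<sigma> s). metric M (\<sigma> s) x y \<le> b"
    using M by (auto simp: continuous_structure_def)
  show "sort_set M0 s \<noteq> {}"
    using Ms(1) by (simp add: sort)
  show "Metric_space (sort_set M0 s) (metric M0 s)"
    by (rule ms)
  have inv_eq: "inv_into UNIV e ` sort_set M (\<sigma> s) = sort_set M0 s"
    unfolding sort image_image using inj_e by simp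
  have "Metric_space.mcomplete (inv_into UNIV e ` sort_set M (\<sigma> s)) (metric M0 s)"
  proof (rule mcomplete_image[OF Ms(2) _ Ms(3)])
    show "Metric_space (inv_into UNIV e ` sort_set M (\<sigma> s)) (metric M0 s)"
      unfolding inv_eq by (rule ms)
    show "metric M0 s (inv_into UNIV e x) (inv_into UNIV e y) = metric M (\<sigma> s) x y"
      if "x \<in> sort_set M (\<sigma> s)" "y \<in> sort_set M (\<sigma> s)" for x y
      using that inj_e unfolding sort by (auto simp: metric_e)
  qed
  then show "Metric_space.mcomplete (sort_set M0 s) (metric M0 s)"
    unfolding inv_eq .
  show "\<exists>b. \<forall>x \<in> sort_set M0 s. \<forall>y \<in> sort_set M0 s. metric M0 s x y \<le> b"
    using Ms(4) unfolding sort by (auto simp: metric_e)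
next
  fix f xs assume "f \<in> fsyms L0" "xs \<in> tuples M0 (fargs L0 f)"
  then show "fint M0 f xs \<in> sort_set M0 (fres L0 f)"
    by (rule closed0)
next
  fix f and \<epsilon> :: real assume f: "f \<in> fsyms L0" and \<epsilon>: "0 < \<epsilon>"
  then obtain \<delta> where \<delta>: "\<delta> > 0" "\<And>xs ys. tuples_close M (fargs L (F f)) \<delta> xs ys \<Longrightarrow>
      metric M (fres L (F f)) (fint M (F f) xs) (fint M (F f) ys) < \<epsilon>"
    using M syms(1) unfolding continuous_structure_def by blast
  have "metric M0 (fres L0 f) (fint M0 f xs) (fint M0 f ys) < \<epsilon>"
    if xy: "tuples_close M0 (fargs L0 f) \<delta> xs ys" for xs ys
  proof -
    have "xs \<in> tuples M0 (fargs L0 f)" "ys \<in> tuples M0 (fargs L0 f)"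
      using xy by (auto simp: tuples_close_def)
    then show ?thesis
      using \<delta>(2)[of "map e xs" "map e ys"] xy f
      by (simp add: syms tuples_close_e fint_e metric_e closed0)
  qed
  then show "\<exists>\<delta>>0. \<forall>xs ys. tuples_close M0 (fargs L0 f) \<delta> xs ys \<longrightarrow>
      metric M0 (fres L0 f) (fint M0 f xs) (fint M0 f ys) < \<epsilon>"
    using \<delta>(1) by blast
next
  fix r assume r: "r \<in> rsyms L0"
  have "\<forall>r\<in>rsyms L. \<exists>b. \<forall>xs\<in>tuples M (rargs L r). \<bar>rint M r xs\<bar> \<le> b"
    using M by (simp add: continuous_structure_def)
  from bspec[OF this syms(4)[OF r]]
  obtain b where "\<And>xs. xs \<in> tuples M (rargs L (R r)) \<Longrightarrow> \<bar>rint M (R r) xs\<bar> \<le> b"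
    by blast
  then show "\<exists>b. \<forall>xs\<in>tuples M0 (rargs L0 r). \<bar>rint M0 r xs\<bar> \<le> b"
    using r by (metis rint_e syms(5) tuples_e)
next
  fix r and \<epsilon> :: real assume r: "r \<in> rsyms L0" and \<epsilon>: "0 < \<epsilon>"
  have "\<forall>r\<in>rsyms L. \<forall>\<epsilon>>0. \<exists>\<delta>>0. \<forall>xs ys. tuples_close M (rargs L r) \<delta> xs ys \<longrightarrow>
      \<bar>rint M r xs - rint M r ys\<bar> < \<epsilon>"
    using M by (simp add: continuous_structure_def)
  from bspec[OF this syms(4)[OF r], rule_format, OF \<epsilon>]
  obtain \<delta> where \<delta>: "\<delta> > 0" "\<And>xs ys. tuples_close M (rargs L (R r)) \<delta> xs ys \<Longrightarrow>
      \<bar>rint M (R r) xs - rint M (R r) ys\<bar> < \<epsilon>"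
    by blast
  have "\<bar>rint M0 r xs - rint M0 r ys\<bar> < \<epsilon>"
    if xy: "tuples_close M0 (rargs L0 r) \<delta> xs ys" for xs ys
  proof -
    have "xs \<in> tuples M0 (rargs L0 r)" "ys \<in> tuples M0 (rargs L0 r)"
      using xy by (auto simp: tuples_close_def)
    then show ?thesis
      using \<delta>(2)[of "map e xs" "map e ys"] xy r by (simp add: syms tuples_close_e rint_e)
  qed
  then show "\<exists>\<delta>>0. \<forall>xs ys. tuples_close M0 (rargs L0 r) \<delta> xs ys \<longrightarrow> \<bar>rint M0 r xs - rint M0 r ys\<bar> < \<epsilon>"
    using \<delta>(1) by blast
qed

end

lemma elementary_reduct:
  assumes N: "reduct L0 L \<sigma> F R e N0 N" and M: "reduct L0 L \<sigma> F R e M0 M"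
    and el: "elementary_substructure L N M" and sub: "substructure L0 N0 M0"
    and ms: "\<And>s. Metric_space (sort_set N0 s) (metric N0 s)"
  shows "elementary_substructure L0 N0 M0"
  unfolding elementary_substructure_def
proof (intro conjI allI impI)
  interpret N: reduct L0 L \<sigma> F R e N0 N by fact
  interpret M: reduct L0 L \<sigma> F R e M0 M by fact
  have cs: "continuous_structure L N"
    using el by (simp add: elementary_substructure_def)
  then show "continuous_structure L0 N0"
    using ms by (rule N.continuous_structure_reduct)
  show "substructure L0 N0 M0" by (rule sub)
  fix \<phi> and a0 :: "_ \<Rightarrow> nat \<Rightarrow> _"
  assume \<phi>: "wff L0 \<phi>" and "\<forall>s n. a0 s n \<in> sort_set N0 s"
  then have a0: "assignment N0 a0"
    by (simp add: assignment_def)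
  have a0': "assignment M0 a0"
    using a0 sub by (auto simp: assignment_def substructure_def)
  \<comment> \<open>Elementarity speaks of total assignments, so the sorts outside the smaller
    language receive arbitrary elements of \<open>N\<close>.\<close>
  define a where "a s n = (if s \<in> range \<sigma> then e (a0 (inv_into UNIV \<sigma> s) n) else SOME x. x \<in> sort_set N s)" for s n
  have a: "a (\<sigma> s) n = e (a0 s n)" for s n
    using N.inj_\<sigma> by (simp add: a_def)
  have "a s n \<in> sort_set N s" for s n
  proof (cases "s \<in> range \<sigma>")
    case True
    then show ?thesis using a a0 by (auto simp: assignment_def)
  next
    case False
    have "sort_set N s \<noteq> {}"
      using cs by (simp add: continuous_structure_def)
    then show ?thesis
      using False by (simp add: a_def some_in_eq)
  qed
  then have "fval N a (map_fml \<sigma> F R \<phi>) = fval M a (map_fml \<sigma> F R \<phi>)"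
    using el wff_map[OF N.morphism \<phi>] by (simp add: elementary_substructure_def)
  then show "fval N0 a0 \<phi> = fval M0 a0 \<phi>"
    using N.fval_map[OF \<phi> a0 a] M.fval_map[OF \<phi> a0' a] by simp
qed

section \<open>Transfer between a structure and an elementary substructure\<close>

text \<open>As in the Tarski-Vaught test, quantification over \<open>N\<close> of values computed in \<open>M\<close> agrees with
  quantification over \<open>M\<close>; hence a formula never has to be evaluated in \<open>N\<close>.\<close>

lemma elementary_quantifiers:
  assumes el: "elementary_substructure L N M" and \<psi>: "wff L \<psi>" and a: "assignment N a"
  shows "(INF x\<in>sort_set N s. fval M (a(s := (a s)(n := x))) \<psi>) =
      (INF x\<in>sort_set M s. fval M (a(s := (a s)(n := x))) \<psi>)"
    "(SUP x\<in>sort_set N s. fval M (a(s := (a s)(n := x))) \<psi>) =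
      (SUP x\<in>sort_set M s. fval M (a(s := (a s)(n := x))) \<psi>)"
proof -
  have eq: "fval N b \<phi> = fval M b \<phi>" if "wff L \<phi>" "assignment N b" for b \<phi>
    using el that by (simp add: elementary_substructure_def assignment_def)
  have inner: "fval N (a(s := (a s)(n := x))) \<psi> = fval M (a(s := (a s)(n := x))) \<psi>"
    if "x \<in> sort_set N s" for x
    using \<psi> a that by (intro eq assignment_update)
  show "(INF x\<in>sort_set N s. fval M (a(s := (a s)(n := x))) \<psi>) =
      (INF x\<in>sort_set M s. fval M (a(s := (a s)(n := x))) \<psi>)"
    using eq[of "InfQ s n \<psi>" a] \<psi> a inner by (simp cong: image_cong)
  show "(SUP x\<in>sort_set N s. fval M (a(s := (a s)(n := x))) \<psi>) =
      (SUP x\<in>sort_set M s. fval M (a(s := (a s)(n := x))) \<psi>)"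
    using eq[of "SupQ s n \<psi>" a] \<psi> a inner by (simp cong: image_cong)
qed

text \<open>Approximate existence passes down: the infimum over the sort of \<open>M\<close> is 0,
  it agrees with the infimum over the sort of \<open>N\<close>, and this yields a witness in
  \<open>N\<close> for every tolerance.\<close>

lemma elementary_inf_zero:
  assumes el: "elementary_substructure L N M" and \<psi>: "wff L \<psi>" and a: "assignment N a"
    and nonneg: "\<And>x. x \<in> sort_set M s \<Longrightarrow> 0 \<le> fval M (a(s := (a s)(n := x))) \<psi>"
    and ex: "\<And>\<eta>. \<eta> > 0 \<Longrightarrow> \<exists>x\<in>sort_set M s. fval M (a(s := (a s)(n := x))) \<psi> < \<eta>"
    and \<eta>: "\<eta> > 0"
  obtains x where "x \<in> sort_set N s" "fval M (a(s := (a s)(n := x))) \<psi> < \<eta>"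
proof -
  have sub: "sort_set N s \<subseteq> sort_set M s" and ne: "sort_set N s \<noteq> {}"
    using el by (auto simp: elementary_substructure_def substructure_def continuous_structure_def)
  have "(INF x\<in>sort_set M s. fval M (a(s := (a s)(n := x))) \<psi>) = 0"
    using sub ne nonneg ex by (subst INF_eq_0_iff) auto
  then have "(INF x\<in>sort_set N s. fval M (a(s := (a s)(n := x))) \<psi>) = 0"
    by (simp add: elementary_quantifiers(1)[OF el \<psi> a])
  then have "\<exists>x\<in>sort_set N s. fval M (a(s := (a s)(n := x))) \<psi> < \<eta>"
    using sub ne nonneg \<eta> by (subst (asm) INF_eq_0_iff) auto
  then show ?thesis using that by blast
qed

text \<open>A universal equation passes up from \<open>N\<close> to \<open>M\<close>. The bound
  \<open>b\<close> makes the supremum over \<open>M\<close> an upper bound of the values.\<close>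

lemma elementary_sup_zero:
  assumes el: "elementary_substructure L N M" and \<psi>: "wff L \<psi>" and a: "assignment N a"
    and nonneg: "\<And>x. x \<in> sort_set M s \<Longrightarrow> 0 \<le> fval M (a(s := (a s)(n := x))) \<psi>"
    and bdd: "\<And>x. x \<in> sort_set M s \<Longrightarrow> fval M (a(s := (a s)(n := x))) \<psi> \<le> b"
    and zero: "\<And>x. x \<in> sort_set N s \<Longrightarrow> fval M (a(s := (a s)(n := x))) \<psi> = 0"
    and x: "x \<in> sort_set M s"
  shows "fval M (a(s := (a s)(n := x))) \<psi> = 0"
proof -
  have ne: "sort_set N s \<noteq> {}"
    using el by (simp add: elementary_substructure_def continuous_structure_def)
  then have "(SUP x\<in>sort_set N s. fval M (a(s := (a s)(n := x))) \<psi>) = 0"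
    using zero by (simp cong: image_cong)
  then have "(SUP x\<in>sort_set M s. fval M (a(s := (a s)(n := x))) \<psi>) = 0"
    by (simp add: elementary_quantifiers(2)[OF el \<psi> a])
  moreover have "sort_set M s \<noteq> {}"
    using x by blast
  ultimately show ?thesis
    using SUP_eq_0_iff[of "sort_set M s" "\<lambda>x. fval M (a(s := (a s)(n := x))) \<psi>" b] nonneg bdd x
    by blast
qed

text \<open>Merges the requirement that one value be 1 with finitely many requirements that values
  be 0, because transfer applies to one formula under one infimum.\<close>

definition defect_conn :: "nat \<Rightarrow> (nat \<Rightarrow> real) \<Rightarrow> real" where
  "defect_conn k w = \<bar>1 - w 0\<bar> + (\<Sum>j<k. \<bar>w (Suc j)\<bar>)"

lemma continuous_defect_conn: "continuous_on UNIV (defect_conn k)"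
  unfolding defect_conn_def by (intro continuous_intros continuous_on_product_coordinates)

lemma fval_defect_conn:
  "fval M a (Conn (defect_conn (length \<phi>s)) (\<phi> # \<phi>s)) =
    \<bar>1 - fval M a \<phi>\<bar> + (\<Sum>j<length \<phi>s. \<bar>fval M a (\<phi>s ! j)\<bar>)"
  by (simp add: defect_conn_def Let_def)

lemma elementary_approx:
  assumes el: "elementary_substructure L N M"
    and wff: "wff L \<phi>" "\<And>\<psi>. \<psi> \<in> set \<phi>s \<Longrightarrow> wff L \<psi>" and a: "assignment N a"
    and ex: "\<And>\<eta>. \<eta> > 0 \<Longrightarrow> \<exists>x\<in>sort_set M s. fval M (a(s := (a s)(n := x))) \<phi> = 1 \<and>
      (\<forall>\<psi>\<in>set \<phi>s. \<bar>fval M (a(s := (a s)(n := x))) \<psi>\<bar> < \<eta>)"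
    and \<eta>: "\<eta> > 0"
  obtains x where "x \<in> sort_set N s" "\<bar>1 - fval M (a(s := (a s)(n := x))) \<phi>\<bar> < \<eta>"
    "\<And>\<psi>. \<psi> \<in> set \<phi>s \<Longrightarrow> \<bar>fval M (a(s := (a s)(n := x))) \<psi>\<bar> < \<eta>"
proof -
  let ?k = "length \<phi>s"
  let ?\<psi> = "Conn (defect_conn ?k) (\<phi> # \<phi>s)"
  obtain x where x: "x \<in> sort_set N s" "fval M (a(s := (a s)(n := x))) ?\<psi> < \<eta>"
  proof (rule elementary_inf_zero[where s = s and n = n, OF el _ a _ _ \<eta>])
    show "wff L ?\<psi>"
      using wff by (simp add: continuous_defect_conn)
    show "0 \<le> fval M (a(s := (a s)(n := x))) ?\<psi>" for x
      unfolding fval_defect_conn by (intro add_nonneg_nonneg sum_nonneg) auto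
    fix \<eta> :: real assume \<eta>: "\<eta> > 0"
    \<comment> \<open>With k formulas a tolerance of \<open>\<eta> / (k + 1)\<close> makes the sum
      less than \<open>\<eta>\<close>, and it is meaningful for k = 0.\<close>
    then obtain x where x: "x \<in> sort_set M s" "fval M (a(s := (a s)(n := x))) \<phi> = 1"
      "\<forall>\<psi>\<in>set \<phi>s. \<bar>fval M (a(s := (a s)(n := x))) \<psi>\<bar> < \<eta> / real (Suc ?k)"
      using ex[of "\<eta> / real (Suc ?k)"] by auto
    have "(\<Sum>j<?k. \<bar>fval M (a(s := (a s)(n := x))) (\<phi>s ! j)\<bar>) \<le> of_nat (card {..<?k}) * (\<eta> / real (Suc ?k))"
      using x(3) by (intro sum_bounded_above) (simp add: less_imp_le)
    also have "\<dots> < \<eta>"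
      using \<eta> by (simp add: field_simps)
    finally show "\<exists>x\<in>sort_set M s. fval M (a(s := (a s)(n := x))) ?\<psi> < \<eta>"
      unfolding fval_defect_conn using x(1,2) by (intro bexI[of _ x]) auto
  qed
  let ?a = "a(s := (a s)(n := x))"
  have nn: "0 \<le> (\<Sum>j<?k. \<bar>fval M ?a (\<phi>s ! j)\<bar>)"
    by (intro sum_nonneg) auto
  show ?thesis
  proof (rule that[OF x(1)])
    show "\<bar>1 - fval M ?a \<phi>\<bar> < \<eta>"
      using x(2) nn unfolding fval_defect_conn by linarith
    fix \<psi> assume "\<psi> \<in> set \<phi>s"
    then obtain j where j: "j < ?k" "\<psi> = \<phi>s ! j"
      by (auto simp: in_set_conv_nth)
    have "\<bar>fval M ?a (\<phi>s ! j)\<bar> \<le> (\<Sum>j<?k. \<bar>fval M ?a (\<phi>s ! j)\<bar>)"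
      using j(1) by (intro member_le_sum) auto
    then show "\<bar>fval M ?a \<psi>\<bar> < \<eta>"
      using x(2) unfolding fval_defect_conn j(2) by linarith
  qed
qed


section \<open>Elementary substructures of action structures\<close>

lemma action_lang_simps [simp]:
  "GSym f \<in> fsyms action_lang" "HSym h \<in> fsyms action_lang \<longleftrightarrow> h \<in> fsyms hilbert_lang"
  "Act m \<in> fsyms action_lang" "rsyms action_lang = UNIV"
  "fargs action_lang = asym_args" "fres action_lang = asym_res"
  "rargs action_lang r = map BSort (hpred_args r)"
  by (auto simp: action_lang_def group_lang_def hilbert_lang_def)

lemma group_lang_simps [simp]:
  "f \<in> fsyms group_lang" "rsyms group_lang = {}" "fres group_lang f = ()"
  "fargs group_lang GMul = [(), ()]" "fargs group_lang GInv = [()]" "fargs group_lang GOne = []"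
  by (simp_all add: group_lang_def)

lemma hilbert_lang_simps [simp]:
  "HZero \<in> fsyms hilbert_lang" "HIncl m n \<in> fsyms hilbert_lang \<longleftrightarrow> m < n"
  "HScale m c \<in> fsyms hilbert_lang" "HAdd m \<in> fsyms hilbert_lang" "HSub m \<in> fsyms hilbert_lang"
  "rsyms hilbert_lang = UNIV" "fargs hilbert_lang = hsym_args" "fres hilbert_lang = hsym_res"
  "rargs hilbert_lang = hpred_args"
  by (auto simp: hilbert_lang_def)

lemma lang_morphism_group: "lang_morphism group_lang action_lang (\<lambda>_. GSort) GSym R"
  by (simp add: lang_morphism_def inj_def)

lemma lang_morphism_hilbert: "lang_morphism hilbert_lang action_lang BSort HSym id"
  by (simp add: lang_morphism_def inj_def)

lemma reduct_via_group:
  "reduct_via group_lang (\<lambda>_. GSort) GSym R Inl (group_structure G d) (action_structure G d H \<pi>)"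
  by (simp add: reduct_via_def comp_def)

lemma reduct_via_hilbert:
  "reduct_via hilbert_lang BSort HSym id Inr (hilbert_structure H) (action_structure G d H \<pi>)"
  by (simp add: reduct_via_def comp_def)

lemma same_structureI:
  assumes "\<And>s. sort_set N s = sort_set A s"
    and "\<And>s x y. x \<in> sort_set N s \<Longrightarrow> y \<in> sort_set N s \<Longrightarrow> metric N s x y = metric A s x y"
    and "\<And>f xs. f \<in> fsyms L \<Longrightarrow> xs \<in> tuples N (fargs L f) \<Longrightarrow> fint N f xs = fint A f xs"
    and "\<And>r xs. r \<in> rsyms L \<Longrightarrow> xs \<in> tuples N (rargs L r) \<Longrightarrow> rint N r xs = rint A r xs"
  shows "same_structure L N A"
proof -
  have "tuples A = tuples N"
    using assms(1) by (simp add: tuples_def fun_eq_iff)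
  then show ?thesis
    using assms by (simp add: same_structure_def substructure_def)
qed

text \<open>\<open>N\<close> equals an action structure only up to the meaningless values of its
  interpretations; being a reduct looks at the meaningful ones and so carries over.\<close>

lemma reduct_via_same_structure:
  assumes mor: "lang_morphism L0 L \<sigma> F R" and red: "reduct_via L0 \<sigma> F R e M0 A" and same: "same_structure L N A"
  shows "reduct_via L0 \<sigma> F R e M0 N"
proof -
  have sort: "sort_set N s = sort_set A s" for s
    using same by (auto simp: same_structure_def substructure_def)
  have tup: "map e xs \<in> tuples N (map \<sigma> ss)" if "xs \<in> tuples M0 ss" for xs ss
    using that red by (auto simp: reduct_via_def tuples_def sort list_all2_map1 list_all2_map2 elim: list_all2_mono)
  show ?thesis
    unfolding reduct_via_def
  proof (intro conjI allI ballI)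
    show "sort_set N (\<sigma> s) = e ` sort_set M0 s" for s
      using red sort by (simp add: reduct_via_def)
    show "metric N (\<sigma> s) (e x) (e y) = metric M0 s x y" if "x \<in> sort_set M0 s" "y \<in> sort_set M0 s" for s x y
    proof -
      have "e x \<in> sort_set N (\<sigma> s)" "e y \<in> sort_set N (\<sigma> s)"
        using that red sort by (auto simp: reduct_via_def)
      then have "metric N (\<sigma> s) (e x) (e y) = metric A (\<sigma> s) (e x) (e y)"
        using same by (simp add: same_structure_def substructure_def)
      then show ?thesis
        using red that by (simp add: reduct_via_def)
    qed
    show "fint N (F f) (map e xs) = e (fint M0 f xs)" if "f \<in> fsyms L0" "xs \<in> tuples M0 (fargs L0 f)" for f xs
      using that red same mor tup[OF that(2)] by (simp add: reduct_via_def same_structure_def substructure_def lang_morphism_def)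
    show "rint N (R r) (map e xs) = rint M0 r xs" if "r \<in> rsyms L0" "xs \<in> tuples M0 (rargs L0 r)" for r xs
      using that red same mor tup[OF that(2)] by (simp add: reduct_via_def same_structure_def substructure_def lang_morphism_def)
  qed
qed

lemma tuples_simps:
  "xs \<in> tuples M [] \<longleftrightarrow> xs = []"
  "xs \<in> tuples M (s # ss) \<longleftrightarrow> (\<exists>y ys. xs = y # ys \<and> y \<in> sort_set M s \<and> ys \<in> tuples M ss)"
  by (auto simp: tuples_def list_all2_Cons2)

lemma (in pre_hilbert_space) scale_hball:
  assumes "v \<in> hball H m"
  shows "c \<odot>\<^bsub>H\<^esub> v \<in> hball H ((nat \<lfloor>cmod c\<rfloor> + 1) * m)"
proof -
  have v: "v \<in> carrier H" "hnorm H v \<le> real m"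
    using assms by (auto simp: hball_def)
  have "cmod c \<le> real (nat \<lfloor>cmod c\<rfloor> + 1)"
    using norm_ge_zero[of c] by linarith
  then have "cmod c * hnorm H v \<le> real (nat \<lfloor>cmod c\<rfloor> + 1) * real m"
    using v by (intro mult_mono) auto
  then show ?thesis
    using v by (simp add: hball_def algebra_simps)
qed

lemma action_structure_closed:
  assumes "metric_group G d" "unitary_rep H G \<pi>"
    and f: "f \<in> fsyms action_lang" and xs: "xs \<in> tuples (action_structure G d H \<pi>) (fargs action_lang f)"
  shows "fint (action_structure G d H \<pi>) f xs \<in> sort_set (action_structure G d H \<pi>) (fres action_lang f)"
proof -
  interpret G: metric_group G d by fact
  interpret unitary_rep H G \<pi> by fact
  show ?thesis
  proof (cases f)
    case (GSym g)
    then show ?thesis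
      using xs by (cases g) (auto simp: tuples_simps)
  next
    case (HSym h)
    have sum: "v \<oplus>\<^bsub>H\<^esub> w \<in> hball H (2 * m)" "v \<ominus>\<^bsub>H\<^esub> w \<in> hball H (2 * m)"
      if "v \<in> hball H m" "w \<in> hball H m" for v w m
      using that norm_triangle[of v w] norm_minus_le[of v w] by (auto simp: hball_def)
    show ?thesis
    proof (cases h)
      case (HIncl m n)
      then have "m < n"
        using f HSym by simp
      then show ?thesis
        using xs HSym HIncl by (auto simp: tuples_simps hball_def)
    next
      case (HScale m c)
      then show ?thesis
        using xs HSym scale_hball by (auto simp: tuples_simps)
    qed (use xs HSym sum in \<open>auto simp: tuples_simps\<close>)
  next
    case (Act m)
    then show ?thesis
      using xs by (auto simp: tuples_simps)
  qed
qed

section \<open>The group and the Hilbert space carried by an elementary substructure\<close>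

locale elementary_action = G: metric_group G d + unitary_rep H G \<pi>
  for G :: "'g monoid" and d :: "'g \<Rightarrow> 'g \<Rightarrow> real" and H :: "'h inner_module" and \<pi> +
  fixes N :: "(asort, asym, hpred, 'g + 'h) mstruct"
  assumes el: "elementary_substructure action_lang N (action_structure G d H \<pi>)"
    and hilbert: "hilbert_space H"
begin

abbreviation A :: "(asort, asym, hpred, 'g + 'h) mstruct" where
  "A \<equiv> action_structure G d H \<pi>"

definition NG :: "'g set" where "NG = projl ` sort_set N GSort"

definition NB :: "nat \<Rightarrow> 'h set" where "NB n = projr ` sort_set N (BSort n)"

definition G0 :: "'g monoid" where "G0 = G\<lparr>carrier := NG\<rparr>"

definition H0 :: "'h inner_module" where "H0 = H\<lparr>carrier := \<Union>n. NB n\<rparr>"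

lemma G0_simps [simp]:
  "carrier G0 = NG" "x \<otimes>\<^bsub>G0\<^esub> y = x \<otimes>\<^bsub>G\<^esub> y" "\<one>\<^bsub>G0\<^esub> = \<one>\<^bsub>G\<^esub>"
  by (simp_all add: G0_def)

lemma H0_simps [simp]:
  "carrier H0 = (\<Union>n. NB n)" "v \<oplus>\<^bsub>H0\<^esub> w = v \<oplus>\<^bsub>H\<^esub> w" "\<zero>\<^bsub>H0\<^esub> = \<zero>\<^bsub>H\<^esub>" "c \<odot>\<^bsub>H0\<^esub> v = c \<odot>\<^bsub>H\<^esub> v"
  "inprod H0 = inprod H" "hnorm H0 = hnorm H"
  by (simp_all add: H0_def hnorm_def fun_eq_iff)

lemma sub: "substructure action_lang N A"
  using el by (simp add: elementary_substructure_def)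

lemma cont: "continuous_structure action_lang N"
  using el by (simp add: elementary_substructure_def)

lemma sort_subset: "sort_set N s \<subseteq> sort_set A s"
  using sub by (simp add: substructure_def)

lemma sort_G: "sort_set N GSort = Inl ` NG"
  using sort_subset[of GSort] unfolding NG_def by (force simp: image_image)

lemma sort_B: "sort_set N (BSort n) = Inr ` NB n"
  using sort_subset[of "BSort n"] unfolding NB_def by (force simp: image_image)

lemma NG_subset: "NG \<subseteq> carrier G"
  using sort_subset[of GSort] unfolding sort_G by auto

lemma NB_subset: "NB n \<subseteq> hball H n"
  using sort_subset[of "BSort n"] unfolding sort_B by auto

lemma closed: "f \<in> fsyms action_lang \<Longrightarrow> xs \<in> tuples N (fargs action_lang f) \<Longrightarrow>
    fint A f xs \<in> sort_set N (fres action_lang f)"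
  using cont sub unfolding continuous_structure_def substructure_def by metis

lemma NG_closed:
  "x \<in> NG \<Longrightarrow> y \<in> NG \<Longrightarrow> x \<otimes>\<^bsub>G\<^esub> y \<in> NG" "x \<in> NG \<Longrightarrow> inv\<^bsub>G\<^esub> x \<in> NG" "\<one>\<^bsub>G\<^esub> \<in> NG"
  using closed[of "GSym GMul" "[Inl x, Inl y]"] closed[of "GSym GInv" "[Inl x]"] closed[of "GSym GOne" "[]"]
  by (auto simp: tuples_simps sort_G)

lemma NB_closed:
  "\<zero>\<^bsub>H\<^esub> \<in> NB 0" "m < n \<Longrightarrow> v \<in> NB m \<Longrightarrow> v \<in> NB n"
  "v \<in> NB m \<Longrightarrow> c \<odot>\<^bsub>H\<^esub> v \<in> NB ((nat \<lfloor>cmod c\<rfloor> + 1) * m)"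
  "v \<in> NB m \<Longrightarrow> w \<in> NB m \<Longrightarrow> v \<oplus>\<^bsub>H\<^esub> w \<in> NB (2 * m)"
  "g \<in> NG \<Longrightarrow> v \<in> NB m \<Longrightarrow> \<pi> g v \<in> NB m"
proof -
  show "\<zero>\<^bsub>H\<^esub> \<in> NB 0"
    using closed[of "HSym HZero" "[]"] by (auto simp: tuples_simps sort_B)
  show "v \<in> NB n" if "m < n" "v \<in> NB m"
    using closed[of "HSym (HIncl m n)" "[Inr v]"] that by (auto simp: tuples_simps sort_B)
  show "c \<odot>\<^bsub>H\<^esub> v \<in> NB ((nat \<lfloor>cmod c\<rfloor> + 1) * m)" if "v \<in> NB m"
    using closed[of "HSym (HScale m c)" "[Inr v]"] that by (auto simp: tuples_simps sort_B)
  show "v \<oplus>\<^bsub>H\<^esub> w \<in> NB (2 * m)" if "v \<in> NB m" "w \<in> NB m"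
    using closed[of "HSym (HAdd m)" "[Inr v, Inr w]"] that by (auto simp: tuples_simps sort_B)
  show "\<pi> g v \<in> NB m" if "g \<in> NG" "v \<in> NB m"
    using closed[of "Act m" "[Inl g, Inr v]"] that by (auto simp: tuples_simps sort_B sort_G)
qed

lemma NB_mono: "m \<le> n \<Longrightarrow> NB m \<subseteq> NB n"
  using NB_closed(2)[of m n] by (cases "m = n") auto

lemma zero_NB: "\<zero>\<^bsub>H\<^esub> \<in> NB n"
  using NB_mono[of 0 n] NB_closed(1) by auto

lemma NB_common:
  assumes "v \<in> carrier H0" "w \<in> carrier H0"
  obtains n where "v \<in> NB n" "w \<in> NB n"
proof -
  obtain k l where "v \<in> NB k" "w \<in> NB l"
    using assms by auto
  then show ?thesis
    using that[of "max k l"] NB_mono[of k "max k l"] NB_mono[of l "max k l"] by auto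
qed

lemma carrier_H0_subset: "carrier H0 \<subseteq> carrier H"
  using NB_subset hball_subset by auto

lemma H0_closed:
  "\<zero>\<^bsub>H\<^esub> \<in> carrier H0" "v \<in> carrier H0 \<Longrightarrow> w \<in> carrier H0 \<Longrightarrow> v \<oplus>\<^bsub>H\<^esub> w \<in> carrier H0"
  "v \<in> carrier H0 \<Longrightarrow> c \<odot>\<^bsub>H\<^esub> v \<in> carrier H0" "g \<in> NG \<Longrightarrow> v \<in> carrier H0 \<Longrightarrow> \<pi> g v \<in> carrier H0"
proof -
  show "v \<oplus>\<^bsub>H\<^esub> w \<in> carrier H0" if "v \<in> carrier H0" "w \<in> carrier H0"
  proof -
    obtain n where "v \<in> NB n" "w \<in> NB n"
      using NB_common \<open>v \<in> carrier H0\<close> \<open>w \<in> carrier H0\<close> by blast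
    then have "v \<oplus>\<^bsub>H\<^esub> w \<in> NB (2 * n)"
      by (rule NB_closed(4))
    then show ?thesis by auto
  qed
  show "c \<odot>\<^bsub>H\<^esub> v \<in> carrier H0" if "v \<in> carrier H0"
    using that NB_closed(3)[of v _ c] by auto
qed (use NB_closed(1,5) in auto)

lemma pre_hilbert_H0: "pre_hilbert_space H0"
proof (rule pre_hilbert_spaceI)
  have H: "v \<in> carrier H" if "v \<in> carrier H0" for v
    using that carrier_H0_subset by blast
  show "pre_hilbert_space_axioms H0"
  proof
    show "inprod H0 v w = cnj (inprod H0 w v)" if "v \<in> carrier H0" "w \<in> carrier H0" for v w
      unfolding H0_simps(5) by (rule inprod_commute[OF H[OF that(1)] H[OF that(2)]])
    show "inprod H0 (u \<oplus>\<^bsub>H0\<^esub> v) w = inprod H0 u w + inprod H0 v w"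
      if "u \<in> carrier H0" "v \<in> carrier H0" "w \<in> carrier H0" for u v w
      unfolding H0_simps(2,5) by (rule inprod_add_left[OF H[OF that(1)] H[OF that(2)] H[OF that(3)]])
    show "inprod H0 (c \<odot>\<^bsub>H0\<^esub> v) w = c * inprod H0 v w" if "v \<in> carrier H0" "w \<in> carrier H0" for c v w
      unfolding H0_simps(4,5) by (rule inprod_scale_left[OF H[OF that(1)] H[OF that(2)]])
    show "0 \<le> Re (inprod H0 v v)" if "v \<in> carrier H0" for v
      unfolding H0_simps(5) by (rule inprod_nonneg[OF H[OF that]])
    show "v = \<zero>\<^bsub>H0\<^esub>" if "v \<in> carrier H0" "inprod H0 v v = 0" for v
      using inprod_definite[OF H[OF that(1)]] that(2) by simp
  qed
  fix a b u v w
  assume v: "v \<in> carrier H0"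
  note v' = H[OF v]
  show "\<zero>\<^bsub>H0\<^esub> \<oplus>\<^bsub>H0\<^esub> v = v" "(-1) \<odot>\<^bsub>H0\<^esub> v \<oplus>\<^bsub>H0\<^esub> v = \<zero>\<^bsub>H0\<^esub>"
    "(a + b) \<odot>\<^bsub>H0\<^esub> v = a \<odot>\<^bsub>H0\<^esub> v \<oplus>\<^bsub>H0\<^esub> b \<odot>\<^bsub>H0\<^esub> v"
    "(a * b) \<odot>\<^bsub>H0\<^esub> v = a \<odot>\<^bsub>H0\<^esub> (b \<odot>\<^bsub>H0\<^esub> v)" "1 \<odot>\<^bsub>H0\<^esub> v = v"
    using v' by (simp_all add: M.l_neg scale_add_left scale_scale flip: uminus_eq_scale)
  show "a \<odot>\<^bsub>H0\<^esub> v \<in> carrier H0"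
    using H0_closed(3)[OF v] by simp
  assume w: "w \<in> carrier H0"
  note w' = H[OF w]
  show "v \<oplus>\<^bsub>H0\<^esub> w \<in> carrier H0"
    using H0_closed(2)[OF v w] by simp
  show "v \<oplus>\<^bsub>H0\<^esub> w = w \<oplus>\<^bsub>H0\<^esub> v" "a \<odot>\<^bsub>H0\<^esub> (v \<oplus>\<^bsub>H0\<^esub> w) = a \<odot>\<^bsub>H0\<^esub> v \<oplus>\<^bsub>H0\<^esub> a \<odot>\<^bsub>H0\<^esub> w"
    using v' w' by (simp_all add: M.a_comm scale_add_right)
  assume u: "u \<in> carrier H0"
  show "u \<oplus>\<^bsub>H0\<^esub> v \<oplus>\<^bsub>H0\<^esub> w = u \<oplus>\<^bsub>H0\<^esub> (v \<oplus>\<^bsub>H0\<^esub> w)"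
    using H[OF u] v' w' by (simp add: M.a_assoc)
qed (use H0_closed(1) in simp)

sublocale H0: pre_hilbert_space H0
  by (rule pre_hilbert_H0)

text \<open>Subtraction is defined through inverses in the carrier, so agreement is not immediate
  after shrinking it; in both spaces it is addition of the multiple by -1.\<close>

lemma minus_H0:
  assumes "v \<in> carrier H0" "w \<in> carrier H0"
  shows "v \<ominus>\<^bsub>H0\<^esub> w = v \<ominus>\<^bsub>H\<^esub> w"
proof -
  have "v \<in> carrier H" "w \<in> carrier H"
    using assms carrier_H0_subset by auto
  then show ?thesis
    using H0.minus_eq_scale[OF assms] by (simp add: minus_eq_scale)
qed

lemma hdist_H0:
  assumes "v \<in> carrier H0" "w \<in> carrier H0"
  shows "hdist H0 v w = hdist H v w"
proof -
  have "v \<in> carrier H" "w \<in> carrier H"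
    using assms carrier_H0_subset by auto
  then show ?thesis
    using assms minus_H0[OF assms] by (simp add: hdist_def del: H0_simps(1))
qed

lemma subgroup_NG: "subgroup NG G"
  using NG_subset NG_closed by (intro G.subgroupI) auto

lemma metric_N:
  "g \<in> NG \<Longrightarrow> h \<in> NG \<Longrightarrow> metric N GSort (Inl g) (Inl h) = d g h"
  "v \<in> NB n \<Longrightarrow> w \<in> NB n \<Longrightarrow> metric N (BSort n) (Inr v) (Inr w) = hdist H v w"
  using sub unfolding substructure_def by (auto simp: sort_G sort_B)

lemma Metric_space_NG: "Metric_space NG d"
  using G.subspace[OF NG_subset] .

lemma Metric_space_NB: "Metric_space (NB n) (hdist H)"
  using Metric_space.subspace[OF Metric_space_hball NB_subset] .

lemma mcomplete_NG: "Metric_space.mcomplete NG d"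
proof -
  have N: "Metric_space (sort_set N GSort) (metric N GSort)"
    "Metric_space.mcomplete (sort_set N GSort) (metric N GSort)"
    using cont by (simp_all add: continuous_structure_def)
  have "Metric_space.mcomplete (projl ` sort_set N GSort) d"
    by (rule mcomplete_image[OF N(1) _ N(2)])
      (use Metric_space_NG in \<open>auto simp: sort_G image_image metric_N\<close>)
  then show ?thesis
    by (simp add: NG_def)
qed

lemma mcomplete_NB: "Metric_space.mcomplete (NB n) (hdist H)"
proof -
  have N: "Metric_space (sort_set N (BSort n)) (metric N (BSort n))"
    "Metric_space.mcomplete (sort_set N (BSort n)) (metric N (BSort n))"
    using cont by (simp_all add: continuous_structure_def)
  have "Metric_space.mcomplete (projr ` sort_set N (BSort n)) (hdist H)"
    by (rule mcomplete_image[OF N(1) _ N(2)])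
      (use Metric_space_NB in \<open>auto simp: sort_B image_image metric_N\<close>)
  then show ?thesis
    by (simp add: NB_def)
qed

lemma metric_group_G0: "metric_group G0 d"
proof -
  have "group G0"
    unfolding G0_def by (rule subgroup.subgroup_is_group[OF subgroup_NG G.group_axioms])
  moreover have "Metric_space (carrier G0) d"
    using Metric_space_NG by simp
  moreover have "metric_group_axioms G0 d"
    using mcomplete_NG NG_subset
    by unfold_locales (auto simp: subset_iff G.left_invariant G.right_invariant G.diameter_le_1)
  ultimately show ?thesis
    by (rule metric_group.intro)
qed

text \<open>A default assignment with values in \<open>N\<close>; the parameters of a formula are
  written over it.\<close>

definition base :: "asort \<Rightarrow> nat \<Rightarrow> 'g + 'h" where
  "base s n = (case s of GSort \<Rightarrow> Inl \<one>\<^bsub>G\<^esub> | BSort m \<Rightarrow> Inr \<zero>\<^bsub>H\<^esub>)"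

lemma base_simps [simp]: "base GSort n = Inl \<one>\<^bsub>G\<^esub>" "base (BSort m) n = Inr \<zero>\<^bsub>H\<^esub>"
  by (simp_all add: base_def)

lemma assignment_base: "assignment N base"
  unfolding assignment_def
proof (intro allI)
  show "base s n \<in> sort_set N s" for s n
    using NG_closed(3) zero_NB by (cases s) (auto simp: sort_G sort_B)
qed

text \<open>In \<open>A\<close> the distance from \<open>v\<close> to the ball of radius \<open>n\<close> is 0, hence also in \<open>N\<close>, whose sorts are
  complete.\<close>

lemma mem_NB_of_norm_le:
  assumes "n < m" and v: "v \<in> NB m" "hnorm H v \<le> real n"
  shows "v \<in> NB n"
proof -
  define a where "a = base(BSort m := (base (BSort m))(0 := Inr v))"
  let ?\<psi> = "Dist (BSort m) (Fun (HSym (HIncl n m)) [Var (BSort n) 0]) (Var (BSort m) 0)"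
  let ?a = "\<lambda>x. a(BSort n := (a (BSort n))(0 := x))"
  have vH: "v \<in> carrier H"
    using v(1) NB_subset hball_subset by blast
  have a: "assignment N a"
    unfolding a_def using v(1) by (intro assignment_update assignment_base) (simp add: sort_B)
  have fv: "fval A (?a x) ?\<psi> = hdist H (projr x) v" for x
    using assms(1) by (simp add: a_def)
  have "\<exists>y\<in>NB n. hdist H y v < \<eta>" if \<eta>: "\<eta> > 0" for \<eta>
  proof -
    obtain x where "x \<in> sort_set N (BSort n)" "fval A (?a x) ?\<psi> < \<eta>"
    proof (rule elementary_inf_zero[OF el _ a, of ?\<psi> "BSort n" 0])
      show "wff action_lang ?\<psi>"
        using assms(1) by simp
      show "0 \<le> fval A (?a x) ?\<psi>" for x
        unfolding fv by (rule Metric_space.nonneg[OF Metric_space_hdist])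
      show "\<exists>x\<in>sort_set A (BSort n). fval A (?a x) ?\<psi> < \<eta>" if "\<eta> > 0" for \<eta>
      proof
        show "Inr v \<in> sort_set A (BSort n)"
          using v vH by (simp add: hball_def)
        show "fval A (?a (Inr v)) ?\<psi> < \<eta>"
          unfolding fv using that vH Metric_space.mdist_zero[OF Metric_space_hdist] by simp
      qed
    qed (use \<eta> in auto)
    then show ?thesis
      unfolding fv by (auto simp: sort_B)
  qed
  then have "\<exists>y\<in>NB n. hdist H y v < inverse (real (Suc k))" for k
    by simp
  then obtain y where y: "\<And>k. y k \<in> NB n" "\<And>k. hdist H (y k) v < inverse (real (Suc k))"
    by metis
  have yH: "y k \<in> carrier H" for k
    using y(1) NB_subset hball_subset by blast
  have near: "\<exists>K. \<forall>k\<ge>K. hdist H (y k) v < \<epsilon>" if \<epsilon>: "\<epsilon> > 0" for \<epsilon>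
  proof -
    obtain K where K: "inverse (real (Suc K)) < \<epsilon>"
      using reals_Archimedean[OF \<epsilon>] by blast
    have "hdist H (y k) v < \<epsilon>" if "k \<ge> K" for k
    proof -
      have "inverse (real (Suc k)) \<le> inverse (real (Suc K))"
        using that by (intro le_imp_inverse_le) auto
      then show ?thesis
        using y(2)[of k] K by linarith
    qed
    then show ?thesis by blast
  qed
  note tri = Metric_space.triangle[OF Metric_space_hdist]
  note com = Metric_space.commute[OF Metric_space_hdist]
  obtain l where l: "l \<in> NB n" "\<And>\<epsilon>. \<epsilon> > 0 \<Longrightarrow> \<exists>K::nat. \<forall>k\<ge>K. hdist H (y k) l < \<epsilon>"
  proof (rule mcompleteD[OF Metric_space_NB mcomplete_NB y(1)])
    fix \<epsilon> :: real assume "\<epsilon> > 0"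
    then obtain K where K: "\<forall>k\<ge>K. hdist H (y k) v < \<epsilon> / 2"
      using near half_gt_zero by blast
    have "hdist H (y i) (y j) < \<epsilon>" if "i \<ge> K" "j \<ge> K" for i j
    proof -
      have "hdist H (y i) v < \<epsilon> / 2" "hdist H (y j) v < \<epsilon> / 2"
        using K that by auto
      then show ?thesis
        using tri[OF yH[of i] vH yH[of j]] com[of v "y j"] by linarith
    qed
    then show "\<exists>K. \<forall>i\<ge>K. \<forall>j\<ge>K. hdist H (y i) (y j) < \<epsilon>"
      by blast
  qed (rule that)
  have lH: "l \<in> carrier H"
    using l(1) NB_subset hball_subset by blast
  have "hdist H l v < \<epsilon>" if \<epsilon>: "\<epsilon> > 0" for \<epsilon>
  proof -
    obtain K1 K2 where "\<forall>k\<ge>K1. hdist H (y k) v < \<epsilon> / 2" "\<forall>k\<ge>K2. hdist H (y k) l < \<epsilon> / 2"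
      using near[OF half_gt_zero[OF \<epsilon>]] l(2)[OF half_gt_zero[OF \<epsilon>]] by blast
    then have "hdist H (y (max K1 K2)) v < \<epsilon> / 2" "hdist H (y (max K1 K2)) l < \<epsilon> / 2"
      by auto
    then show ?thesis
      using tri[OF lH yH[of "max K1 K2"] vH] com[of l "y (max K1 K2)"] by linarith
  qed
  then have "hdist H l v = 0"
    using Metric_space.nonneg[OF Metric_space_hdist, of l v] by (metis less_irrefl order_le_less)
  then have "l = v"
    using Metric_space.zero[OF Metric_space_hdist lH vH] by simp
  then show ?thesis
    using l(1) by simp
qed

text \<open>Identifies the sorts of \<open>N\<close> with the balls of its own Hilbert space. The
  harder inclusion lowers the index of the sort in which \<open>v\<close> happens to occur to the
  one given by its norm.\<close>

lemma NB_eq: "NB n = hball H0 n"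
proof (intro equalityI subsetI)
  fix v assume "v \<in> NB n"
  then show "v \<in> hball H0 n"
    using NB_subset[of n] by (auto simp: hball_def)
next
  fix v assume "v \<in> hball H0 n"
  then obtain m where m: "v \<in> NB m" "hnorm H v \<le> real n"
    by (auto simp: hball_def)
  show "v \<in> NB n"
  proof (cases "n < m")
    case True
    then show ?thesis using m by (rule mem_NB_of_norm_le)
  next
    case False
    then show ?thesis using m(1) NB_mono[of m n] by auto
  qed
qed

lemma hball_H0_subset: "hball H0 n \<subseteq> hball H n"
  using NB_subset NB_eq by simp

text \<open>A Cauchy sequence is bounded, so a tail lies in one ball, which by \<open>NB_eq\<close>
  is a sort of \<open>N\<close> and therefore complete.\<close>

lemma mcomplete_H0: "Metric_space.mcomplete (carrier H0) (hdist H0)"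
  unfolding mcomplete_iff[OF H0.Metric_space_hdist]
proof (intro allI impI, elim conjE)
  fix \<sigma> :: "nat \<Rightarrow> 'h"
  assume \<sigma>0: "\<forall>n. \<sigma> n \<in> carrier H0"
    and C: "\<forall>\<epsilon>>0. \<exists>K. \<forall>m\<ge>K. \<forall>n\<ge>K. hdist H0 (\<sigma> m) (\<sigma> n) < \<epsilon>"
  have \<sigma>: "\<sigma> n \<in> carrier H0" for n
    using \<sigma>0 by blast
  obtain K where K: "\<forall>m\<ge>K. \<forall>n\<ge>K. hdist H0 (\<sigma> m) (\<sigma> n) < 1"
    using C zero_less_one by blast
  obtain B :: nat where B: "hnorm H0 (\<sigma> K) + 1 \<le> real B"
    using real_arch_simple by blast
  have \<tau>: "\<sigma> (n + K) \<in> NB B" for n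
  proof -
    have "hdist H0 (\<sigma> (n + K)) (\<sigma> K) < 1"
      using K by simp
    then have "hnorm H0 (\<sigma> (n + K)) \<le> real B"
      using H0.norm_diff_abs_le[OF \<sigma>[of "n + K"] \<sigma>[of K]] H0.hdist_eq[OF \<sigma>[of "n + K"] \<sigma>[of K]] B by linarith
    then show ?thesis
      using \<sigma>[of "n + K"] unfolding NB_eq hball_def by blast
  qed
  obtain l where l: "l \<in> NB B" "\<And>\<epsilon>. \<epsilon> > 0 \<Longrightarrow> \<exists>M::nat. \<forall>n\<ge>M. hdist H (\<sigma> (n + K)) l < \<epsilon>"
  proof (rule mcompleteD[OF Metric_space_NB mcomplete_NB \<tau>])
    fix \<epsilon> :: real assume "\<epsilon> > 0"
    then obtain M where M: "\<forall>m\<ge>M. \<forall>n\<ge>M. hdist H0 (\<sigma> m) (\<sigma> n) < \<epsilon>"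
      using C by blast
    have "hdist H (\<sigma> (m + K)) (\<sigma> (n + K)) < \<epsilon>" if "m \<ge> M" "n \<ge> M" for m n
      using M that hdist_H0[OF \<sigma> \<sigma>, of "m + K" "n + K"] by (metis trans_le_add1)
    then show "\<exists>M. \<forall>m\<ge>M. \<forall>n\<ge>M. hdist H (\<sigma> (m + K)) (\<sigma> (n + K)) < \<epsilon>"
      by blast
  qed (rule that)
  have l0: "l \<in> carrier H0"
    using l(1) by auto
  show "\<exists>l\<in>carrier H0. \<forall>\<epsilon>>0. \<exists>M. \<forall>n\<ge>M. hdist H0 (\<sigma> n) l < \<epsilon>"
  proof (intro bexI[OF _ l0] allI impI)
    fix \<epsilon> :: real assume "\<epsilon> > 0"
    then obtain M where M: "\<forall>n\<ge>M. hdist H (\<sigma> (n + K)) l < \<epsilon>"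
      using l(2) by blast
    have "hdist H0 (\<sigma> n) l < \<epsilon>" if "n \<ge> M + K" for n
    proof -
      have "hdist H (\<sigma> (n - K + K)) l < \<epsilon>"
        using that by (intro M[rule_format]) simp
      then show ?thesis
        using that hdist_H0[OF \<sigma>[of n] l0] by simp
    qed
    then show "\<exists>M. \<forall>n\<ge>M. hdist H0 (\<sigma> n) l < \<epsilon>"
      by blast
  qed
qed

end


section \<open>Transfer of dimension, action and invariance to the substructure\<close>

context elementary_action
begin

text \<open>Suppose \<open>E\<close> is a finite orthonormal basis of \<open>H0\<close>. A unit
  vector of \<open>H\<close> orthogonal to \<open>E\<close> gives, by elementarity, a vector of
  \<open>H0\<close> of norm near 1 with small coefficients on \<open>E\<close>, and Parseval's
  identity in \<open>H0\<close> makes its norm small.\<close>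

lemma infinite_dimensional_H0: "\<not> finite_dimensional H0"
proof
  assume "finite_dimensional H0"
  then obtain E where E: "H0.orthonormal E" "\<And>v. v \<in> carrier H0 \<Longrightarrow> H0.proj E v = v"
    using H0.finite_dimensional_iff by auto
  then have fin: "finite E" and E0: "E \<subseteq> carrier H0"
    and on: "\<And>e e'. e \<in> E \<Longrightarrow> e' \<in> E \<Longrightarrow> inprod H e e' = (if e = e' then 1 else 0)"
    by (auto simp: H0.orthonormal_def)
  have EH: "orthonormal E"
    unfolding orthonormal_def using fin E0 carrier_H0_subset on by auto
  have E1: "e \<in> NB 1" if "e \<in> E" for e
  proof -
    have "hnorm H e = 1"
      using on[OF that that] by (simp add: hnorm_def)
    then show ?thesis
      using that E0 unfolding NB_eq by (auto simp: hball_def)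
  qed
  obtain y where y: "y \<in> carrier H" "inprod H y y = 1" "\<And>e. e \<in> E \<Longrightarrow> inprod H y e = 0"
    using infinite_dimensional_orthogonal_unit[OF hilbert_space.infinite_dimensional[OF hilbert] EH] by blast
  obtain es where es: "set es = E"
    using finite_list[OF fin] by blast
  let ?B = "BSort 1" and ?k = "length es"
  \<comment> \<open>Variable 0 is kept for the vector sought, and variable i + 1 names the i-th
    element of the supposed basis.\<close>
  define a where "a = base(?B := (\<lambda>n. case n of 0 \<Rightarrow> Inr \<zero>\<^bsub>H\<^esub>
      | Suc i \<Rightarrow> if i < ?k then Inr (es ! i) else Inr \<zero>\<^bsub>H\<^esub>))"
  have a: "assignment N a"
    using assignment_base E1 es zero_NB
    by (auto simp: a_def assignment_def sort_B split: nat.split)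
  let ?\<phi> = "Pred (ReInner 1) [Var ?B 0, Var ?B 0] :: (asort, asym, hpred) fml"
  let ?re = "\<lambda>i. Pred (ReInner 1) [Var ?B 0, Var ?B (Suc i)] :: (asort, asym, hpred) fml"
  let ?im = "\<lambda>i. Pred (ImInner 1) [Var ?B 0, Var ?B (Suc i)] :: (asort, asym, hpred) fml"
  let ?\<phi>s = "map ?re [0..<?k] @ map ?im [0..<?k]"
  let ?a = "\<lambda>x. a(?B := (a ?B)(0 := x))"
  have fv: "fval A (?a x) ?\<phi> = Re (inprod H (projr x) (projr x))"
    "i < ?k \<Longrightarrow> fval A (?a x) (?re i) = Re (inprod H (projr x) (es ! i))"
    "i < ?k \<Longrightarrow> fval A (?a x) (?im i) = Im (inprod H (projr x) (es ! i))" for x i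
    by (simp_all add: a_def)
  \<comment> \<open>Real and imaginary parts below \<open>\<eta>\<close> give coefficients of
    modulus at most \<open>2 * \<eta>\<close>. Since \<open>card E * \<eta>\<close> is at most 1/4,
    the sum of their squares is at most \<open>\<eta>\<close>, hence at most 1/4, while the squared
    norm exceeds 3/4.\<close>
  define \<eta> where "\<eta> = 1 / (4 * real (Suc (card E)))"
  have \<eta>: "\<eta> > 0" "\<eta> \<le> 1 / 4"
    by (auto simp: \<eta>_def field_simps)
  obtain x where x: "x \<in> sort_set N ?B" "\<bar>1 - fval A (?a x) ?\<phi>\<bar> < \<eta>"
    "\<And>\<psi>. \<psi> \<in> set ?\<phi>s \<Longrightarrow> \<bar>fval A (?a x) \<psi>\<bar> < \<eta>"
  proof (rule elementary_approx[OF el _ _ a, of ?\<phi> ?\<phi>s ?B 0 \<eta>])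
    show "\<exists>x\<in>sort_set A ?B. fval A (?a x) ?\<phi> = 1 \<and> (\<forall>\<psi>\<in>set ?\<phi>s. \<bar>fval A (?a x) \<psi>\<bar> < \<epsilon>)"
      if "\<epsilon> > 0" for \<epsilon>
    proof (intro bexI[of _ "Inr y"] conjI ballI)
      show "Inr y \<in> sort_set A ?B"
        using y by (simp add: hball_def hnorm_def)
      show "fval A (?a (Inr y)) ?\<phi> = 1"
        unfolding fv using y by simp
      fix \<psi> assume "\<psi> \<in> set ?\<phi>s"
      then obtain i where "i < ?k" "\<psi> = ?re i \<or> \<psi> = ?im i"
        by auto
      moreover have "inprod H y (es ! i) = 0" if "i < ?k" for i
        using that es by (intro y(3)) auto
      ultimately have "fval A (?a (Inr y)) \<psi> = 0"
        using fv(2,3)[of i "Inr y"] by auto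
      then show "\<bar>fval A (?a (Inr y)) \<psi>\<bar> < \<epsilon>"
        using that by simp
    qed
  qed (use \<eta> in auto)
  define v where "v = projr x"
  have vB: "v \<in> NB 1"
    using x(1) by (auto simp: v_def sort_B)
  then have v0: "v \<in> carrier H0"
    by auto
  have "1 - \<eta> < Re (inprod H v v)"
    using x(2) unfolding fv v_def by linarith
  also have "Re (inprod H v v) = (\<Sum>e\<in>E. (cmod (inprod H v e))\<^sup>2)"
    using H0.sum_inprod_orthonormal[OF E(1) v0 E(2)[OF v0]] by simp
  also have "\<dots> \<le> of_nat (card E) * (2 * \<eta>)\<^sup>2"
  proof (rule sum_bounded_above)
    fix e assume "e \<in> E"
    then obtain i where i: "i < ?k" "e = es ! i"
      using es by (auto simp: in_set_conv_nth)
    have "\<bar>Re (inprod H v e)\<bar> < \<eta>" "\<bar>Im (inprod H v e)\<bar> < \<eta>"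
      using x(3)[of "?re i"] x(3)[of "?im i"] fv(2,3)[OF i(1), of x] i by (auto simp: v_def)
    then have "cmod (inprod H v e) \<le> 2 * \<eta>"
      using cmod_le[of "inprod H v e"] by linarith
    then show "(cmod (inprod H v e))\<^sup>2 \<le> (2 * \<eta>)\<^sup>2"
      by (intro power_mono) auto
  qed
  also have "\<dots> \<le> 1 / 4"
  proof -
    have "real (card E) * \<eta> \<le> 1 / 4"
      by (simp add: \<eta>_def field_simps)
    then have "real (card E) * \<eta> * (4 * \<eta>) \<le> 1 / 4 * (4 * \<eta>)"
      using \<eta> by (intro mult_right_mono) auto
    then show ?thesis
      using \<eta>(2) by (simp add: power2_eq_square algebra_simps)
  qed
  finally show False
    using \<eta>(2) by linarith
qed

lemma hilbert_space_H0: "hilbert_space H0"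
  by (intro hilbert_space.intro hilbert_space_axioms.intro mcomplete_H0 infinite_dimensional_H0
      H0.module_axioms H0.inprod_commute H0.inprod_add_left H0.inprod_scale_left H0.inprod_nonneg H0.inprod_definite)

lemma rep_H0: "unitary_representation G0 H0 \<pi>"
proof (rule unitary_representationI)
  show "group G0"
    using metric_group_G0 by (rule metric_group.axioms(1))
  have H: "v \<in> carrier H" if "v \<in> carrier H0" for v
    using that carrier_H0_subset by blast
  have Gc: "g \<in> carrier G" if "g \<in> carrier G0" for g
    using that NG_subset by auto
  fix g v w c assume g: "g \<in> carrier G0" and v: "v \<in> carrier H0"
  show "\<pi> g v \<in> carrier H0"
    using g v H0_closed(4) by simp
  show "\<pi> g (c \<odot>\<^bsub>H0\<^esub> v) = c \<odot>\<^bsub>H0\<^esub> \<pi> g v"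
    using Gc[OF g] H[OF v] by (simp add: act_scale)
  show "\<pi> (g \<otimes>\<^bsub>G0\<^esub> h) v = \<pi> g (\<pi> h v)" if "h \<in> carrier G0" for h
    using Gc[OF g] Gc[OF that] H[OF v] by (simp add: act_mult)
  assume w: "w \<in> carrier H0"
  show "\<pi> g (v \<oplus>\<^bsub>H0\<^esub> w) = \<pi> g v \<oplus>\<^bsub>H0\<^esub> \<pi> g w"
    using Gc[OF g] H[OF v] H[OF w] by (simp add: act_add)
  show "inprod H0 (\<pi> g v) (\<pi> g w) = inprod H0 v w"
    using Gc[OF g] H[OF v] H[OF w] by (simp add: act_inprod)
next
  show "\<pi> \<one>\<^bsub>G0\<^esub> v = v" if "v \<in> carrier H0" for v
    using act_one[OF subsetD[OF carrier_H0_subset that]] by simp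
qed (rule pre_hilbert_H0)

sublocale rep0: unitary_rep H0 G0 \<pi>
  by (intro unitary_rep.intro unitary_rep_axioms.intro pre_hilbert_H0 rep_H0)

lemma F_continuous_H0:
  assumes "F_continuous F G d H \<pi>"
  shows "F_continuous F G0 d H0 \<pi>"
  unfolding F_continuous_def
proof (intro allI impI ballI)
  fix i :: nat and g g' v and \<epsilon> :: real
  assume *: "1 \<le> i" "g \<in> carrier G0" "g' \<in> carrier G0" "v \<in> hball H0 i" "0 < \<epsilon>" "d g g' < F i \<epsilon>"
  have "v \<in> carrier H0"
    using *(4) by (simp add: hball_def)
  then have "\<pi> g v \<in> carrier H0" "\<pi> g' v \<in> carrier H0"
    using *(2,3) by (auto intro: rep0.act_closed simp del: H0_simps(1))
  moreover have "hnorm H (\<pi> g v \<ominus>\<^bsub>H\<^esub> \<pi> g' v) < \<epsilon>"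
  proof -
    have "g \<in> carrier G" "g' \<in> carrier G" "v \<in> hball H i"
      using * NG_subset hball_H0_subset by auto
    then show ?thesis
      using assms *(1,5,6) unfolding F_continuous_def by blast
  qed
  ultimately show "hnorm H0 (\<pi> g v \<ominus>\<^bsub>H0\<^esub> \<pi> g' v) < \<epsilon>"
    by (simp add: minus_H0 del: H0_simps(1))
qed

text \<open>\<open>N\<close> agrees with \<open>A\<close> on its own tuples, so it remains to
  compare \<open>A\<close> with the structure of the restricted carriers. Group inverse and vector
  subtraction, both defined through the carrier, are the symbols that need an argument.\<close>

lemma same_structure_N: "same_structure action_lang N (action_structure G0 d H0 \<pi>)"
proof (rule same_structureI)
  show "sort_set N s = sort_set (action_structure G0 d H0 \<pi>) s" for s
    by (cases s) (simp_all add: sort_G sort_B NB_eq)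
  show "metric N s x y = metric (action_structure G0 d H0 \<pi>) s x y"
    if xy: "x \<in> sort_set N s" "y \<in> sort_set N s" for s x y
  proof (cases s)
    case GSort
    then show ?thesis
      using xy by (auto simp: sort_G metric_N)
  next
    case (BSort n)
    then obtain v w where vw: "x = Inr v" "y = Inr w" "v \<in> NB n" "w \<in> NB n"
      using xy by (auto simp: sort_B)
    then have "v \<in> carrier H0" "w \<in> carrier H0"
      by auto
    then show ?thesis
      using vw BSort by (simp add: metric_N hdist_H0 del: H0_simps(1))
  qed
  show "fint N f xs = fint (action_structure G0 d H0 \<pi>) f xs"
    if f: "f \<in> fsyms action_lang" and xs: "xs \<in> tuples N (fargs action_lang f)" for f xs
  proof -
    have "fint N f xs = fint A f xs"
      using sub f xs by (simp add: substructure_def)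
    also have "\<dots> = fint (action_structure G0 d H0 \<pi>) f xs"
    proof (cases f)
      case (GSym g)
      then show ?thesis
        using xs G.m_inv_consistent[OF subgroup_NG]
        by (cases g) (auto simp: tuples_simps sort_G G0_def)
    next
      case (HSym h)
      show ?thesis
      proof (cases h)
        case (HSub m)
        then obtain v w where vw: "xs = [Inr v, Inr w]" "v \<in> NB m" "w \<in> NB m"
          using xs HSym by (auto simp: tuples_simps sort_B)
        then have "v \<in> carrier H0" "w \<in> carrier H0"
          by auto
        then show ?thesis
          using vw HSym HSub minus_H0[of v w] by (simp del: H0_simps(1))
      qed (use HSym in simp_all)
    qed simp
    finally show ?thesis .
  qed
  show "rint N r xs = rint (action_structure G0 d H0 \<pi>) r xs"
    if "r \<in> rsyms action_lang" "xs \<in> tuples N (rargs action_lang r)" for r xs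
  proof -
    have "rint N r xs = rint A r xs"
      using sub that by (simp add: substructure_def)
    then show ?thesis
      by (cases r) simp_all
  qed
qed

lemma closed_N: "f \<in> fsyms action_lang \<Longrightarrow> xs \<in> tuples N (fargs action_lang f) \<Longrightarrow>
    fint N f xs \<in> sort_set N (fres action_lang f)"
  using cont unfolding continuous_structure_def by blast

lemma closed_A: "f \<in> fsyms action_lang \<Longrightarrow> xs \<in> tuples A (fargs action_lang f) \<Longrightarrow>
    fint A f xs \<in> sort_set A (fres action_lang f)"
  by (rule action_structure_closed[OF G.metric_group_axioms unitary_rep_axioms])

lemma elementary_G0: "elementary_substructure group_lang (group_structure G0 d) (group_structure G d)"
proof (rule elementary_reduct[OF _ _ el])
  \<comment> \<open>A placeholder: the group language has no predicate symbols to be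
    renamed.\<close>
  let ?R = "\<lambda>_ :: unit. ReInner 0"
  show "reduct group_lang action_lang (\<lambda>_. GSort) GSym ?R Inl (group_structure G0 d) N"
    by (intro reduct.intro lang_morphism_group inj_Inl closed_N
        reduct_via_same_structure[OF lang_morphism_group reduct_via_group same_structure_N])
  show "reduct group_lang action_lang (\<lambda>_. GSort) GSym ?R Inl (group_structure G d) A"
    by (intro reduct.intro lang_morphism_group inj_Inl closed_A reduct_via_group)
  have "fint (group_structure G0 d) f xs = fint (group_structure G d) f xs"
    if "xs \<in> tuples (group_structure G0 d) (fargs group_lang f)" for f xs
    using that G.m_inv_consistent[OF subgroup_NG] by (cases f) (auto simp: tuples_simps G0_def)
  then show "substructure group_lang (group_structure G0 d) (group_structure G d)"
    using NG_subset by (simp add: substructure_def)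
  show "Metric_space (sort_set (group_structure G0 d) s) (metric (group_structure G0 d) s)" for s
    using Metric_space_NG by simp
qed

lemma elementary_H0: "elementary_substructure hilbert_lang (hilbert_structure H0) (hilbert_structure H)"
proof (rule elementary_reduct[OF _ _ el])
  show "reduct hilbert_lang action_lang BSort HSym id Inr (hilbert_structure H0) N"
    by (intro reduct.intro lang_morphism_hilbert inj_Inr closed_N
        reduct_via_same_structure[OF lang_morphism_hilbert reduct_via_hilbert same_structure_N])
  show "reduct hilbert_lang action_lang BSort HSym id Inr (hilbert_structure H) A"
    by (intro reduct.intro lang_morphism_hilbert inj_Inr closed_A reduct_via_hilbert)
  have B0: "v \<in> carrier H0" if "v \<in> hball H0 n" for v n
    using that by (simp add: hball_def)
  have f: "fint (hilbert_structure H0) f xs = fint (hilbert_structure H) f xs"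
    if xs: "xs \<in> tuples (hilbert_structure H0) (hsym_args f)" for f xs
  proof (cases f)
    case (HSub m)
    then obtain v w where vw: "xs = [v, w]" "v \<in> hball H0 m" "w \<in> hball H0 m"
      using xs by (auto simp: tuples_simps)
    then show ?thesis
      using HSub minus_H0[OF B0[OF vw(2)] B0[OF vw(3)]] by simp
  qed simp_all
  have r: "rint (hilbert_structure H0) r xs = rint (hilbert_structure H) r xs" for r xs
    by (cases r) simp_all
  show "substructure hilbert_lang (hilbert_structure H0) (hilbert_structure H)"
    using hball_H0_subset B0 hdist_H0 f r by (simp add: substructure_def)
  show "Metric_space (sort_set (hilbert_structure H0) s) (metric (hilbert_structure H0) s)" for s
    using H0.Metric_space_hball by simp
qed

text \<open>With \<open>v\<close> as parameter, invariance under the smaller group is the vanishing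
  of a supremum over the group sort of \<open>N\<close>. By elementarity the supremum over
  \<open>G\<close> vanishes too, and \<open>v\<close> would be a unit vector fixed by
  \<open>G\<close>.\<close>

lemma no_invariant_H0:
  assumes no: "\<not> (\<exists>v. invariant_vector G H \<pi> v \<and> hnorm H v = 1)"
  shows "\<not> (\<exists>v. invariant_vector G0 H0 \<pi> v \<and> hnorm H0 v = 1)"
proof
  assume "\<exists>v. invariant_vector G0 H0 \<pi> v \<and> hnorm H0 v = 1"
  then obtain v where v: "v \<in> carrier H0" "\<And>g. g \<in> NG \<Longrightarrow> \<pi> g v = v" "hnorm H v = 1"
    by (auto simp: invariant_vector_def)
  have vH: "v \<in> carrier H"
    using v(1) carrier_H0_subset by blast
  \<comment> \<open>The norm puts \<open>v\<close> into the sort of index 1, whichever sort it came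
    from, so a single formula about that sort suffices.\<close>
  have vB: "v \<in> NB 1"
    unfolding NB_eq using v(1,3) by (simp add: hball_def)
  define a where "a = base(BSort 1 := (base (BSort 1))(0 := Inr v))"
  let ?\<psi> = "Dist (BSort 1) (Fun (Act 1) [Var GSort 0, Var (BSort 1) 0]) (Var (BSort 1) 0) :: (asort, asym, hpred) fml"
  let ?a = "\<lambda>x. a(GSort := (a GSort)(0 := x))"
  have a: "assignment N a"
    unfolding a_def using vB by (intro assignment_update assignment_base) (simp add: sort_B)
  have fv: "fval A (?a x) ?\<psi> = hdist H (\<pi> (projl x) v) v" for x
    by (simp add: a_def)
  have "\<pi> g v = v" if g: "g \<in> carrier G" for g
  proof -
    have "fval A (?a (Inl g)) ?\<psi> = 0"
    proof (rule elementary_sup_zero[OF el _ a, of ?\<psi> GSort 0 2])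
      show "wff action_lang ?\<psi>"
        by simp
      show "0 \<le> fval A (?a x) ?\<psi>" for x
        unfolding fv by (rule Metric_space.nonneg[OF Metric_space_hdist])
      show "fval A (?a x) ?\<psi> \<le> 2" if "x \<in> sort_set A GSort" for x
      proof -
        have "hdist H (\<pi> (projl x) v) v \<le> 2 * real 1"
          using that vB NB_subset by (intro hdist_hball_le act_hball) auto
        then show ?thesis
          unfolding fv by simp
      qed
      show "fval A (?a x) ?\<psi> = 0" if "x \<in> sort_set N GSort" for x
      proof -
        have "\<pi> (projl x) v = v"
          using that v(2) by (auto simp: sort_G)
        then show ?thesis
          unfolding fv using Metric_space.mdist_zero[OF Metric_space_hdist vH] by simp
      qed
    qed (use g in simp)
    then have "hdist H (\<pi> g v) v = 0"
      unfolding fv by simp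
    then show ?thesis
      using Metric_space.zero[OF Metric_space_hdist, of "\<pi> g v" v] g vH by simp
  qed
  then show False
    using no v(3) vH by (auto simp: invariant_vector_def)
qed

text \<open>The points of a finite net of \<open>Q\<close> become parameters of one formula. Being
  finite, the net is compact in \<open>G\<close>, so \<open>H\<close> has vectors almost invariant
  under it with any tolerance.\<close>

lemma almost_contains_unit_H0:
  assumes ac: "almost_contains_unit G d H \<pi>" and F: "continuity_moduli F" "F_continuous F G d H \<pi>"
  shows "almost_contains_unit G0 d H0 \<pi>"
  unfolding almost_contains_unit_def
proof (intro allI impI)
  interpret G0: metric_group G0 d by (rule metric_group_G0)
  fix Q and \<epsilon> :: real
  assume Q: "compactin (group_topology G0 d) Q" and \<epsilon>: "0 < \<epsilon>"
  have QG: "Q \<subseteq> carrier G0"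
    using compactin_subset_topspace[OF Q] by (simp only: G0.topspace_mtopology)
  \<comment> \<open>A point of \<open>Q\<close> displaces \<open>v\<close> by less than
    \<open>\<epsilon> / 8\<close> for the passage to a net point and \<open>\<epsilon> / 8\<close>
    for the displacement by that point; normalization doubles the resulting
    \<open>\<epsilon> / 4\<close>.\<close>
  define \<eta> where "\<eta> = min (1/2) (\<epsilon> / 8)"
  have \<eta>: "0 < \<eta>" "\<eta> \<le> 1/2" "\<eta> \<le> \<epsilon> / 8"
    using \<epsilon> by (auto simp: \<eta>_def)
  have F1: "0 < F 1 (\<epsilon> / 8)"
    using F(1) \<epsilon> by (simp add: continuity_moduli_def)
  obtain S where S: "finite S" "S \<subseteq> Q" "\<And>x. x \<in> Q \<Longrightarrow> \<exists>y\<in>S. d y x < F 1 (\<epsilon> / 8)"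
    using G0.compact_net[OF Q F1] by blast
  obtain gs where gs: "set gs = S"
    using finite_list[OF S(1)] by blast
  have gsN: "set gs \<subseteq> NG"
    using gs S(2) QG by auto
  then have gsG: "set gs \<subseteq> carrier G"
    using NG_subset by blast
  have gs_compact: "compactin G.mtopology (set gs)"
    using gsG by (intro finite_imp_compactin) auto
  \<comment> \<open>The i-th variable of the group sort names the i-th net point, and the vector
    sought is variable 0 of its own sort.\<close>
  define a where "a = base(GSort := (\<lambda>i. if i < length gs then Inl (gs ! i) else Inl \<one>\<^bsub>G\<^esub>))"
  have a: "assignment N a"
    using assignment_base subsetD[OF gsN nth_mem] NG_closed(3) by (auto simp: a_def assignment_def sort_G)
  let ?B = "BSort 1"
  let ?\<phi> = "Pred (ReInner 1) [Var ?B 0, Var ?B 0] :: (asort, asym, hpred) fml"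
  let ?\<psi> = "\<lambda>i. Dist ?B (Fun (Act 1) [Var GSort i, Var ?B 0]) (Var ?B 0) :: (asort, asym, hpred) fml"
  let ?\<phi>s = "map ?\<psi> [0..<length gs]"
  let ?a = "\<lambda>x. a(?B := (a ?B)(0 := x))"
  have fv: "fval A (?a x) ?\<phi> = Re (inprod H (projr x) (projr x))"
    "i < length gs \<Longrightarrow> fval A (?a x) (?\<psi> i) = hdist H (\<pi> (gs ! i) (projr x)) (projr x)" for x i
    by (simp_all add: a_def)
  obtain x where x: "x \<in> sort_set N ?B" "\<bar>1 - fval A (?a x) ?\<phi>\<bar> < \<eta>"
    "\<And>\<psi>. \<psi> \<in> set ?\<phi>s \<Longrightarrow> \<bar>fval A (?a x) \<psi>\<bar> < \<eta>"
  proof (rule elementary_approx[OF el _ _ a, of ?\<phi> ?\<phi>s ?B 0 \<eta>])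
    fix \<epsilon> :: real assume "0 < \<epsilon>"
    then obtain u where "almost_invariant_unit_vector H \<pi> (set gs) \<epsilon> u"
      using ac gs_compact unfolding almost_contains_unit_def by blast
    note u = almost_invariant_unit_vectorD[OF this gsG]
    show "\<exists>x\<in>sort_set A ?B. fval A (?a x) ?\<phi> = 1 \<and> (\<forall>\<psi>\<in>set ?\<phi>s. \<bar>fval A (?a x) \<psi>\<bar> < \<epsilon>)"
    proof (intro bexI[of _ "Inr u"] conjI ballI)
      show "Inr u \<in> sort_set A ?B"
        using u by (simp add: hball_def)
      show "fval A (?a (Inr u)) ?\<phi> = 1"
        unfolding fv using norm_sq[OF u(1)] u(2) by simp
      fix \<psi> assume "\<psi> \<in> set ?\<phi>s"
      then obtain i where i: "i < length gs" "\<psi> = ?\<psi> i"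
        by auto
      then have gi: "gs ! i \<in> set gs"
        by simp
      have "hdist H (\<pi> (gs ! i) u) u < \<epsilon>"
        using u(1) u(3)[OF gi] gi gsG by (simp add: hdist_eq subset_iff)
      then show "\<bar>fval A (?a (Inr u)) \<psi>\<bar> < \<epsilon>"
        using fv(2)[OF i(1), of "Inr u"] i(2) Metric_space.nonneg[OF Metric_space_hdist] by simp
    qed
  qed (use \<eta> in auto)
  define v where "v = projr x"
  have vB: "v \<in> NB 1"
    using x(1) by (auto simp: v_def sort_B)
  then have v0: "v \<in> carrier H0"
    by auto
  have vH: "v \<in> carrier H" and v1: "v \<in> hball H 1"
    using vB NB_subset hball_subset by auto
  have near: "hdist H (\<pi> g v) v < \<eta>" if g: "g \<in> S" for g
  proof -
    obtain i where i: "i < length gs" "g = gs ! i"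
      using g gs by (auto simp: in_set_conv_nth)
    then show ?thesis
      using x(3)[of "?\<psi> i"] fv(2)[OF i(1), of x] by (auto simp: v_def)
  qed
  \<comment> \<open>The language has the inner product but no norm, so the formula controls the
    squared norm; from 1/2 one passes down to 1/4 in order to take the root.\<close>
  have "1/2 \<le> (hnorm H v)\<^sup>2"
    using x(2) \<eta>(2) norm_sq[OF vH] unfolding fv v_def by linarith
  then have "(1/2)\<^sup>2 \<le> (hnorm H v)\<^sup>2"
    by (simp add: power2_eq_square)
  then have "1/2 \<le> hnorm H v"
    by (rule power2_le_imp_le) (simp add: vH)
  then have v_half: "1/2 \<le> hnorm H0 v"
    by simp
  have "hnorm H0 (\<pi> q v \<ominus>\<^bsub>H0\<^esub> v) \<le> \<epsilon> / 4" if q: "q \<in> Q" for q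
  proof -
    have qN: "q \<in> NG" and qG: "q \<in> carrier G"
      using q QG NG_subset by auto
    obtain g where g: "g \<in> S" "d g q < F 1 (\<epsilon> / 8)"
      using S(3)[OF q] by blast
    have gG: "g \<in> carrier G"
      using g(1) gs gsG by blast
    have "hnorm H (\<pi> g v \<ominus>\<^bsub>H\<^esub> \<pi> q v) < \<epsilon> / 8"
      using F(2)[unfolded F_continuous_def, rule_format, of 1 g q v "\<epsilon> / 8"] gG qG v1 \<epsilon> g(2) by simp
    then have "hnorm H (\<pi> q v \<ominus>\<^bsub>H\<^esub> \<pi> g v) < \<epsilon> / 8"
      using norm_minus_commute[of "\<pi> g v" "\<pi> q v"] gG qG vH by simp
    moreover have "hnorm H (\<pi> g v \<ominus>\<^bsub>H\<^esub> v) < \<epsilon> / 8"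
      using near[OF g(1)] \<eta>(3) gG vH by (simp add: hdist_eq)
    moreover have "hnorm H (\<pi> q v \<ominus>\<^bsub>H\<^esub> v) \<le> hnorm H (\<pi> q v \<ominus>\<^bsub>H\<^esub> \<pi> g v) + hnorm H (\<pi> g v \<ominus>\<^bsub>H\<^esub> v)"
      using gG qG vH by (intro norm_minus_triangle) auto
    ultimately have "hnorm H (\<pi> q v \<ominus>\<^bsub>H\<^esub> v) \<le> \<epsilon> / 4"
      by linarith
    then show ?thesis
      using minus_H0[OF H0_closed(4)[OF qN v0] v0] by simp
  qed
  then show "\<exists>v. almost_invariant_unit_vector H0 \<pi> Q \<epsilon> v"
    using QG v0 v_half \<epsilon> by (intro rep0.almost_invariant_normalize[of Q v "\<epsilon> / 4"]) auto
qed

end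

text \<open>The type of the space in the second part is dictated by the Hilbert sum: its vectors are
  families indexed by pairs of a subset of the group and a natural number.\<close>

theorem theorem2p5:
  fixes F :: "nat \<Rightarrow> real \<Rightarrow> real"
    and G :: "'g monoid" and d :: "'g \<Rightarrow> 'g \<Rightarrow> real"
  assumes "continuity_moduli F"
    and "metric_group G d"
    and "locally_compact_space (group_topology G d)"
  shows
    "(\<forall>(H :: 'h inner_module) \<pi>.
        hilbert_space H \<longrightarrow> unitary_representation G H \<pi> \<longrightarrow> F_continuous F G d H \<pi> \<longrightarrow>
        (almost_contains_unit G d H \<pi> \<longleftrightarrow>
           (\<exists>\<delta> \<in> {0<..<1} \<inter> \<rat>. action_structure G d H \<pi> \<in> K_class \<delta> F)))
     \<and>
     ((\<forall>Q \<epsilon>. compactin (group_topology G d) Q \<longrightarrow> \<epsilon> > 0 \<longrightarrow>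
         (\<exists>(H :: 'k inner_module) \<pi>.
            hilbert_space H \<and> unitary_representation G H \<pi> \<and> F_continuous F G d H \<pi> \<and>
            (\<exists>v. almost_invariant_unit_vector H \<pi> Q \<epsilon> v) \<and>
            \<not> (\<exists>v. invariant_vector G H \<pi> v \<and> v \<noteq> \<zero>\<^bsub>H\<^esub>)))
      \<longrightarrow>
      (\<exists>(H :: ('g set \<times> nat \<Rightarrow> 'k) inner_module) \<pi>.
         hilbert_space H \<and> unitary_representation G H \<pi> \<and> F_continuous F G d H \<pi> \<and>
         almost_contains_unit G d H \<pi> \<and>
         \<not> (\<exists>v. invariant_vector G H \<pi> v \<and> hnorm H v = 1) \<and>
         (\<forall>N. elementary_substructure action_lang N (action_structure G d H \<pi>) \<longrightarrow>
            (\<exists>G\<^sub>0 d\<^sub>0 H\<^sub>0 \<pi>\<^sub>0.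
               metric_group G\<^sub>0 d\<^sub>0 \<and> hilbert_space H\<^sub>0 \<and>
               unitary_representation G\<^sub>0 H\<^sub>0 \<pi>\<^sub>0 \<and> F_continuous F G\<^sub>0 d\<^sub>0 H\<^sub>0 \<pi>\<^sub>0 \<and>
               same_structure action_lang N (action_structure G\<^sub>0 d\<^sub>0 H\<^sub>0 \<pi>\<^sub>0) \<and>
               elementary_substructure group_lang (group_structure G\<^sub>0 d\<^sub>0) (group_structure G d) \<and>
               elementary_substructure hilbert_lang (hilbert_structure H\<^sub>0) (hilbert_structure H) \<and>
               almost_contains_unit G\<^sub>0 d\<^sub>0 H\<^sub>0 \<pi>\<^sub>0 \<and>
               \<not> (\<exists>v. invariant_vector G\<^sub>0 H\<^sub>0 \<pi>\<^sub>0 v \<and> hnorm H\<^sub>0 v = 1)))))"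
  (is "?A \<and> (?B \<longrightarrow> ?C)")
proof (intro conjI impI)
  show ?A
    using almost_contains_unit_iff_K_class[OF assms(2,3)] by blast
  assume B: ?B
  obtain H :: "('g set \<times> nat \<Rightarrow> 'k) inner_module" and \<pi> where H: "hilbert_space H"
    "unitary_representation G H \<pi>" "F_continuous F G d H \<pi>" "almost_contains_unit G d H \<pi>"
    "\<not> (\<exists>v. invariant_vector G H \<pi> v \<and> hnorm H v = 1)"
    by (rule exists_almost_invariant_without_invariant[OF assms(2) B[rule_format]])
  show ?C
  proof (intro exI[of _ H] exI[of _ \<pi>] conjI allI impI; (rule H)?)
    fix N assume "elementary_substructure action_lang N (action_structure G d H \<pi>)"
    then interpret elementary_action G d H \<pi> N
      by (intro elementary_action.intro elementary_action_axioms.intro unitary_rep.intro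
          unitary_rep_axioms.intro hilbert_space.pre_hilbert assms(2) H)
    \<comment> \<open>The distance and the action remain the same functions; only the carriers of
      the group and of the Hilbert space shrink.\<close>
    show "\<exists>G\<^sub>0 d\<^sub>0 H\<^sub>0 \<pi>\<^sub>0.
               metric_group G\<^sub>0 d\<^sub>0 \<and> hilbert_space H\<^sub>0 \<and>
               unitary_representation G\<^sub>0 H\<^sub>0 \<pi>\<^sub>0 \<and> F_continuous F G\<^sub>0 d\<^sub>0 H\<^sub>0 \<pi>\<^sub>0 \<and>
               same_structure action_lang N (action_structure G\<^sub>0 d\<^sub>0 H\<^sub>0 \<pi>\<^sub>0) \<and>
               elementary_substructure group_lang (group_structure G\<^sub>0 d\<^sub>0) (group_structure G d) \<and>
               elementary_substructure hilbert_lang (hilbert_structure H\<^sub>0) (hilbert_structure H) \<and>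
               almost_contains_unit G\<^sub>0 d\<^sub>0 H\<^sub>0 \<pi>\<^sub>0 \<and>
               \<not> (\<exists>v. invariant_vector G\<^sub>0 H\<^sub>0 \<pi>\<^sub>0 v \<and> hnorm H\<^sub>0 v = 1)"
      by (intro exI[of _ G0] exI[of _ d] exI[of _ H0] exI[of _ \<pi>] conjI metric_group_G0
          hilbert_space_H0 rep_H0 F_continuous_H0[OF H(3)] same_structure_N elementary_G0 elementary_H0
          almost_contains_unit_H0[OF H(4) assms(1) H(3)] no_invariant_H0[OF H(5)])
  qed
qed

end
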